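(* Let $n\in\mathbb N_0$, $\beta,\gamma\in(-1,1)\setminus\{0\}$, $0<|q|<1$, $|t|<\min\{(1-\beta^2)(1+\sqrt q|\beta|),1\}$. Then, with $x=\cos\theta$, $$\int_{-1}^1{}_2\phi_1\!\left(\beta^{1/2}e^{i\theta},-(q\beta)^{1/2}e^{i\theta};-\beta q^{1/2};q,te^{-i\theta}\right)\,{}_2\phi_1\!\left((q\beta)^{1/2}e^{-i\theta},-\beta^{1/2}e^{-i\theta};-\beta q^{1/2};q,te^{i\theta}\right)C_n(x;\gamma|q)\frac{w(x;\gamma|q)}{\sqrt{1-x^2}}\,dx$$ $$=2\pi t^n\frac{(\gamma,q\gamma;q)_\infty(\gamma^2,\pm\beta,\beta q^{1/2};q)_n}{(\gamma^2,q;q)_\infty(\beta^2,-\beta q^{1/2},q\gamma,q;q)_n}\,\Phi_n,$$ where $\Phi_n$ is the series ${}_{10}\phi_9$ with base $q$, argument $\gamma t^2$, upper parameters $$\beta\gamma^{-1},\ \beta q^n,\ \pm i(\beta q^n)^{1/2},\ \pm i(\beta q^{n+1})^{1/2},\ \pm(\beta q^{n+1/2})^{1/2},\ \pm(\beta q^{n+3/2})^{1/2},$$ and lower parameters $$\gamma q^{n+1},\ \pm\beta q^{n/2},\ \pm\beta q^{(n+1)/2},\ \pm i(\beta q^{n+1/2})^{1/2},\ \pm i(\beta q^{n+3/2})^{1/2}.$$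
   Context: Notation: $\mathbb N_0=\{0,1,2,\dots\}$, $(a;q)_0=1$, $(a;q)_n=\prod_{j=0}^{n-1}(1-aq^j)$, $(a;q)_\infty=\prod_{j\ge0}(1-aq^j)$, $(a_1,\dots,a_r;q)_n=\prod_i(a_i;q)_n$ (also for $n=\infty$). In a list of parameters, $\pm a$ stands for the two entries $a,-a$. Square roots are taken consistently: $(q\beta)^{1/2}=q^{1/2}\beta^{1/2}$. The basic hypergeometric series, with upper parameters listed before the first semicolon and lower parameters before the second, is $${}_r\phi_s(a_1,\dots,a_r;b_1,\dots,b_s;q,z)=\sum_{k=0}^\infty\frac{(a_1,\dots,a_r;q)_k}{(q,b_1,\dots,b_s;q)_k}\left((-1)^kq^{\binom k2}\right)^{1+s-r}z^k.$$ The continuous $q$-ultraspherical/Rogers polynomials are, for $x=\cos\theta$, $$C_n(x;\beta|q)=\frac{(\beta;q)_n}{(q;q)_n}e^{in\theta}\,{}_2\phi_1\!\left(q^{-n},\beta;\beta^{-1}q^{1-n};q,q\beta^{-1}e^{-2i\theta}\right),$$ and the weight function $w$ on $(-1,1)$ is $$w(x;\beta|q)=\left|\frac{(e^{2i\theta};q)_\infty}{(\beta e^{2i\theta};q)_\infty}\right|^2.$$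
   Formalization: Here q is taken to be real with 0<|q|<1 (for non-real q the identity fails, e.g. n=0, t=0 and small imaginary q), and √q in the bound on |t| is read as √|q|, so that negative q is also covered. *)

theory Defs
  imports "HOL-Analysis.Analysis"
begin

definition qpoch :: "complex \<Rightarrow> complex \<Rightarrow> nat \<Rightarrow> complex" where
  "qpoch a q n = (\<Prod>j<n. 1 - a * q ^ j)"

definition qpoch_inf :: "complex \<Rightarrow> complex \<Rightarrow> complex" where
  "qpoch_inf a q = (\<Prod>j. 1 - a * q ^ j)"

definition qpochs :: "complex list \<Rightarrow> complex \<Rightarrow> nat \<Rightarrow> complex" where
  "qpochs as q n = (\<Prod>a\<leftarrow>as. qpoch a q n)"

definition qpochs_inf :: "complex list \<Rightarrow> complex \<Rightarrow> complex" where
  "qpochs_inf as q = (\<Prod>a\<leftarrow>as. qpoch_inf a q)"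

definition pm :: "complex \<Rightarrow> complex list" where
  "pm a = [a, - a]"

text \<open>
  The basic hypergeometric series; \<open>r\<close> and \<open>s\<close> are the lengths of the two parameter lists.
  For a terminating series, the terms beyond the last nonzero one vanish even if a lower
  parameter makes their denominator zero, since their numerator is zero.
\<close>

definition basic_hyp :: "complex list \<Rightarrow> complex list \<Rightarrow> complex \<Rightarrow> complex \<Rightarrow> complex" where
  "basic_hyp as bs q z =
     (\<Sum>k. qpochs as q k / qpochs (q # bs) q k
          * ((- 1) ^ k * q ^ (k choose 2)) powi (1 + int (length bs) - int (length as)) * z ^ k)"

text \<open>
  The two functions below are meant for \<open>x \<in> {-1..1}\<close>, where \<open>x = cos \<theta>\<close> with \<open>\<theta> = arccos x\<close>.
\<close>

definition rogers_C :: "nat \<Rightarrow> real \<Rightarrow> complex \<Rightarrow> complex \<Rightarrow> complex" where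
  "rogers_C n x \<beta> q =
     (let \<theta> = arccos x in
        qpoch \<beta> q n / qpoch q q n * exp (\<i> * of_nat n * of_real \<theta>)
        * basic_hyp [q powi (- int n), \<beta>] [inverse \<beta> * q powi (1 - int n)] q
            (q * inverse \<beta> * exp (- 2 * \<i> * of_real \<theta>)))"

definition rogers_w :: "real \<Rightarrow> complex \<Rightarrow> complex \<Rightarrow> real" where
  "rogers_w x \<beta> q =
     (let \<theta> = arccos x in
        (cmod (qpoch_inf (exp (2 * \<i> * of_real \<theta>)) q
               / qpoch_inf (\<beta> * exp (2 * \<i> * of_real \<theta>)) q))\<^sup>2)"

text \<open>
  The series \<open>\<Phi>\<^sub>n\<close>. All roots are built from the principal values of \<open>\<beta>\<^bsup>1/2\<^esup>\<close>, \<open>q\<^bsup>1/2\<^esup>\<close> and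
  \<open>q\<^bsup>1/4\<^esup> = (q\<^bsup>1/2\<^esup>)\<^bsup>1/2\<^esup>\<close>: for instance \<open>(\<beta> q\<^bsup>n\<^esup>)\<^bsup>1/2\<^esup>\<close> is \<open>\<beta>\<^bsup>1/2\<^esup> (q\<^bsup>1/2\<^esup>)\<^bsup>n\<^esup>\<close> and \<open>(\<beta> q\<^bsup>n+3/2\<^esup>)\<^bsup>1/2\<^esup>\<close> is
  \<open>\<beta>\<^bsup>1/2\<^esup> (q\<^bsup>1/4\<^esup>)\<^bsup>2n+3\<^esup>\<close>. This keeps \<open>(q \<beta>)\<^bsup>1/2\<^esup> = q\<^bsup>1/2\<^esup> \<beta>\<^bsup>1/2\<^esup>\<close> when both are negative, where
  \<open>csqrt (q * \<beta>)\<close> would have the opposite sign.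
\<close>

definition Phi :: "nat \<Rightarrow> complex \<Rightarrow> complex \<Rightarrow> complex \<Rightarrow> complex \<Rightarrow> complex" where
  "Phi n \<beta> \<gamma> q t =
     (let b = csqrt \<beta>; r = csqrt q; p = csqrt (csqrt q) in
        basic_hyp
          ([\<beta> * inverse \<gamma>, \<beta> * q ^ n]
            @ pm (\<i> * (b * r ^ n)) @ pm (\<i> * (b * r ^ (n + 1)))
            @ pm (b * p ^ (2 * n + 1)) @ pm (b * p ^ (2 * n + 3)))
          ([\<gamma> * q ^ (n + 1)]
            @ pm (\<beta> * r ^ n) @ pm (\<beta> * r ^ (n + 1))
            @ pm (\<i> * (b * p ^ (2 * n + 1))) @ pm (\<i> * (b * p ^ (2 * n + 3))))
          q (\<gamma> * t\<^sup>2))"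

end

theory Submission
  imports Defs "HOL-Computational_Algebra.Formal_Power_Series"
begin

text \<open>
  Write \<open>z = e\<^sup>i\<^sup>\<theta>\<close>. The product of the two series \<open>\<^sub>2\<phi>\<^sub>1\<close> is a generating function of the Rogers
  polynomials of parameter \<open>\<beta>\<close>: it equals \<open>\<Sum>\<^sub>m s\<^sub>m C\<^sub>m(x; \<beta>|q) t\<^sup>m\<close> with
  \<open>s\<^sub>m = (-\<beta>, \<beta> q\<^bsup>1/2\<^esup>; q)\<^sub>m / (\<beta>\<^sup>2, -\<beta> q\<^bsup>1/2\<^esup>; q)\<^sub>m\<close>. On the unit circle the series converges uniformly for
  \<open>|t| < 1\<close>, so that it may be integrated term by term. What remains are the integrals of
  \<open>C\<^sub>m(x; \<beta>|q) C\<^sub>n(x; \<gamma>|q)\<close> against the weight of parameter \<open>\<gamma>\<close>. They vanish unless \<open>m = n + 2 k\<close>, and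
  the surviving ones are, up to the splitting of shifted factorials of length \<open>n + 2 k\<close>, the terms
  of \<open>\<Phi>\<^sub>n\<close>.

  The integrals (\<open>integral_mixed\<close>). The three-term recurrence of either factor expands
  \<open>2 x C\<^sub>m(x; \<beta>|q) C\<^sub>n(x; \<gamma>|q)\<close>, and equating the two expansions determines the integrals for \<open>m + 1\<close> from
  those for \<open>m\<close> and \<open>m - 1\<close>. It therefore suffices to verify one polynomial identity and to treat
  \<open>m = 0\<close>, that is, to integrate a single Rogers polynomial.

  The case \<open>m = 0\<close> (\<open>integral_rogers\<close>, \<open>moment_0\<close>). By the \<open>q\<close>-binomial theorem the weight is
  \<open>A(z\<^sup>2) A(z\<^sup>-\<^sup>2)\<close> for an explicit power series \<open>A\<close>. Its moments are not obviously products, but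
  those of \<open>A(y) A(q / y)\<close> are, because this function satisfies a first-order \<open>q\<close>-difference equation, and
  the two are related by symmetrization. With the moments known up to a constant, the integral of
  \<open>C\<^sub>n\<close> for \<open>n \<ge> 1\<close> is a sum that telescopes to zero. The total mass follows from its behaviour under
  \<open>\<gamma> \<mapsto> q \<gamma>\<close> and continuity at \<open>\<gamma> = 0\<close>.

  The generating function (\<open>gf_coeff_eq_rogers\<close>). Let \<open>D\<^sub>m(z)\<close> be the coefficient of \<open>t\<^sup>m\<close> in the product of
  the two series, and \<open>p = - q\<^bsup>1/2\<^esup>\<close>. Both \<open>D\<^sub>m\<close> and \<open>s\<^sub>m C\<^sub>m\<close> obey the same lowering relation: the
  difference of the values at \<open>p z\<close> and \<open>z / p\<close> is a multiple of \<open>z - z\<^sup>-\<^sup>1\<close> times the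
  function of index \<open>m - 1\<close> with \<open>\<beta>\<close> replaced by \<open>\<beta> q\<close>. By induction \<open>D\<^sub>m - s\<^sub>m C\<^sub>m\<close> is a Laurent
  polynomial invariant under \<open>z \<mapsto> q z\<close>, hence constant, and it vanishes at \<open>z = \<beta>\<^bsup>-1/2\<^esup>\<close>.
\<close>

section \<open>Shifted factorials\<close>

lemma qpoch_0 [simp]: "qpoch a q 0 = 1"
  by (simp add: qpoch_def)

lemma qpoch_Suc: "qpoch a q (Suc n) = qpoch a q n * (1 - a * q ^ n)"
  by (simp add: qpoch_def)

lemma qpoch_Suc_left: "qpoch a q (Suc n) = (1 - a) * qpoch (a * q) q n"
  unfolding qpoch_def prod.lessThan_Suc_shift by (simp add: mult.assoc)

lemma qpoch_add: "qpoch a q (m + n) = qpoch a q m * qpoch (a * q ^ m) q n"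
  by (induction n) (simp_all add: qpoch_Suc power_add mult.assoc)

lemma qpoch_double: "qpoch a p (2 * n) = qpoch a (p\<^sup>2) n * qpoch (a * p) (p\<^sup>2) n"
proof (induction n)
  case (Suc n)
  have "p ^ (2 * n) = p\<^sup>2 ^ n"
    by (simp add: power_mult)
  with Suc show ?case
    by (simp add: qpoch_Suc mult_ac)
qed simp

lemma qpoch_pm: "qpoch a q n * qpoch (- a) q n = qpoch (a\<^sup>2) (q\<^sup>2) n"
  by (induction n)
    (simp_all add: qpoch_Suc algebra_simps power_mult[symmetric] power2_eq_square power_mult_distrib mult_2 power_add)

lemma one_minus_nonzero: "1 - x \<noteq> 0" if "norm x < 1" for x :: complex
  using that by auto

lemma norm_mult_power_less_1:
  fixes a q :: complex
  assumes "norm a < 1" "norm q < 1"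
  shows "norm (a * q ^ n) < 1"
proof -
  have "norm q ^ n \<le> 1"
    using assms by (simp add: power_le_one)
  then have "norm a * norm q ^ n \<le> norm a"
    by (simp add: mult_left_le)
  then show ?thesis
    using assms by (simp add: norm_mult norm_power)
qed

lemma qpoch_nonzero:
  assumes "norm a < 1" "norm q < 1"
  shows "qpoch a q n \<noteq> 0"
  unfolding qpoch_def using one_minus_nonzero[OF norm_mult_power_less_1[OF assms]] by auto

lemma convergent_prod_qpoch_factors:
  fixes a q :: complex
  assumes "norm q < 1"
  shows "convergent_prod (\<lambda>j. 1 - a * q ^ j)"
proof -
  have "summable (\<lambda>j. norm ((1 - a * q ^ j) - 1))"
    using assms by (simp add: norm_mult norm_power summable_mult summable_geometric)
  then show ?thesis
    by (intro abs_convergent_prod_imp_convergent_prod summable_imp_abs_convergent_prod)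
qed

lemma qpoch_tendsto:
  assumes "norm q < 1"
  shows "(\<lambda>n. qpoch a q n) \<longlonglongrightarrow> qpoch_inf a q"
proof -
  have "convergent_prod (\<lambda>j. 1 - a * q ^ j)"
    by (rule convergent_prod_qpoch_factors[OF assms])
  then have "(\<lambda>n. \<Prod>j\<le>n. 1 - a * q ^ j) \<longlonglongrightarrow> qpoch_inf a q"
    unfolding qpoch_inf_def by (rule convergent_prod_LIMSEQ)
  then show ?thesis
    unfolding qpoch_def using LIMSEQ_lessThan_iff_atMost by blast
qed

lemma qpoch_inf_nonzero:
  assumes "norm a < 1" "norm q < 1"
  shows "qpoch_inf a q \<noteq> 0"
proof -
  have "1 - a * q ^ j \<noteq> 0" for j
    using one_minus_nonzero[OF norm_mult_power_less_1[OF assms]] .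
  then show ?thesis
    unfolding qpoch_inf_def using convergent_prod_qpoch_factors[OF assms(2)]
    by (intro prodinf_nonzero)
qed

lemma qpoch_inf_shift:
  assumes "norm q < 1"
  shows "qpoch_inf a q = qpoch a q n * qpoch_inf (a * q ^ n) q"
proof -
  have "(\<lambda>m. qpoch a q (n + m)) \<longlonglongrightarrow> qpoch a q n * qpoch_inf (a * q ^ n) q"
    unfolding qpoch_add by (intro tendsto_intros qpoch_tendsto assms)
  moreover have "(\<lambda>m. qpoch a q (n + m)) \<longlonglongrightarrow> qpoch_inf a q"
    using LIMSEQ_ignore_initial_segment[OF qpoch_tendsto[OF assms, of a], of n]
    by (simp add: add.commute)
  ultimately show ?thesis
    by (metis LIMSEQ_unique)
qed

lemma qpoch_inf_step:
  assumes "norm q < 1"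
  shows "qpoch_inf a q = (1 - a) * qpoch_inf (a * q) q"
  using qpoch_inf_shift[OF assms, of a 1] by (simp add: qpoch_Suc)

lemma qpoch_inf_shift_tendsto:
  assumes "norm a < 1" "norm q < 1"
  shows "(\<lambda>n. qpoch_inf (a * q ^ n) q) \<longlonglongrightarrow> 1"
proof -
  have "qpoch_inf (a * q ^ n) q = qpoch_inf a q / qpoch a q n" for n
    using qpoch_inf_shift[OF assms(2), of a n] qpoch_nonzero[OF assms, of n] by simp
  moreover have "(\<lambda>n. qpoch_inf a q / qpoch a q n) \<longlonglongrightarrow> qpoch_inf a q / qpoch_inf a q"
    by (intro tendsto_intros qpoch_tendsto qpoch_inf_nonzero assms)
  ultimately show ?thesis
    using qpoch_inf_nonzero[OF assms] by simp
qed

lemma qpoch_bounded: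
  assumes "norm q < 1"
  obtains K where "K > 0" "\<And>n. norm (qpoch a q n) \<le> K"
  using BseqE[OF convergent_imp_Bseq[OF convergentI[OF qpoch_tendsto[OF assms, of a]]]] by blast

lemma inverse_qpoch_bounded:
  assumes "norm a < 1" "norm q < 1"
  obtains K where "K > 0" "\<And>n. norm (inverse (qpoch a q n)) \<le> K"
proof -
  have "(\<lambda>n. inverse (qpoch a q n)) \<longlonglongrightarrow> inverse (qpoch_inf a q)"
    by (intro tendsto_intros qpoch_tendsto qpoch_inf_nonzero assms)
  from BseqE[OF convergent_imp_Bseq[OF convergentI[OF this]]] show ?thesis
    using that by blast
qed

section \<open>The \<open>q\<close>-binomial theorem\<close>

text \<open>
  The coefficient is \<open>(\<gamma>\<^sup>-\<^sup>1; q)\<^sub>k \<gamma>\<^sup>k / (q; q)\<^sub>k\<close>, written as a polynomial in \<open>\<gamma>\<close> so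
  that it also makes sense, and is continuous, at \<open>\<gamma> = 0\<close>.
\<close>

definition qbin :: "complex \<Rightarrow> complex \<Rightarrow> nat \<Rightarrow> complex" where
  "qbin \<gamma> q k = (\<Prod>j<k. \<gamma> - q ^ j) / qpoch q q k"

lemma qbin_0 [simp]: "qbin \<gamma> q 0 = 1"
  by (simp add: qbin_def)

lemma qbin_Suc:
  assumes "norm q < 1"
  shows "qbin \<gamma> q (Suc k) * (1 - q ^ Suc k) = qbin \<gamma> q k * (\<gamma> - q ^ k)"
  using one_minus_nonzero[OF norm_mult_power_less_1[OF assms assms, of k]] qpoch_nonzero[OF assms assms]
  by (simp add: qbin_def qpoch_Suc field_simps)

lemma prod_one_plus_geometric_le:
  fixes c x :: real
  assumes "0 \<le> c" "0 \<le> x" "x < 1"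
  shows "(\<Prod>j<k. 1 + c * x ^ j) \<le> exp (c / (1 - x))"
proof -
  have "(\<Prod>j<k. 1 + c * x ^ j) \<le> (\<Prod>j<k. exp (c * x ^ j))"
    using assms by (intro prod_mono) (auto intro: add_nonneg_nonneg)
  also have "\<dots> = exp (c * (\<Sum>j<k. x ^ j))"
    by (simp add: exp_sum sum_distrib_left)
  also have "(\<Sum>j<k. x ^ j) \<le> 1 / (1 - x)"
    using assms sum_le_suminf[OF summable_geometric, of x "{..<k}"] suminf_geometric[of x] by simp
  then have "exp (c * (\<Sum>j<k. x ^ j)) \<le> exp (c / (1 - x))"
    using mult_left_mono[OF _ assms(1)] by fastforce
  finally show ?thesis .
qed

text \<open>
  The bound is uniform in the parameter, which is what allows the limit \<open>\<gamma> \<rightarrow> 0\<close> to be taken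
  under the summation sign.
\<close>

lemma qbin_bounded:
  assumes "norm q < 1" "0 < \<rho>"
  obtains K where "K > 0" "\<And>\<gamma> k. norm \<gamma> \<le> \<rho> \<Longrightarrow> norm (qbin \<gamma> q k) \<le> K * \<rho> ^ k"
proof -
  obtain L where L: "L > 0" "\<And>n. norm (inverse (qpoch q q n)) \<le> L"
    using inverse_qpoch_bounded[OF assms(1) assms(1)] by blast
  define E where "E = exp ((1 / \<rho>) / (1 - norm q))"
  have "norm (qbin \<gamma> q k) \<le> (E * L) * \<rho> ^ k" if "norm \<gamma> \<le> \<rho>" for \<gamma> k
  proof -
    have "norm (\<Prod>j<k. \<gamma> - q ^ j) \<le> (\<Prod>j<k. \<rho> * (1 + 1 / \<rho> * norm q ^ j))"
      unfolding prod_norm[symmetric]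
    proof (intro prod_mono conjI norm_ge_zero)
      fix j
      have "norm (\<gamma> - q ^ j) \<le> norm \<gamma> + norm q ^ j"
        by (metis norm_power norm_triangle_ineq4)
      then show "norm (\<gamma> - q ^ j) \<le> \<rho> * (1 + 1 / \<rho> * norm q ^ j)"
        using that assms by (simp add: algebra_simps)
    qed
    also have "\<dots> = \<rho> ^ k * (\<Prod>j<k. 1 + 1 / \<rho> * norm q ^ j)"
      by (simp add: prod.distrib)
    also have "\<dots> \<le> \<rho> ^ k * E"
      unfolding E_def using assms
      by (intro mult_left_mono prod_one_plus_geometric_le) auto
    finally have "norm (\<Prod>j<k. \<gamma> - q ^ j) * norm (inverse (qpoch q q k)) \<le> (\<rho> ^ k * E) * L"
      using L by (intro mult_mono) (auto simp: E_def assms(2) less_imp_le)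
    then show ?thesis
      by (simp add: qbin_def divide_inverse norm_mult mult_ac)
  qed
  moreover have "E * L > 0"
    using L by (simp add: E_def)
  ultimately show ?thesis
    using that by blast
qed

definition qbin_sum :: "complex \<Rightarrow> complex \<Rightarrow> complex \<Rightarrow> complex" where
  "qbin_sum \<gamma> q y = (\<Sum>k. qbin \<gamma> q k * y ^ k)"

lemma qbin_geometric_bound:
  assumes "norm q < 1" "norm \<gamma> < 1"
  obtains K \<rho> where "K > 0" "0 < \<rho>" "\<rho> < 1" "\<And>k. norm (qbin \<gamma> q k) \<le> K * \<rho> ^ k"
proof -
  obtain \<rho> where \<rho>: "norm \<gamma> < \<rho>" "\<rho> < 1"
    using assms(2) dense by blast
  then have pos: "0 < \<rho>"
    using norm_ge_zero[of \<gamma>] by linarith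
  obtain K where "K > 0" "\<And>\<gamma> k. norm \<gamma> \<le> \<rho> \<Longrightarrow> norm (qbin \<gamma> q k) \<le> K * \<rho> ^ k"
    using qbin_bounded[OF assms(1) pos] by blast
  then show ?thesis
    using that[of K \<rho>] \<rho> pos by simp
qed

lemma summable_qbin_power:
  assumes "norm q < 1" "norm \<gamma> < 1" "norm y \<le> 1"
  shows "summable (\<lambda>k. qbin \<gamma> q k * y ^ k)"
proof -
  obtain K \<rho> where K: "K > 0" "0 < \<rho>" "\<rho> < 1" "\<And>k. norm (qbin \<gamma> q k) \<le> K * \<rho> ^ k"
    using qbin_geometric_bound[OF assms(1,2)] by blast
  have "norm (qbin \<gamma> q k * y ^ k) \<le> K * \<rho> ^ k" for k
    using mult_mono[OF K(4)[of k] power_le_one[OF _ assms(3), of k]] K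
    by (simp add: norm_mult norm_power)
  moreover have "summable (\<lambda>k. K * \<rho> ^ k)"
    using K by (intro summable_mult summable_geometric) simp
  ultimately show ?thesis
    by (rule summable_comparison_test'[where N = 0, rotated])
qed

text \<open>
  The recurrence of the coefficients is the functional equation
  \<open>(1 - \<gamma> y) A(y) = (1 - y) A(q y)\<close>. Iterating it moves the argument to \<open>0\<close>, where \<open>A = 1\<close>.
\<close>

lemma qbin_sum_step:
  assumes "norm q < 1" "norm \<gamma> < 1" "norm y \<le> 1"
  shows "(1 - \<gamma> * y) * qbin_sum \<gamma> q y = (1 - y) * qbin_sum \<gamma> q (q * y)"
proof -
  have qy: "norm (q * y) \<le> 1"
    using assms by (simp add: norm_mult mult_le_one)
  have s1: "(\<lambda>k. qbin \<gamma> q k * y ^ k) sums qbin_sum \<gamma> q y"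
    unfolding qbin_sum_def using summable_qbin_power[OF assms] by (rule summable_sums)
  have s2: "(\<lambda>k. qbin \<gamma> q k * (q * y) ^ k) sums qbin_sum \<gamma> q (q * y)"
    unfolding qbin_sum_def using summable_qbin_power[OF assms(1,2) qy] by (rule summable_sums)
  have d: "(\<lambda>k. qbin \<gamma> q k * y ^ k - qbin \<gamma> q k * (q * y) ^ k) sums
             (qbin_sum \<gamma> q y - qbin_sum \<gamma> q (q * y))"
    using s1 s2 by (rule sums_diff)
  have e: "(\<lambda>k. y * (\<gamma> * (qbin \<gamma> q k * y ^ k) - qbin \<gamma> q k * (q * y) ^ k)) sums
             (y * (\<gamma> * qbin_sum \<gamma> q y - qbin_sum \<gamma> q (q * y)))"
    by (intro sums_mult sums_diff s1 s2)
  have "y * (\<gamma> * (qbin \<gamma> q k * y ^ k) - qbin \<gamma> q k * (q * y) ^ k) =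
          qbin \<gamma> q (Suc k) * y ^ Suc k - qbin \<gamma> q (Suc k) * (q * y) ^ Suc k" for k
  proof -
    have "y * (\<gamma> * (qbin \<gamma> q k * y ^ k) - qbin \<gamma> q k * (q * y) ^ k) =
            (qbin \<gamma> q k * (\<gamma> - q ^ k)) * y ^ Suc k"
      by (simp add: algebra_simps power_mult_distrib)
    also have "\<dots> = (qbin \<gamma> q (Suc k) * (1 - q ^ Suc k)) * y ^ Suc k"
      by (simp only: qbin_Suc[OF assms(1)])
    finally show ?thesis
      by (simp add: algebra_simps power_mult_distrib)
  qed
  with e have "(\<lambda>k. qbin \<gamma> q (Suc k) * y ^ Suc k - qbin \<gamma> q (Suc k) * (q * y) ^ Suc k) sums
             (y * (\<gamma> * qbin_sum \<gamma> q y - qbin_sum \<gamma> q (q * y)))"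
    by simp
  then have "(\<lambda>k. qbin \<gamma> q k * y ^ k - qbin \<gamma> q k * (q * y) ^ k) sums
             (y * (\<gamma> * qbin_sum \<gamma> q y - qbin_sum \<gamma> q (q * y)))"
    by (subst (asm) sums_Suc_iff) simp
  from sums_unique2[OF d this] show ?thesis
    by (simp add: algebra_simps)
qed

theorem q_binomial:
  assumes "norm q < 1" "norm \<gamma> < 1" "norm y \<le> 1"
  shows "qbin_sum \<gamma> q y = qpoch_inf y q / qpoch_inf (\<gamma> * y) q"
proof -
  have gy: "norm (\<gamma> * y) < 1"
    using assms mult_left_le[of "norm y" "norm \<gamma>"] by (simp add: norm_mult)
  have it: "qpoch (\<gamma> * y) q n * qbin_sum \<gamma> q y = qpoch y q n * qbin_sum \<gamma> q (q ^ n * y)" for n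
  proof (induction n)
    case (Suc n)
    have "norm (q ^ n * y) \<le> 1"
      using assms by (simp add: norm_mult norm_power mult_le_one power_le_one)
    note step = qbin_sum_step[OF assms(1,2) this]
    have "qpoch (\<gamma> * y) q (Suc n) * qbin_sum \<gamma> q y =
            qpoch y q n * ((1 - \<gamma> * (q ^ n * y)) * qbin_sum \<gamma> q (q ^ n * y))"
      using Suc by (simp add: qpoch_Suc mult_ac)
    also have "\<dots> = qpoch y q (Suc n) * qbin_sum \<gamma> q (q ^ Suc n * y)"
      unfolding step by (simp add: qpoch_Suc mult_ac)
    finally show ?case .
  qed simp
  have "uniform_limit (cball 0 1) (\<lambda>n y. \<Sum>k<n. qbin \<gamma> q k * y ^ k) (qbin_sum \<gamma> q) sequentially"
  proof -
    obtain K \<rho> where K: "K > 0" "0 < \<rho>" "\<rho> < 1" "\<And>k. norm (qbin \<gamma> q k) \<le> K * \<rho> ^ k"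
      using qbin_geometric_bound[OF assms(1,2)] by blast
    show ?thesis
      unfolding qbin_sum_def
    proof (rule Weierstrass_m_test[where M = "\<lambda>k. K * \<rho> ^ k"])
      fix k and y :: complex assume y: "y \<in> cball 0 1"
      show "norm (qbin \<gamma> q k * y ^ k) \<le> K * \<rho> ^ k"
        using mult_mono[OF K(4)[of k] power_le_one[of "norm y" k]] K y
        by (simp add: norm_mult norm_power)
    qed (use K in \<open>auto intro: summable_mult summable_geometric\<close>)
  qed
  then have cont: "continuous_on (cball 0 1) (qbin_sum \<gamma> q)"
    by (rule uniform_limit_theorem[rotated]) (auto intro!: always_eventually continuous_intros)
  have "(\<lambda>n. q ^ n * y) \<longlonglongrightarrow> 0 * y"
    using assms by (intro tendsto_intros LIMSEQ_power_zero)
  then have "(\<lambda>n. qbin_sum \<gamma> q (q ^ n * y)) \<longlonglongrightarrow> qbin_sum \<gamma> q 0"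
    using assms
    by (intro continuous_on_tendsto_compose[OF cont] always_eventually)
      (auto simp: norm_mult norm_power mult_le_one power_le_one)
  moreover have "qbin_sum \<gamma> q 0 = 1"
    by (simp add: qbin_sum_def)
  ultimately have "(\<lambda>n. qpoch y q n * qbin_sum \<gamma> q (q ^ n * y)) \<longlonglongrightarrow> qpoch_inf y q * 1"
    by (intro tendsto_intros qpoch_tendsto assms) simp
  moreover have "(\<lambda>n. qpoch (\<gamma> * y) q n * qbin_sum \<gamma> q y) \<longlonglongrightarrow> qpoch_inf (\<gamma> * y) q * qbin_sum \<gamma> q y"
    by (intro tendsto_intros qpoch_tendsto assms)
  ultimately have "qpoch_inf (\<gamma> * y) q * qbin_sum \<gamma> q y = qpoch_inf y q"
    using LIMSEQ_unique unfolding it by fastforce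
  then show ?thesis
    using qpoch_inf_nonzero[OF gy assms(1)] by (simp add: field_simps)
qed

section \<open>The Rogers polynomials as Laurent polynomials\<close>

text \<open>
  With \<open>z = e\<^sup>i\<^sup>\<theta>\<close> the Rogers polynomial is the coefficient of \<open>t\<^sup>n\<close> in a product of two
  power series, one in \<open>t z\<close> and one in \<open>t / z\<close>.
\<close>

definition rcoef :: "complex \<Rightarrow> complex \<Rightarrow> nat \<Rightarrow> complex" where
  "rcoef \<gamma> q k = qpoch \<gamma> q k / qpoch q q k"

definition rogers :: "nat \<Rightarrow> complex \<Rightarrow> complex \<Rightarrow> complex \<Rightarrow> complex" where
  "rogers n \<gamma> q z = (\<Sum>k\<le>n. rcoef \<gamma> q k * rcoef \<gamma> q (n - k) * (z ^ (n - k) * inverse z ^ k))"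

lemma rcoef_0 [simp]: "rcoef \<gamma> q 0 = 1"
  by (simp add: rcoef_def)

lemma rcoef_Suc:
  assumes "norm q < 1"
  shows "rcoef \<gamma> q (Suc k) * (1 - q ^ Suc k) = rcoef \<gamma> q k * (1 - \<gamma> * q ^ k)"
  using one_minus_nonzero[OF norm_mult_power_less_1[OF assms assms, of k]] qpoch_nonzero[OF assms assms]
  by (simp add: rcoef_def qpoch_Suc field_simps)

lemma rogers_0 [simp]: "rogers 0 \<gamma> q z = 1"
  by (simp add: rogers_def)

lemma rogers_inverse: "rogers n \<gamma> q (inverse z) = rogers n \<gamma> q z"
  unfolding rogers_def
  by (subst sum.nat_diff_reindex[symmetric, of _ "Suc n", simplified lessThan_Suc_atMost], rule sum.cong)
    (auto simp: mult_ac)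

lemma rogers_fps:
  "Abs_fps (\<lambda>n. rogers n \<gamma> q z) =
     Abs_fps (\<lambda>k. rcoef \<gamma> q k * inverse z ^ k) * Abs_fps (\<lambda>k. rcoef \<gamma> q k * z ^ k)"
  by (rule fps_ext, simp add: fps_mult_nth rogers_def atLeast0AtMost) (simp add: mult_ac)

text \<open>
  The recurrence of \<open>rcoef\<close> turns into a first-order \<open>q\<close>-difference equation for each
  of the two power series, and their product inherits one in which \<open>t\<close> appears to the second
  power. Comparing coefficients gives the three-term recurrence.
\<close>

lemma rcoef_fps_step:
  assumes "norm q < 1"
  shows "(1 - fps_const z * fps_X) * Abs_fps (\<lambda>k. rcoef \<gamma> q k * z ^ k) =
         (1 - fps_const (\<gamma> * z) * fps_X) * Abs_fps (\<lambda>k. q ^ k * (rcoef \<gamma> q k * z ^ k))"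
proof (rule fps_ext)
  fix k
  show "fps_nth ((1 - fps_const z * fps_X) * Abs_fps (\<lambda>k. rcoef \<gamma> q k * z ^ k)) k =
        fps_nth ((1 - fps_const (\<gamma> * z) * fps_X) * Abs_fps (\<lambda>k. q ^ k * (rcoef \<gamma> q k * z ^ k))) k"
  proof (cases k)
    case (Suc j)
    have "(rcoef \<gamma> q (Suc j) * (1 - q ^ Suc j)) * z ^ Suc j =
          (rcoef \<gamma> q j * (1 - \<gamma> * q ^ j)) * z ^ Suc j"
      by (simp only: rcoef_Suc[OF assms])
    with Suc show ?thesis
      by (simp add: left_diff_distrib mult.assoc algebra_simps)
  qed (simp add: left_diff_distrib mult.assoc)
qed

lemma rogers_recurrence:
  assumes q: "norm q < 1" and z: "z \<noteq> 0"
  shows "(z + inverse z) * (1 - \<gamma> * q ^ Suc n) * rogers (Suc n) \<gamma> q z =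
         (1 - q ^ Suc (Suc n)) * rogers (Suc (Suc n)) \<gamma> q z + (1 - \<gamma>\<^sup>2 * q ^ n) * rogers n \<gamma> q z"
    and "(z + inverse z) * (1 - \<gamma>) * rogers 0 \<gamma> q z = (1 - q) * rogers 1 \<gamma> q z"
proof -
  define P where "P = (\<lambda>w::complex. Abs_fps (\<lambda>k. rcoef \<gamma> q k * w ^ k))"
  define Q where "Q = (\<lambda>w::complex. Abs_fps (\<lambda>k. q ^ k * (rcoef \<gamma> q k * w ^ k)))"
  define R where "R = Abs_fps (\<lambda>n. rogers n \<gamma> q z)"
  define S where "S = Abs_fps (\<lambda>n. q ^ n * rogers n \<gamma> q z)"
  have R: "R = P (inverse z) * P z"
    by (simp add: R_def P_def rogers_fps)
  have S: "S = Q (inverse z) * Q z"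
  proof (rule fps_ext)
    fix n
    have "q ^ i * (rcoef \<gamma> q i * inverse z ^ i) * (q ^ (n - i) * (rcoef \<gamma> q (n - i) * z ^ (n - i))) =
          q ^ n * (rcoef \<gamma> q i * rcoef \<gamma> q (n - i) * (z ^ (n - i) * inverse z ^ i))"
      if "i \<le> n" for i
      using power_add[of q i "n - i"] that by (simp add: mult_ac)
    from sum.cong[OF refl this, of "{..n}"] show "fps_nth S n = fps_nth (Q (inverse z) * Q z) n"
      by (simp add: S_def Q_def fps_mult_nth rogers_def sum_distrib_left atLeast0AtMost)
  qed
  have step: "(1 - fps_const w * fps_X) * P w = (1 - fps_const (\<gamma> * w) * fps_X) * Q w" for w
    unfolding P_def Q_def by (rule rcoef_fps_step[OF q])
  have quad: "(1 - fps_const (c * inverse z) * fps_X) * (1 - fps_const (c * z) * fps_X) =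
              1 - fps_const (c * (z + inverse z)) * fps_X + fps_const (c\<^sup>2) * fps_X * fps_X" for c
  proof -
    have "(1 - u * fps_X) * (1 - v * fps_X) = 1 - (u + v) * fps_X + u * v * fps_X * fps_X"
      for u v :: "complex fps"
      by (simp add: algebra_simps)
    moreover have "fps_const (c * inverse z) * fps_const (c * z) = fps_const (c\<^sup>2)"
      using z by (simp add: power2_eq_square)
    moreover have "fps_const (c * inverse z) + fps_const (c * z) = fps_const (c * (z + inverse z))"
      by (simp add: algebra_simps)
    ultimately show ?thesis
      by (simp only:)
  qed
  have "(1 - fps_const (inverse z) * fps_X) * (1 - fps_const z * fps_X) * R =
        ((1 - fps_const (inverse z) * fps_X) * P (inverse z)) * ((1 - fps_const z * fps_X) * P z)"
    by (simp add: R mult_ac)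
  also have "\<dots> = (1 - fps_const (\<gamma> * inverse z) * fps_X) * (1 - fps_const (\<gamma> * z) * fps_X) * S"
    unfolding step by (simp add: S mult_ac)
  finally have main: "(1 - fps_const (z + inverse z) * fps_X + fps_X * fps_X) * R =
      (1 - fps_const (\<gamma> * (z + inverse z)) * fps_X + fps_const (\<gamma>\<^sup>2) * fps_X * fps_X) * S"
    using quad[of 1] unfolding quad[of \<gamma>] mult_1_left power_one fps_const_1_eq_1 by simp
  have "fps_nth ((1 - fps_const (z + inverse z) * fps_X + fps_X * fps_X) * R) (Suc (Suc n)) =
      fps_nth ((1 - fps_const (\<gamma> * (z + inverse z)) * fps_X + fps_const (\<gamma>\<^sup>2) * fps_X * fps_X) * S) (Suc (Suc n))"
    by (simp only: main)
  then show "(z + inverse z) * (1 - \<gamma> * q ^ Suc n) * rogers (Suc n) \<gamma> q z =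
         (1 - q ^ Suc (Suc n)) * rogers (Suc (Suc n)) \<gamma> q z + (1 - \<gamma>\<^sup>2 * q ^ n) * rogers n \<gamma> q z"
    by (simp add: R_def S_def ring_distribs mult.assoc) (simp add: algebra_simps)
  have "fps_nth ((1 - fps_const (z + inverse z) * fps_X + fps_X * fps_X) * R) 1 =
      fps_nth ((1 - fps_const (\<gamma> * (z + inverse z)) * fps_X + fps_const (\<gamma>\<^sup>2) * fps_X * fps_X) * S) 1"
    by (simp only: main)
  then show "(z + inverse z) * (1 - \<gamma>) * rogers 0 \<gamma> q z = (1 - q) * rogers 1 \<gamma> q z"
    by (simp add: R_def S_def ring_distribs mult.assoc) (simp add: algebra_simps)
qed

text \<open>
  The two shifted factorials whose parameters contain \<open>q\<^sup>-\<^sup>n\<close> strip the last \<open>k\<close> factors from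
  \<open>(\<gamma>; q)\<^sub>n / (q; q)\<^sub>n\<close>. This is what makes the terminating series symmetric in \<open>k\<close> and \<open>n - k\<close>.
\<close>

lemma terminating_ratio:
  fixes \<gamma> q :: complex
  assumes q: "q \<noteq> 0" "norm q < 1" and \<gamma>: "\<gamma> \<noteq> 0" "norm \<gamma> < 1" and k: "k \<le> n"
  shows "qpoch (q powi - int n) q k / qpoch (inverse \<gamma> * q powi (1 - int n)) q k * (q * inverse \<gamma>) ^ k
           * rcoef \<gamma> q n = rcoef \<gamma> q (n - k)"
  using k
proof (induction k)
  case (Suc k)
  define l where "l = n - Suc k"
  have l: "n - k = Suc l"
    using Suc.prems by (simp add: l_def)
  have n: "int n = int l + 1 + int k"
    using Suc.prems by (simp add: l_def)
  have e1: "q powi (- int n) * q ^ k = inverse (q ^ Suc l)"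
    using q by (simp add: n power_int_diff power_int_add power_int_minus field_simps)
  have e2: "q powi (1 - int n) * q ^ k = inverse (q ^ l)"
    using q by (simp add: n power_int_diff power_int_add power_int_minus field_simps)
  have nz: "1 - q ^ Suc l \<noteq> 0" "1 - \<gamma> * q ^ l \<noteq> 0"
    using one_minus_nonzero[OF norm_mult_power_less_1] q \<gamma> by (simp_all add: power_Suc)
  have nz': "1 - inverse \<gamma> * inverse (q ^ l) \<noteq> 0"
  proof
    assume "1 - inverse \<gamma> * inverse (q ^ l) = 0"
    then have "\<gamma> * q ^ l = 1"
      using q \<gamma> by (simp add: field_simps)
    with nz show False
      by simp
  qed
  have ratio: "(1 - inverse (q ^ Suc l)) / (1 - inverse \<gamma> * inverse (q ^ l)) * (q * inverse \<gamma>) =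
          (1 - q ^ Suc l) / (1 - \<gamma> * q ^ l)"
  proof -
    have "(1 - inverse (q ^ Suc l)) * (q * inverse \<gamma>) * (1 - \<gamma> * q ^ l) =
            (1 - q ^ Suc l) * (1 - inverse \<gamma> * inverse (q ^ l))"
      using q \<gamma> by (simp add: field_simps)
    then show ?thesis
      using nz nz' by (simp add: frac_eq_eq mult_ac)
  qed
  have "qpoch (q powi - int n) q (Suc k) = qpoch (q powi - int n) q k * (1 - inverse (q ^ Suc l))"
    using e1 by (simp add: qpoch_Suc)
  moreover have "qpoch (inverse \<gamma> * q powi (1 - int n)) q (Suc k) =
      qpoch (inverse \<gamma> * q powi (1 - int n)) q k * (1 - inverse \<gamma> * inverse (q ^ l))"
    by (simp add: qpoch_Suc mult.assoc e2)
  ultimately have "qpoch (q powi - int n) q (Suc k) / qpoch (inverse \<gamma> * q powi (1 - int n)) q (Suc k)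
        * (q * inverse \<gamma>) ^ Suc k * rcoef \<gamma> q n =
      ((1 - inverse (q ^ Suc l)) / (1 - inverse \<gamma> * inverse (q ^ l)) * (q * inverse \<gamma>)) *
      (qpoch (q powi - int n) q k / qpoch (inverse \<gamma> * q powi (1 - int n)) q k
        * (q * inverse \<gamma>) ^ k * rcoef \<gamma> q n)"
    unfolding power_Suc by (simp only: times_divide_times_eq times_divide_eq_left times_divide_eq_right divide_divide_eq_left mult_ac)
  also have "\<dots> = (1 - q ^ Suc l) / (1 - \<gamma> * q ^ l) * rcoef \<gamma> q (Suc l)"
    unfolding ratio using Suc l by simp
  also have "\<dots> = rcoef \<gamma> q l"
    using rcoef_Suc[OF q(2), of \<gamma> l] nz by (simp add: field_simps)
  finally show ?case
    by (simp add: l_def)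
qed simp

lemma qpoch_negative_power_eq_0:
  assumes "q \<noteq> 0" "n < k"
  shows "qpoch (q powi - int n) q k = 0"
proof -
  have "1 - q powi - int n * q ^ n = 0"
    using assms by (simp add: power_int_minus)
  then show ?thesis
    unfolding qpoch_def using assms by auto
qed

lemma rogers_C_eq_rogers:
  fixes \<gamma> q :: complex
  assumes q: "q \<noteq> 0" "norm q < 1" and \<gamma>: "\<gamma> \<noteq> 0" "norm \<gamma> < 1"
  shows "rogers_C n x \<gamma> q = rogers n \<gamma> q (exp (\<i> * of_real (arccos x)))"
proof -
  define z where "z = exp (\<i> * of_real (arccos x))"
  define e where "e = exp (- 2 * \<i> * of_real (arccos x))"
  have z: "z \<noteq> 0"
    by (simp add: z_def)
  have zn: "exp (\<i> * of_nat n * of_real (arccos x)) = z ^ n"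
    unfolding z_def exp_of_nat_mult[symmetric] by (simp add: mult_ac)
  have e: "e = inverse z * inverse z"
    unfolding e_def z_def exp_minus[symmetric] exp_add[symmetric] by (simp add: algebra_simps)
  define T where "T = (\<lambda>k. qpoch (q powi - int n) q k * qpoch \<gamma> q k
        / (qpoch q q k * qpoch (inverse \<gamma> * q powi (1 - int n)) q k) * (q * inverse \<gamma> * e) ^ k)"
  have "basic_hyp [q powi (- int n), \<gamma>] [inverse \<gamma> * q powi (1 - int n)] q (q * inverse \<gamma> * e) = (\<Sum>k. T k)"
    unfolding basic_hyp_def qpochs_def T_def by simp
  also have "\<dots> = (\<Sum>k\<le>n. T k)"
    using qpoch_negative_power_eq_0[OF q(1), of n] by (intro suminf_finite) (auto simp: T_def)
  finally have "rogers_C n x \<gamma> q = rcoef \<gamma> q n * z ^ n * (\<Sum>k\<le>n. T k)"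
    unfolding rogers_C_def Let_def zn e_def[symmetric] rcoef_def by simp
  also have "\<dots> = (\<Sum>k\<le>n. rcoef \<gamma> q n * z ^ n * T k)"
    by (simp add: sum_distrib_left)
  also have "\<dots> = rogers n \<gamma> q z"
    unfolding rogers_def
  proof (rule sum.cong[OF refl])
    fix k assume k: "k \<in> {..n}"
    have "rcoef \<gamma> q n * z ^ n * T k =
      (qpoch (q powi - int n) q k / qpoch (inverse \<gamma> * q powi (1 - int n)) q k * (q * inverse \<gamma>) ^ k * rcoef \<gamma> q n)
        * rcoef \<gamma> q k * (z ^ n * e ^ k)"
      by (simp add: T_def rcoef_def power_mult_distrib mult_ac)
    also have "\<dots> = rcoef \<gamma> q (n - k) * rcoef \<gamma> q k * (z ^ n * e ^ k)"
      using terminating_ratio[OF q \<gamma>, of k n] k by simp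
    also have "z ^ n * e ^ k = z ^ (n - k) * inverse z ^ k"
      using power_add[of z "n - k" k] k z by (simp add: e power_mult_distrib field_simps)
    finally show "rcoef \<gamma> q n * z ^ n * T k = rcoef \<gamma> q k * rcoef \<gamma> q (n - k) * (z ^ (n - k) * inverse z ^ k)"
      by (simp add: mult_ac)
  qed
  finally show ?thesis
    by (simp add: z_def)
qed

section \<open>Moments of the weight\<close>

text \<open>
  With \<open>A\<close> the function of the \<open>q\<close>-binomial theorem, these are the Laurent coefficients of
  \<open>A(y) A(1 / y)\<close>. They are symmetric in \<open>n\<close> and \<open>- n\<close>.
\<close>

definition moment :: "complex \<Rightarrow> complex \<Rightarrow> nat \<Rightarrow> complex" where
  "moment \<gamma> q n = (\<Sum>k. qbin \<gamma> q k * qbin \<gamma> q (k + n))"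

text \<open>
  The Laurent coefficients of \<open>A(y) A(q / y)\<close>. Unlike those of \<open>A(y) A(1 / y)\<close>, they satisfy a
  recurrence that is inherited directly from a \<open>q\<close>-difference equation.
\<close>

definition skew_moment :: "complex \<Rightarrow> complex \<Rightarrow> nat \<Rightarrow> complex" where
  "skew_moment \<gamma> q n = (\<Sum>k. qbin \<gamma> q k * qbin \<gamma> q (k + n) * q ^ k)"

text \<open>
  The weights \<open>u\<close> cover all the correlation sums that occur below. The decay in \<open>n\<close> is used to
  identify a constant by letting \<open>n \<rightarrow> \<infinity>\<close>.
\<close>

lemma qbin_correlation_bounds:
  assumes "norm q < 1" "norm \<gamma> < 1"
  shows "\<exists>\<rho> C. 0 < \<rho> \<and> \<rho> < 1 \<and> (\<forall>u n. (\<forall>k. norm (u k) \<le> 1) \<longrightarrow>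
    summable (\<lambda>k. qbin \<gamma> q k * qbin \<gamma> q (k + n) * u k) \<and>
    norm (\<Sum>k. qbin \<gamma> q k * qbin \<gamma> q (k + n) * u k) \<le> C * \<rho> ^ n)"
proof -
  obtain K \<rho> where K: "K > 0" "0 < \<rho>" "\<rho> < 1" "\<And>k. norm (qbin \<gamma> q k) \<le> K * \<rho> ^ k"
    using qbin_geometric_bound[OF assms] by blast
  have b: "norm (qbin \<gamma> q k * qbin \<gamma> q (k + n) * u k) \<le> K\<^sup>2 * \<rho> ^ n * \<rho> ^ k"
    if "\<And>k. norm (u k) \<le> 1" for u n k
  proof -
    have "norm (qbin \<gamma> q (k + n)) \<le> K * \<rho> ^ n"
      using K order_trans[OF K(4)[of "k + n"]] by (simp add: power_add mult_le_one power_le_one mult_left_le_one_le)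
    then have "norm (qbin \<gamma> q k) * norm (qbin \<gamma> q (k + n)) * norm (u k) \<le> (K * \<rho> ^ k) * (K * \<rho> ^ n) * 1"
      using K that by (intro mult_mono) auto
    then show ?thesis
      by (simp add: norm_mult power2_eq_square mult_ac)
  qed
  have s: "summable (\<lambda>k. K\<^sup>2 * \<rho> ^ n * \<rho> ^ k)" for n
    using K by (intro summable_mult summable_geometric) simp
  have "(\<Sum>k. K\<^sup>2 * \<rho> ^ n * \<rho> ^ k) = K\<^sup>2 / (1 - \<rho>) * \<rho> ^ n" for n
    using K by (simp add: suminf_mult suminf_geometric summable_geometric)
  then have B: "norm (\<Sum>k. qbin \<gamma> q k * qbin \<gamma> q (k + n) * u k) \<le> K\<^sup>2 / (1 - \<rho>) * \<rho> ^ n"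
    if "\<And>k. norm (u k) \<le> 1" for u n
    using norm_suminf_le[OF b[OF that] s, of n] by simp
  have S: "summable (\<lambda>k. qbin \<gamma> q k * qbin \<gamma> q (k + n) * u k)"
    if "\<And>k. norm (u k) \<le> 1" for u n
    using b[of u, OF that] s by (rule summable_comparison_test'[where N = 0, rotated])
  show ?thesis
    by (rule exI[of _ \<rho>], rule exI[of _ "K\<^sup>2 / (1 - \<rho>)"]) (intro conjI allI impI K(2,3) S B; elim allE)
qed

context
  fixes \<gamma> q :: complex
  assumes q: "norm q < 1" and \<gamma>: "norm \<gamma> < 1"
begin

lemma summable_qbin_correlation:
  assumes "\<And>k. norm (u k) \<le> 1"
  shows "summable (\<lambda>k. qbin \<gamma> q k * qbin \<gamma> q (k + n) * u k)"
proof -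
  obtain \<rho> C where "\<forall>u n. (\<forall>k. norm (u k) \<le> 1) \<longrightarrow> summable (\<lambda>k. qbin \<gamma> q k * qbin \<gamma> q (k + n) * u k) \<and>
      norm (\<Sum>k. qbin \<gamma> q k * qbin \<gamma> q (k + n) * u k) \<le> C * \<rho> ^ n"
    using qbin_correlation_bounds[OF q \<gamma>] by (elim exE conjE)
  from this[THEN spec[of _ u], THEN spec[of _ n]] show ?thesis
    using assms by simp
qed

lemma moment_sums: "(\<lambda>k. qbin \<gamma> q k * qbin \<gamma> q (k + n)) sums moment \<gamma> q n"
  unfolding moment_def using summable_qbin_correlation[of "\<lambda>_. 1"] by (simp add: summable_sums)

lemma skew_moment_sums: "(\<lambda>k. qbin \<gamma> q k * qbin \<gamma> q (k + n) * q ^ k) sums skew_moment \<gamma> q n"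
proof -
  have "norm (q ^ k) \<le> 1" for k
    using q by (simp add: norm_power power_le_one)
  from summable_qbin_correlation[of "\<lambda>k. q ^ k", OF this] show ?thesis
    unfolding skew_moment_def by (rule summable_sums)
qed

text \<open>
  This is the recurrence that \<open>F(y) = A(y) A(q / y)\<close> satisfies because
  \<open>(y - \<gamma>) F(q y) = - (1 - \<gamma> y) F(y)\<close>. Both sides of the functional equation equal
  \<open>(y - 1) A(q y) A(q / y)\<close>, whose coefficients are eliminated.
\<close>

lemma skew_moment_Suc:
  "skew_moment \<gamma> q (Suc n) * (1 - \<gamma> * q ^ Suc n) = skew_moment \<gamma> q n * (\<gamma> - q ^ n)"
proof -
  define h where "h = (\<lambda>n. \<Sum>k. qbin \<gamma> q k * qbin \<gamma> q (k + n) * (q ^ k * q ^ (k + n)))"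
  have h: "(\<lambda>k. qbin \<gamma> q k * qbin \<gamma> q (k + n) * (q ^ k * q ^ (k + n))) sums h n" for n
  proof -
    have "norm (q ^ k * q ^ (k + n)) \<le> 1" for k
      using q by (simp add: norm_mult norm_power power_le_one mult_le_one)
    from summable_qbin_correlation[of "\<lambda>k. q ^ k * q ^ (k + n)", OF this] show ?thesis
      unfolding h_def by (rule summable_sums)
  qed
  have "(\<lambda>k. qbin \<gamma> q k * qbin \<gamma> q (k + Suc n) * q ^ k
           - qbin \<gamma> q k * qbin \<gamma> q (k + Suc n) * (q ^ k * q ^ (k + Suc n)))
          sums (skew_moment \<gamma> q (Suc n) - h (Suc n))"
    by (intro sums_diff skew_moment_sums h)
  moreover have "(\<lambda>k. \<gamma> * (qbin \<gamma> q k * qbin \<gamma> q (k + n) * q ^ k)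
           - qbin \<gamma> q k * qbin \<gamma> q (k + n) * (q ^ k * q ^ (k + n)))
          sums (\<gamma> * skew_moment \<gamma> q n - h n)"
    by (intro sums_diff sums_mult skew_moment_sums h)
  moreover have "qbin \<gamma> q k * qbin \<gamma> q (k + Suc n) * q ^ k
           - qbin \<gamma> q k * qbin \<gamma> q (k + Suc n) * (q ^ k * q ^ (k + Suc n)) =
         \<gamma> * (qbin \<gamma> q k * qbin \<gamma> q (k + n) * q ^ k)
           - qbin \<gamma> q k * qbin \<gamma> q (k + n) * (q ^ k * q ^ (k + n))" for k
  proof -
    have "qbin \<gamma> q k * q ^ k * (qbin \<gamma> q (Suc (k + n)) * (1 - q ^ Suc (k + n))) =
          qbin \<gamma> q k * q ^ k * (qbin \<gamma> q (k + n) * (\<gamma> - q ^ (k + n)))"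
      by (simp only: qbin_Suc[OF q])
    then show ?thesis
      by (simp add: algebra_simps)
  qed
  ultimately have 1: "skew_moment \<gamma> q (Suc n) - h (Suc n) = \<gamma> * skew_moment \<gamma> q n - h n"
    using sums_unique2 by fastforce
  have "(\<lambda>k. q ^ n * (qbin \<gamma> q k * qbin \<gamma> q (k + n) * q ^ k)
           - qbin \<gamma> q k * qbin \<gamma> q (k + n) * (q ^ k * q ^ (k + n)))
          sums (q ^ n * skew_moment \<gamma> q n - h n)"
    by (intro sums_diff sums_mult skew_moment_sums h)
  then have "(\<lambda>k. q ^ n * (qbin \<gamma> q (Suc k) * qbin \<gamma> q (Suc k + n) * q ^ Suc k)
           - qbin \<gamma> q (Suc k) * qbin \<gamma> q (Suc k + n) * (q ^ Suc k * q ^ (Suc k + n)))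
          sums (q ^ n * skew_moment \<gamma> q n - h n)"
    by (subst sums_Suc_iff) simp
  moreover have "(\<lambda>k. \<gamma> * q ^ Suc n * (qbin \<gamma> q k * qbin \<gamma> q (k + Suc n) * q ^ k)
           - qbin \<gamma> q k * qbin \<gamma> q (k + Suc n) * (q ^ k * q ^ (k + Suc n)))
          sums (\<gamma> * q ^ Suc n * skew_moment \<gamma> q (Suc n) - h (Suc n))"
    by (intro sums_diff sums_mult skew_moment_sums h)
  moreover have "q ^ n * (qbin \<gamma> q (Suc k) * qbin \<gamma> q (Suc k + n) * q ^ Suc k)
           - qbin \<gamma> q (Suc k) * qbin \<gamma> q (Suc k + n) * (q ^ Suc k * q ^ (Suc k + n)) =
         \<gamma> * q ^ Suc n * (qbin \<gamma> q k * qbin \<gamma> q (k + Suc n) * q ^ k)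
           - qbin \<gamma> q k * qbin \<gamma> q (k + Suc n) * (q ^ k * q ^ (k + Suc n))" for k
  proof -
    have "(qbin \<gamma> q (Suc k) * (1 - q ^ Suc k)) * qbin \<gamma> q (Suc k + n) * q ^ (Suc k + n) =
          (qbin \<gamma> q k * (\<gamma> - q ^ k)) * qbin \<gamma> q (Suc k + n) * q ^ (Suc k + n)"
      by (simp only: qbin_Suc[OF q])
    then show ?thesis
      by (simp add: algebra_simps power_add)
  qed
  ultimately have 2: "q ^ n * skew_moment \<gamma> q n - h n = \<gamma> * q ^ Suc n * skew_moment \<gamma> q (Suc n) - h (Suc n)"
    using sums_unique2 by fastforce
  from arg_cong2[OF 1 2, of "(+)"] show ?thesis
    by (simp add: algebra_simps)
qed

text \<open>
  In terms of functions, \<open>(1 + \<gamma>) A(y) A(1/y) = F(y) + F(1/y)\<close>. On coefficients the difference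
  of the two sides does not depend on \<open>n\<close>, and it tends to \<open>0\<close>.
\<close>

lemma moment_eq_skew_moment: "(1 + \<gamma>) * moment \<gamma> q n = (1 + q ^ n) * skew_moment \<gamma> q n"
proof -
  define L where "L = (\<lambda>n. (1 + \<gamma>) * moment \<gamma> q n - (1 + q ^ n) * skew_moment \<gamma> q n)"
  have "L (Suc n) = L n" for n
  proof -
    define a where "a = qbin \<gamma> q"
    have s1: "(\<lambda>k. \<gamma> * (a k * a (k + n)) - q ^ n * (a k * a (k + n) * q ^ k))
            sums (\<gamma> * moment \<gamma> q n - q ^ n * skew_moment \<gamma> q n)"
      unfolding a_def by (intro sums_diff sums_mult moment_sums skew_moment_sums)
    have "(\<lambda>k. a k * a (k + n) - a k * a (k + n) * q ^ k) sums (moment \<gamma> q n - skew_moment \<gamma> q n)"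
      unfolding a_def by (intro sums_diff moment_sums skew_moment_sums)
    then have s2: "(\<lambda>k. a (Suc k) * a (Suc k + n) - a (Suc k) * a (Suc k + n) * q ^ Suc k)
            sums (moment \<gamma> q n - skew_moment \<gamma> q n)"
      by (subst sums_Suc_iff) simp
    have s3: "(\<lambda>k. (1 + \<gamma>) * (a k * a (k + Suc n)) - (1 + q ^ Suc n) * (a k * a (k + Suc n) * q ^ k)) sums L (Suc n)"
      unfolding a_def L_def by (intro sums_diff sums_mult moment_sums skew_moment_sums)
    have "(\<gamma> * (a k * a (k + n)) - q ^ n * (a k * a (k + n) * q ^ k))
            + (a (Suc k) * a (Suc k + n) - a (Suc k) * a (Suc k + n) * q ^ Suc k) =
          (1 + \<gamma>) * (a k * a (k + Suc n)) - (1 + q ^ Suc n) * (a k * a (k + Suc n) * q ^ k)" for k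
    proof -
      have "a k * (a (Suc (k + n)) * (1 - q ^ Suc (k + n))) = a k * (a (k + n) * (\<gamma> - q ^ (k + n)))"
        "(a (Suc k) * (1 - q ^ Suc k)) * a (Suc (k + n)) = (a k * (\<gamma> - q ^ k)) * a (Suc (k + n))"
        unfolding a_def by (simp_all only: qbin_Suc[OF q])
      from arg_cong2[OF this, of "(-)"] show ?thesis
        by (simp add: algebra_simps power_add)
    qed
    with sums_add[OF s1 s2] have "(\<lambda>k. (1 + \<gamma>) * (a k * a (k + Suc n)) - (1 + q ^ Suc n) * (a k * a (k + Suc n) * q ^ k))
        sums (\<gamma> * moment \<gamma> q n - q ^ n * skew_moment \<gamma> q n + (moment \<gamma> q n - skew_moment \<gamma> q n))"
      by (simp only:)
    from sums_unique2[OF s3 this] show ?thesis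
      by (simp add: L_def algebra_simps)
  qed
  then have const: "L n = L 0" for n
    by (induction n) auto
  obtain \<rho> C where \<rho>: "0 < \<rho>" "\<rho> < 1"
    and C': "\<forall>u n. (\<forall>k. norm (u k) \<le> 1) \<longrightarrow> summable (\<lambda>k. qbin \<gamma> q k * qbin \<gamma> q (k + n) * u k) \<and>
      norm (\<Sum>k. qbin \<gamma> q k * qbin \<gamma> q (k + n) * u k) \<le> C * \<rho> ^ n"
    using qbin_correlation_bounds[OF q \<gamma>] by (elim exE conjE)
  have C: "norm (\<Sum>k. qbin \<gamma> q k * qbin \<gamma> q (k + n) * u k) \<le> C * \<rho> ^ n" if "\<And>k. norm (u k) \<le> 1" for u n
    using C'[THEN spec[of _ u], THEN spec[of _ n]] that by simp
  have lim: "(\<lambda>n. C * \<rho> ^ n) \<longlonglongrightarrow> 0"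
    using \<rho> by (intro tendsto_mult_right_zero LIMSEQ_power_zero) simp
  have "moment \<gamma> q \<longlonglongrightarrow> 0"
    using C[of "\<lambda>_. 1"] by (intro Lim_null_comparison[OF _ lim] always_eventually) (simp add: moment_def)
  moreover have "skew_moment \<gamma> q \<longlonglongrightarrow> 0"
    using C[of "\<lambda>k. q ^ k"] q
    by (intro Lim_null_comparison[OF _ lim] always_eventually)
      (simp add: skew_moment_def norm_power power_le_one)
  ultimately have "L \<longlonglongrightarrow> (1 + \<gamma>) * 0 - (1 + 0) * 0"
    unfolding L_def using q by (intro tendsto_intros LIMSEQ_power_zero)
  moreover have "L \<longlonglongrightarrow> L n" for n
    using const[of n] by (metis (no_types, lifting) const ext tendsto_const)
  ultimately have "L n = 0"
    using LIMSEQ_unique by fastforce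
  then show ?thesis
    by (simp add: L_def)
qed

end

text \<open>
  Replacing \<open>\<gamma>\<close> by \<open>q \<gamma>\<close> multiplies \<open>A(y)\<close> by \<open>1 - \<gamma> y\<close>.
\<close>

lemma qbin_shift:
  assumes "norm q < 1"
  shows "qbin (q * \<gamma>) q (Suc k) = qbin \<gamma> q (Suc k) - \<gamma> * qbin \<gamma> q k"
proof -
  have nz: "1 - q ^ Suc k \<noteq> 0"
    using one_minus_nonzero[OF norm_mult_power_less_1[OF assms assms, of k]] by simp
  have "(\<Prod>j<Suc k. q * \<gamma> - q ^ j) = (q * \<gamma> - 1) * (\<Prod>j<k. q * (\<gamma> - q ^ j))"
    unfolding prod.lessThan_Suc_shift by (simp add: algebra_simps)
  also have "\<dots> = (q * \<gamma> - 1) * (q ^ k * (\<Prod>j<k. \<gamma> - q ^ j))"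
    by (simp only: prod.distrib prod_constant card_lessThan)
  finally have "qbin (q * \<gamma>) q (Suc k) * (1 - q ^ Suc k) = (q * \<gamma> - 1) * q ^ k * qbin \<gamma> q k"
    using qpoch_nonzero[OF assms assms] nz
    unfolding qbin_def qpoch_Suc by simp
  also have "\<dots> = (qbin \<gamma> q (Suc k) - \<gamma> * qbin \<gamma> q k) * (1 - q ^ Suc k)"
    using qbin_Suc[OF assms, of \<gamma> k] by (simp add: algebra_simps)
  finally show ?thesis
    using nz by simp
qed

text \<open>
  Hence the mass for \<open>q \<gamma>\<close> is a combination of the first two moments for \<open>\<gamma>\<close>, whose quotient is
  known.
\<close>

lemma moment_0_shift:
  assumes q: "norm q < 1" and \<gamma>: "norm \<gamma> < 1"
  shows "moment (q * \<gamma>) q 0 * (1 - \<gamma> * q) = moment \<gamma> q 0 * ((1 + \<gamma>) * (1 - \<gamma>\<^sup>2 * q))"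
proof -
  have \<gamma>': "norm (q * \<gamma>) < 1"
    using norm_mult_power_less_1[OF \<gamma> q, of 1] by (simp add: mult.commute)
  define a where "a = qbin \<gamma> q"
  have "(\<lambda>k. a (Suc k) * a (Suc k)) sums (moment \<gamma> q 0 - 1)"
    using moment_sums[OF q \<gamma>, of 0] by (subst sums_Suc_iff) (simp add: a_def)
  then have s: "(\<lambda>k. a (Suc k) * a (Suc k) - 2 * \<gamma> * (a k * a (k + 1)) + \<gamma>\<^sup>2 * (a k * a (k + 0))) sums
          (moment \<gamma> q 0 - 1 - 2 * \<gamma> * moment \<gamma> q 1 + \<gamma>\<^sup>2 * moment \<gamma> q 0)"
    unfolding a_def by (intro sums_add sums_diff sums_mult moment_sums q \<gamma>)
  have s': "(\<lambda>k. qbin (q * \<gamma>) q (Suc k) * qbin (q * \<gamma>) q (Suc k)) sums (moment (q * \<gamma>) q 0 - 1)"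
    using moment_sums[OF q \<gamma>', of 0] by (subst sums_Suc_iff) simp
  have e: "qbin (q * \<gamma>) q (Suc k) * qbin (q * \<gamma>) q (Suc k) =
      a (Suc k) * a (Suc k) - 2 * \<gamma> * (a k * a (k + 1)) + \<gamma>\<^sup>2 * (a k * a (k + 0))" for k
    unfolding qbin_shift[OF q] a_def by (simp add: algebra_simps power2_eq_square)
  have w: "moment (q * \<gamma>) q 0 = (1 + \<gamma>\<^sup>2) * moment \<gamma> q 0 - 2 * \<gamma> * moment \<gamma> q 1"
    using sums_unique2[OF s'[unfolded e] s] by (simp add: algebra_simps)
  have nz: "1 + \<gamma> \<noteq> 0"
    using one_minus_nonzero[of "- \<gamma>"] \<gamma> by simp
  have "(1 + \<gamma>) * ((1 - \<gamma> * q) * (2 * moment \<gamma> q 1)) = 2 * (1 - \<gamma> * q) * ((1 + \<gamma>) * moment \<gamma> q 1)"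
    by (simp only: mult_ac)
  also have "\<dots> = 2 * (1 + q) * (skew_moment \<gamma> q (Suc 0) * (1 - \<gamma> * q ^ Suc 0))"
    unfolding moment_eq_skew_moment[OF q \<gamma>, of 1] by (simp add: algebra_simps)
  also have "\<dots> = (1 + q) * (\<gamma> - 1) * (2 * skew_moment \<gamma> q 0)"
    unfolding skew_moment_Suc[OF q \<gamma>, of 0] by (simp add: mult_ac)
  also have "2 * skew_moment \<gamma> q 0 = (1 + \<gamma>) * moment \<gamma> q 0"
    using moment_eq_skew_moment[OF q \<gamma>, of 0] by simp
  finally have m1: "(1 - \<gamma> * q) * (2 * moment \<gamma> q 1) = (1 + q) * (\<gamma> - 1) * moment \<gamma> q 0"
    using nz by (simp add: mult_ac)
  have "moment (q * \<gamma>) q 0 * (1 - \<gamma> * q) =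
      (1 + \<gamma>\<^sup>2) * moment \<gamma> q 0 * (1 - \<gamma> * q) - \<gamma> * ((1 - \<gamma> * q) * (2 * moment \<gamma> q 1))"
    unfolding w by (simp add: algebra_simps)
  then show ?thesis
    unfolding m1 by (simp add: algebra_simps power2_eq_square)
qed

lemma moment_0_tendsto:
  assumes q: "norm q < 1" and \<gamma>: "norm \<gamma> < 1"
  shows "(\<lambda>N. moment (\<gamma> * q ^ N) q 0) \<longlonglongrightarrow> moment 0 q 0"
proof -
  obtain \<rho> where \<rho>: "norm \<gamma> < \<rho>" "\<rho> < 1"
    using \<gamma> dense by blast
  then have pos: "0 < \<rho>"
    using norm_ge_zero[of \<gamma>] by linarith
  obtain K where K: "K > 0" "\<And>\<gamma> k. norm \<gamma> \<le> \<rho> \<Longrightarrow> norm (qbin \<gamma> q k) \<le> K * \<rho> ^ k"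
    using qbin_bounded[OF q pos] by blast
  have le: "norm (\<gamma> * q ^ N) \<le> \<rho>" for N
    using \<rho> q mult_left_le[of "norm q ^ N" "norm \<gamma>"] by (simp add: norm_mult norm_power power_le_one)
  have "norm (qbin (\<gamma> * q ^ N) q k * qbin (\<gamma> * q ^ N) q k) \<le> (K * \<rho> ^ k) * (K * \<rho> ^ k)" for N k
    unfolding norm_mult using K(2)[OF le] by (intro mult_mono) (auto simp: K(1) pos less_imp_le)
  then have "norm (qbin (\<gamma> * q ^ N) q k * qbin (\<gamma> * q ^ N) q k) \<le> K\<^sup>2 * (\<rho>\<^sup>2) ^ k" for N k
    by (simp add: power2_eq_square power_mult_distrib mult_ac)
  moreover have "summable (\<lambda>k. K\<^sup>2 * (\<rho>\<^sup>2) ^ k)"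
    using \<rho> pos by (intro summable_mult summable_geometric) (simp add: power_less_one_iff)
  moreover have "(\<lambda>N. qbin (\<gamma> * q ^ N) q k * qbin (\<gamma> * q ^ N) q k) \<longlonglongrightarrow> qbin 0 q k * qbin 0 q k" for k
  proof -
    have "(\<lambda>N. \<gamma> * q ^ N) \<longlonglongrightarrow> 0"
      using q by (intro tendsto_mult_right_zero LIMSEQ_power_zero)
    then show ?thesis
      unfolding qbin_def by (intro tendsto_intros qpoch_nonzero q)
  qed
  ultimately show ?thesis
    unfolding moment_def
    using tannerys_theorem[of "\<lambda>k N. qbin (\<gamma> * q ^ N) q k * qbin (\<gamma> * q ^ N) q k"
        "\<lambda>k. qbin 0 q k * qbin 0 q k" sequentially "\<lambda>k. K\<^sup>2 * (\<rho>\<^sup>2) ^ k"]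
    by (simp add: case_prod_unfold)
qed

text \<open>
  The ratio of the total mass and the claimed product does not change when \<open>\<gamma>\<close> is replaced by
  \<open>q \<gamma>\<close>, and it is continuous at \<open>\<gamma> = 0\<close>; so it is the same for all \<open>\<gamma>\<close>. For \<open>\<gamma> = q\<close> the
  function \<open>A\<close> is \<open>1 - y\<close> and the mass is \<open>1 + 1\<close>.
\<close>

theorem moment_0:
  assumes q: "norm q < 1" and \<gamma>: "norm \<gamma> < 1"
  shows "moment \<gamma> q 0 = 2 * (qpoch_inf \<gamma> q * qpoch_inf (q * \<gamma>) q) / (qpoch_inf (\<gamma>\<^sup>2) q * qpoch_inf q q)"
proof -
  define R where "R = (\<lambda>\<gamma>. moment \<gamma> q 0 * (qpoch_inf (\<gamma>\<^sup>2) q * qpoch_inf q q) /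
                             (qpoch_inf \<gamma> q * qpoch_inf (q * \<gamma>) q))"
  have sq: "norm (\<gamma>\<^sup>2) < 1" if "norm \<gamma> < 1" for \<gamma> :: complex
    using that by (simp add: norm_power power_less_one_iff)
  have qg: "norm (q * \<gamma>) < 1" if "norm \<gamma> < 1" for \<gamma> :: complex
    using norm_mult_power_less_1[OF that q, of 1] by (simp add: mult.commute)
  have step: "R (q * \<gamma>) = R \<gamma>" if g: "norm \<gamma> < 1" for \<gamma>
  proof -
    have e1: "qpoch_inf (\<gamma>\<^sup>2) q = (1 - \<gamma>\<^sup>2) * ((1 - \<gamma>\<^sup>2 * q) * qpoch_inf ((q * \<gamma>)\<^sup>2) q)"
      using qpoch_inf_step[OF q, of "\<gamma>\<^sup>2"] qpoch_inf_step[OF q, of "\<gamma>\<^sup>2 * q"]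
      by (simp add: power2_eq_square mult_ac)
    have e2: "qpoch_inf \<gamma> q = (1 - \<gamma>) * qpoch_inf (q * \<gamma>) q"
      using qpoch_inf_step[OF q, of \<gamma>] by (simp add: mult.commute)
    have e3: "qpoch_inf (q * \<gamma>) q = (1 - \<gamma> * q) * qpoch_inf (q * (q * \<gamma>)) q"
      using qpoch_inf_step[OF q, of "q * \<gamma>"] by (simp add: mult_ac)
    have nz: "1 - \<gamma> \<noteq> 0" "1 - \<gamma> * q \<noteq> 0" "qpoch_inf (q * \<gamma>) q \<noteq> 0" "qpoch_inf (q * (q * \<gamma>)) q \<noteq> 0"
      using one_minus_nonzero[OF g] one_minus_nonzero[OF qg[OF g]]
        qpoch_inf_nonzero[OF qg[OF g] q] qpoch_inf_nonzero[OF qg[OF qg[OF g]] q]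
      by (simp_all add: mult.commute)
    define M M' X Y Z where "M = moment \<gamma> q 0" and "M' = moment (q * \<gamma>) q 0"
      and "X = qpoch_inf ((q * \<gamma>)\<^sup>2) q" and "Y = qpoch_inf (q * (q * \<gamma>)) q" and "Z = qpoch_inf q q"
    have M: "M' * (1 - \<gamma> * q) = M * ((1 + \<gamma>) * (1 - \<gamma>\<^sup>2 * q))"
      unfolding M_def M'_def by (rule moment_0_shift[OF q g])
    have Y: "Y \<noteq> 0"
      using nz by (simp add: Y_def)
    have "M' * (X * Z) * ((1 - \<gamma>) * ((1 - \<gamma> * q) * Y) * ((1 - \<gamma> * q) * Y)) =
          (M' * (1 - \<gamma> * q)) * ((1 - \<gamma>) * (X * Z) * Y * ((1 - \<gamma> * q) * Y))"
      by (simp only: mult_ac)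
    also have "\<dots> = M * ((1 - \<gamma>) * (1 + \<gamma>) * ((1 - \<gamma>\<^sup>2 * q) * X) * Z) * ((1 - \<gamma> * q) * Y * Y)"
      unfolding M by (simp only: mult_ac)
    also have "(1 - \<gamma>) * (1 + \<gamma>) = 1 - \<gamma>\<^sup>2"
      by (simp add: algebra_simps power2_eq_square)
    finally have "M' * (X * Z) / ((1 - \<gamma> * q) * Y * Y) =
        M * ((1 - \<gamma>\<^sup>2) * ((1 - \<gamma>\<^sup>2 * q) * X) * Z) /
          ((1 - \<gamma>) * ((1 - \<gamma> * q) * Y) * ((1 - \<gamma> * q) * Y))"
      using nz Y by (subst frac_eq_eq) simp_all
    then show ?thesis
      unfolding R_def e1 e2 unfolding e3 M_def M'_def X_def Y_def Z_def .
  qed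
  have R0: "R \<gamma> = moment 0 q 0 * qpoch_inf q q" if g: "norm \<gamma> < 1" for \<gamma>
  proof -
    have const: "R (\<gamma> * q ^ N) = R \<gamma>" for N
    proof (induction N)
      case (Suc N)
      then show ?case
        using step[OF norm_mult_power_less_1[OF g q, of N]] by (simp add: mult.left_commute)
    qed simp
    have "(\<lambda>N. qpoch_inf (\<gamma>\<^sup>2 * q ^ (2 * N)) q) \<longlonglongrightarrow> 1"
      using filterlim_compose[OF qpoch_inf_shift_tendsto[OF sq[OF g] q], of "\<lambda>N. 2 * N" sequentially]
      by (simp add: filterlim_subseq strict_mono_def)
    then have l1: "(\<lambda>N. qpoch_inf ((\<gamma> * q ^ N)\<^sup>2) q) \<longlonglongrightarrow> 1"
      by (simp add: power_mult_distrib power_mult[symmetric] mult.commute)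
    have l2: "(\<lambda>N. qpoch_inf (\<gamma> * q ^ N) q) \<longlonglongrightarrow> 1"
      by (rule qpoch_inf_shift_tendsto[OF g q])
    have l3: "(\<lambda>N. qpoch_inf (q * (\<gamma> * q ^ N)) q) \<longlonglongrightarrow> 1"
      using qpoch_inf_shift_tendsto[OF qg[OF g] q] by (simp add: mult.assoc)
    have "(\<lambda>N. R (\<gamma> * q ^ N)) \<longlonglongrightarrow> moment 0 q 0 * (1 * qpoch_inf q q) / (1 * 1)"
      unfolding R_def by (intro tendsto_intros moment_0_tendsto[OF q g] l1 l2 l3) simp
    then show ?thesis
      unfolding const using LIMSEQ_unique[OF tendsto_const] by fastforce
  qed
  have "moment q q 0 = 2"
  proof -
    have "qbin q q 1 = - 1"
      using one_minus_nonzero[OF q] by (simp add: qbin_def qpoch_def divide_simps)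
    moreover have "qbin q q k = 0" if "k \<notin> {0, 1}" for k
      using that unfolding qbin_def by (auto intro!: bexI[of _ 1])
    ultimately have "(\<lambda>k. qbin q q k * qbin q q k) sums (\<Sum>k\<in>{0, 1}. qbin q q k * qbin q q k)"
      by (intro sums_finite) auto
    then show ?thesis
      using \<open>qbin q q 1 = - 1\<close> by (simp add: moment_def sums_unique[symmetric])
  qed
  then have "R q = 2"
    using qpoch_inf_nonzero[OF q q] qpoch_inf_nonzero[OF qg[OF q] q]
    by (simp add: R_def power2_eq_square)
  then have "R \<gamma> = 2"
    using R0[OF q] R0[OF \<gamma>] by simp
  then show ?thesis
    using qpoch_inf_nonzero[OF q q] qpoch_inf_nonzero[OF sq[OF \<gamma>] q]
      qpoch_inf_nonzero[OF \<gamma> q] qpoch_inf_nonzero[OF qg[OF \<gamma>] q]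
    by (simp add: R_def field_simps)
qed

section \<open>Integrals against the weight\<close>

lemma has_integral_suminf:
  fixes f :: "nat \<Rightarrow> real \<Rightarrow> complex"
  assumes cont: "\<And>k. continuous_on {a..b} (f k)"
    and bound: "\<And>k x. x \<in> {a..b} \<Longrightarrow> norm (f k x) \<le> M k"
    and M: "summable M"
    and int: "\<And>k. (f k has_integral I k) {a..b}"
  shows "((\<lambda>x. \<Sum>k. f k x) has_integral (\<Sum>k. I k)) {a..b}"
    and "continuous_on {a..b} (\<lambda>x. \<Sum>k. f k x)"
    and "summable I"
proof -
  have u: "uniform_limit {a..b} (\<lambda>n x. \<Sum>k<n. f k x) (\<lambda>x. \<Sum>k. f k x) sequentially"
    using bound M by (rule Weierstrass_m_test)
  have c: "continuous_on {a..b} (\<lambda>x. \<Sum>k<n. f k x)" for n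
    by (intro continuous_intros cont)
  show "continuous_on {a..b} (\<lambda>x. \<Sum>k. f k x)"
    using u by (rule uniform_limit_theorem[rotated]) (auto intro!: always_eventually c)
  obtain I' J where I': "\<And>n. ((\<lambda>x. \<Sum>k<n. f k x) has_integral I' n) {a..b}"
    and J: "((\<lambda>x. \<Sum>k. f k x) has_integral J) {a..b}" and lim: "I' \<longlonglongrightarrow> J"
    using uniform_limit_integral[OF u c] by auto
  have "I' n = (\<Sum>k<n. I k)" for n
    using I'[of n] has_integral_sum[of "{..<n}" f I "{a..b}"] int has_integral_unique by blast
  then have "I' = (\<lambda>n. \<Sum>k<n. I k)"
    by (rule ext)
  with lim have "I sums J"
    by (simp add: sums_def)
  with J show "((\<lambda>x. \<Sum>k. f k x) has_integral (\<Sum>k. I k)) {a..b}" and "summable I"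
    by (simp_all add: sums_iff)
qed

lemma integral_cis_powers:
  "((\<lambda>\<theta>. cis \<theta> ^ a * inverse (cis \<theta>) ^ b) has_integral (if a = b then 2 * of_real pi else 0)) {-pi..pi}"
proof -
  define m where "m = real a - real b"
  have z: "cis \<theta> ^ a * inverse (cis \<theta>) ^ b = cis (m * \<theta>)" for \<theta>
  proof -
    have "cis \<theta> ^ a * inverse (cis \<theta>) ^ b = cis (real a * \<theta>) * cis (real b * (- \<theta>))"
      unfolding cis_inverse by (simp add: Complex.DeMoivre)
    then show ?thesis
      by (simp add: m_def cis_mult algebra_simps)
  qed
  show ?thesis
  proof (cases "a = b")
    case True
    then have "cis \<theta> ^ a * inverse (cis \<theta>) ^ b = 1" for \<theta>
      unfolding z m_def by simp
    moreover have "((\<lambda>_. 1 :: complex) has_integral 2 * of_real pi) {-pi..pi}"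
      using has_integral_const_real[of "1::complex" "-pi" pi] by (simp add: scaleR_conv_of_real)
    ultimately show ?thesis
      using True by (simp only: if_True simp_thms)
  next
    case False
    then have m: "m \<noteq> 0"
      by (simp add: m_def)
    have "((\<lambda>\<theta>. cis (m * \<theta>)) has_integral cis (m * pi) / (\<i> * m) - cis (m * (- pi)) / (\<i> * m)) {-pi..pi}"
    proof (rule fundamental_theorem_of_calculus)
      fix x assume "x \<in> {-pi..pi}"
      have "((\<lambda>\<theta>. exp (\<i> * of_real (m * \<theta>)) / (\<i> * m)) has_vector_derivative exp (\<i> * of_real (m * x)))
              (at x within {-pi..pi})"
        using m by (auto intro!: derivative_eq_intros has_vector_derivative_real_field simp: field_simps)
      then show "((\<lambda>\<theta>. cis (m * \<theta>) / (\<i> * m)) has_vector_derivative cis (m * x)) (at x within {-pi..pi})"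
        by (simp only: cis_conv_exp)
    qed simp
    moreover have "cis (m * pi) = cis (m * (- pi))"
    proof -
      have "sin (m * pi) = 0"
        by (simp add: m_def sin_times_pi_eq_0)
      then show ?thesis
        by (simp add: complex_eq_iff)
    qed
    ultimately show ?thesis
      unfolding z if_not_P[OF False] by simp
  qed
qed

text \<open>
  The weight in the variable \<open>z = e\<^sup>i\<^sup>\<theta>\<close>. Being analytic in \<open>\<gamma>\<close> and \<open>q\<close>, it is defined for complex
  parameters; for real ones the two factors are conjugate on the unit circle.
\<close>

definition weight :: "complex \<Rightarrow> complex \<Rightarrow> complex \<Rightarrow> complex" where
  "weight \<gamma> q z = qbin_sum \<gamma> q (z\<^sup>2) * qbin_sum \<gamma> q ((inverse z)\<^sup>2)"

context
  fixes \<gamma> q :: complex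
  assumes q: "norm q < 1" and \<gamma>: "norm \<gamma> < 1"
begin

text \<open>
  The series for the two factors of the weight are integrated one after the other, which
  avoids double series.
\<close>

lemma half_weight_moments:
  "((\<lambda>\<theta>. cis \<theta> ^ a * inverse (cis \<theta>) ^ b * qbin_sum \<gamma> q ((inverse (cis \<theta>))\<^sup>2)) has_integral
      2 * of_real pi * (if b \<le> a \<and> even (a - b) then qbin \<gamma> q ((a - b) div 2) else 0)) {-pi..pi}"
  "continuous_on {-pi..pi} (\<lambda>\<theta>. qbin_sum \<gamma> q ((inverse (cis \<theta>))\<^sup>2))"
proof -
  obtain K \<rho> where K: "K > 0" "0 < \<rho>" "\<rho> < 1" "\<And>k. norm (qbin \<gamma> q k) \<le> K * \<rho> ^ k"
    using qbin_geometric_bound[OF q \<gamma>] by blast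
  have M: "summable (\<lambda>k. K * \<rho> ^ k)"
    using K by (intro summable_mult summable_geometric) simp
  define f where "f = (\<lambda>a b k \<theta>. qbin \<gamma> q k * (cis \<theta> ^ a * inverse (cis \<theta>) ^ (b + 2 * k)))"
  define I where "I = (\<lambda>a b k. qbin \<gamma> q k * (if a = b + 2 * k then 2 * of_real pi else 0))"
  have f: "(f a b k has_integral I a b k) {-pi..pi}" for a b k
    unfolding f_def I_def by (intro has_integral_mult_right integral_cis_powers)
  have cont: "continuous_on {-pi..pi} (f a b k)" for a b k
    unfolding f_def by (intro continuous_intros continuous_on_cis) auto
  have bound: "norm (f a b k \<theta>) \<le> K * \<rho> ^ k" for a b k \<theta>
    using K(4)[of k] by (simp add: f_def norm_mult norm_power norm_inverse)
  have sum: "(\<Sum>k. f a b k \<theta>) = cis \<theta> ^ a * inverse (cis \<theta>) ^ b * qbin_sum \<gamma> q ((inverse (cis \<theta>))\<^sup>2)"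
    for a b \<theta>
  proof -
    have "(\<Sum>k. f a b k \<theta>) = (\<Sum>k. cis \<theta> ^ a * inverse (cis \<theta>) ^ b * (qbin \<gamma> q k * ((inverse (cis \<theta>))\<^sup>2) ^ k))"
      unfolding f_def power_add power_mult by (simp only: mult_ac)
    also have "\<dots> = cis \<theta> ^ a * inverse (cis \<theta>) ^ b * qbin_sum \<gamma> q ((inverse (cis \<theta>))\<^sup>2)"
      unfolding qbin_sum_def
      by (intro suminf_mult summable_qbin_power q \<gamma>) (simp add: norm_power norm_inverse)
    finally show ?thesis .
  qed
  have I: "(\<Sum>k. I a b k) = 2 * of_real pi * (if b \<le> a \<and> even (a - b) then qbin \<gamma> q ((a - b) div 2) else 0)"
  proof (cases "b \<le> a \<and> even (a - b)")
    case True
    then have "I a b = (\<lambda>k. if k = (a - b) div 2 then 2 * of_real pi * qbin \<gamma> q k else 0)"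
      by (auto simp: I_def fun_eq_iff)
    then have "I a b sums (2 * of_real pi * qbin \<gamma> q ((a - b) div 2))"
      using sums_single[of "(a - b) div 2" "\<lambda>k. 2 * of_real pi * qbin \<gamma> q k"] by simp
    then show ?thesis
      unfolding if_P[OF True] by (simp add: sums_iff)
  next
    case False
    then have "I a b k = 0" for k
      by (auto simp: I_def)
    then show ?thesis
      using False by auto
  qed
  show "((\<lambda>\<theta>. cis \<theta> ^ a * inverse (cis \<theta>) ^ b * qbin_sum \<gamma> q ((inverse (cis \<theta>))\<^sup>2)) has_integral
      2 * of_real pi * (if b \<le> a \<and> even (a - b) then qbin \<gamma> q ((a - b) div 2) else 0)) {-pi..pi}"
    using has_integral_suminf(1)[OF cont[of a b] bound[where a = a and b = b] M f[of a b]] unfolding sum I .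
  show "continuous_on {-pi..pi} (\<lambda>\<theta>. qbin_sum \<gamma> q ((inverse (cis \<theta>))\<^sup>2))"
    using has_integral_suminf(2)[OF cont[of 0 0] bound[where a = 0 and b = 0] M f[of 0 0]] unfolding sum by simp
qed

lemma qbin_sum_bounded:
  obtains B where "\<And>y. norm y \<le> 1 \<Longrightarrow> norm (qbin_sum \<gamma> q y) \<le> B"
proof -
  obtain K \<rho> where K: "K > 0" "0 < \<rho>" "\<rho> < 1" "\<And>k. norm (qbin \<gamma> q k) \<le> K * \<rho> ^ k"
    using qbin_geometric_bound[OF q \<gamma>] by blast
  have M: "summable (\<lambda>k. K * \<rho> ^ k)"
    using K by (intro summable_mult summable_geometric) simp
  have b: "norm (qbin \<gamma> q k * y ^ k) \<le> K * \<rho> ^ k" if "norm y \<le> 1" for y k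
    using mult_mono[OF K(4)[of k] power_le_one[OF _ that, of k]] K
    by (simp add: norm_mult norm_power)
  have "norm (qbin_sum \<gamma> q y) \<le> (\<Sum>k. K * \<rho> ^ k)" if "norm y \<le> 1" for y
    unfolding qbin_sum_def by (rule norm_suminf_le[OF b[OF that] M])
  then show ?thesis
    by (rule that)
qed

lemma weight_moments:
  "((\<lambda>\<theta>. cis \<theta> ^ a * inverse (cis \<theta>) ^ b * weight \<gamma> q (cis \<theta>)) has_integral
      2 * of_real pi * (if even (a + b) then moment \<gamma> q ((a - b + (b - a)) div 2) else 0)) {-pi..pi}"
  "continuous_on {-pi..pi} (\<lambda>\<theta>. weight \<gamma> q (cis \<theta>))"
proof -
  obtain K \<rho> where K: "K > 0" "0 < \<rho>" "\<rho> < 1" "\<And>k. norm (qbin \<gamma> q k) \<le> K * \<rho> ^ k"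
    using qbin_geometric_bound[OF q \<gamma>] by blast
  obtain B where B: "\<And>y. norm y \<le> 1 \<Longrightarrow> norm (qbin_sum \<gamma> q y) \<le> B"
    using qbin_sum_bounded by blast
  have M: "summable (\<lambda>k. K * \<rho> ^ k * B)"
    using K by (intro summable_mult2 summable_mult summable_geometric) simp
  define f where "f = (\<lambda>a b k \<theta>. qbin \<gamma> q k *
    (cis \<theta> ^ (a + 2 * k) * inverse (cis \<theta>) ^ b * qbin_sum \<gamma> q ((inverse (cis \<theta>))\<^sup>2)))"
  define I where "I = (\<lambda>a b k. qbin \<gamma> q k * (2 * of_real pi *
    (if b \<le> a + 2 * k \<and> even (a + 2 * k - b) then qbin \<gamma> q ((a + 2 * k - b) div 2) else 0)))"
  have f: "(f a b k has_integral I a b k) {-pi..pi}" for a b k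
    unfolding f_def I_def by (intro has_integral_mult_right half_weight_moments)
  have cont: "continuous_on {-pi..pi} (f a b k)" for a b k
    unfolding f_def by (intro continuous_intros continuous_on_cis half_weight_moments) auto
  have bound: "norm (f a b k \<theta>) \<le> K * \<rho> ^ k * B" for a b k \<theta>
    unfolding f_def norm_mult
    using K B[of "(inverse (cis \<theta>))\<^sup>2"] by (simp add: norm_power norm_inverse mult_mono)
  have sum: "(\<Sum>k. f a b k \<theta>) = cis \<theta> ^ a * inverse (cis \<theta>) ^ b * weight \<gamma> q (cis \<theta>)"
    for a b \<theta>
  proof -
    define c where "c = cis \<theta> ^ a * inverse (cis \<theta>) ^ b * qbin_sum \<gamma> q ((inverse (cis \<theta>))\<^sup>2)"
    have "(\<Sum>k. f a b k \<theta>) = (\<Sum>k. c * (qbin \<gamma> q k * ((cis \<theta>)\<^sup>2) ^ k))"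
      unfolding f_def c_def power_add power_mult by (simp only: mult_ac)
    also have "\<dots> = c * qbin_sum \<gamma> q ((cis \<theta>)\<^sup>2)"
      unfolding qbin_sum_def
      by (intro suminf_mult summable_qbin_power q \<gamma>) (simp add: norm_power)
    finally show ?thesis
      by (simp add: weight_def c_def mult_ac)
  qed
  have I: "(\<Sum>k. I a b k) = 2 * of_real pi * (if even (a + b) then moment \<gamma> q ((a - b + (b - a)) div 2) else 0)"
  proof (cases "even (a + b)")
    case False
    then have "I a b k = 0" for k
      by (auto simp: I_def)
    then show ?thesis
      using False by simp
  next
    case True
    consider n where "a = b + 2 * n" | n where "b = a + 2 * n"
    proof (cases "b \<le> a")
      case True
      with \<open>even (a + b)\<close> have "even (a - b)"
        by simp
      then obtain n where "a - b = 2 * n"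
        by (rule evenE)
      with True show ?thesis
        by (intro that(1)[of n]) simp
    next
      case False
      with \<open>even (a + b)\<close> have "even (b - a)"
        by simp
      then obtain n where "b - a = 2 * n"
        by (rule evenE)
      with False show ?thesis
        by (intro that(2)[of n]) simp
    qed
    then show ?thesis
    proof cases
      case 1
      then have "I a b = (\<lambda>k. 2 * of_real pi * (qbin \<gamma> q k * qbin \<gamma> q (k + n)))"
        by (simp add: I_def add.commute fun_eq_iff)
      then have "I a b sums (2 * of_real pi * moment \<gamma> q n)"
        by (simp only: sums_mult[OF moment_sums[OF q \<gamma>]])
      then show ?thesis
        using 1 by (simp add: sums_iff)
    next
      case 2
      have "I a b (k + n) = 2 * of_real pi * (qbin \<gamma> q k * qbin \<gamma> q (k + n))" for k
        using 2 by (simp add: I_def mult_ac)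
      then have "(\<lambda>k. I a b (k + n)) sums (2 * of_real pi * moment \<gamma> q n)"
        by (simp only: sums_mult[OF moment_sums[OF q \<gamma>]])
      moreover have "I a b k = 0" if "k < n" for k
        using 2 that by (simp add: I_def)
      ultimately have "I a b sums (2 * of_real pi * moment \<gamma> q n)"
        by (subst (asm) sums_iff_shift) simp
      then show ?thesis
        using 2 by (simp add: sums_iff)
    qed
  qed
  show "((\<lambda>\<theta>. cis \<theta> ^ a * inverse (cis \<theta>) ^ b * weight \<gamma> q (cis \<theta>)) has_integral
      2 * of_real pi * (if even (a + b) then moment \<gamma> q ((a - b + (b - a)) div 2) else 0)) {-pi..pi}"
    using has_integral_suminf(1)[OF cont[of a b] bound[where a = a and b = b] M f[of a b]] unfolding sum I .
  show "continuous_on {-pi..pi} (\<lambda>\<theta>. weight \<gamma> q (cis \<theta>))"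
    using has_integral_suminf(2)[OF cont[of 0 0] bound[where a = 0 and b = 0] M f[of 0 0]] unfolding sum by simp
qed

section \<open>Orthogonality\<close>

text \<open>
  The summand is well-poised, and it becomes a difference once the terms \<open>k\<close> and \<open>2 N - k\<close> are
  added, which is where the factor \<open>1 + q\<^bsup>N - k\<^esup>\<close> comes from. The closed form of the partial sums reflects
  that the Rogers polynomials are eigenfunctions of a \<open>q\<close>-difference operator that is symmetric for the weight.
\<close>

lemma well_poised_partial_sum:
  assumes "K \<le> N"
  shows "(1 - \<gamma>) * (1 - q ^ N) * (1 - \<gamma> * q ^ N) *
      (\<Sum>k<K. rcoef \<gamma> q k * rcoef \<gamma> q (2 * N - k) * ((1 + q ^ (N - k)) * skew_moment \<gamma> q (N - k))) =
    rcoef \<gamma> q K * rcoef \<gamma> q (2 * N - K) * (1 - q ^ K) * (1 - \<gamma> * q ^ (2 * N - K)) *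
      ((\<gamma> - q ^ (N - K)) * skew_moment \<gamma> q (N - K))"
  using assms
proof (induction K)
  case (Suc K)
  define l where "l = N - Suc K"
  have N: "N = Suc (K + l)"
    using Suc.prems by (simp add: l_def)
  define u v where "u = q ^ K" and "v = q ^ Suc l"
  have idx: "N - K = Suc l" "2 * N - K = Suc (2 * N - Suc K)" "2 * N - Suc K = K + 2 * l + 1"
    using N by auto
  have pw: "q ^ N = u * v" "q ^ (2 * N - K) = u * v\<^sup>2"
    using N by (simp_all add: u_def v_def power_add power2_eq_square power_mult mult_ac mult_2)
  define c d f where "c = rcoef \<gamma> q K" and "d = rcoef \<gamma> q (2 * N - K)" and "f = skew_moment \<gamma> q (Suc l)"
  have r1: "rcoef \<gamma> q (Suc K) * (1 - q ^ Suc K) = c * (1 - \<gamma> * u)"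
    by (simp only: rcoef_Suc[OF q] c_def u_def)
  have r2: "rcoef \<gamma> q (2 * N - Suc K) * (1 - \<gamma> * q ^ (2 * N - Suc K)) = d * (1 - u * v\<^sup>2)"
    using rcoef_Suc[OF q, of \<gamma> "2 * N - Suc K"] unfolding d_def idx(2)[symmetric] pw(2) by simp
  have r3: "(\<gamma> - q ^ l) * skew_moment \<gamma> q l = (1 - \<gamma> * v) * f"
    using skew_moment_Suc[OF q \<gamma>, of l] by (simp add: v_def f_def mult_ac)
  have "(1 - \<gamma>) * (1 - q ^ N) * (1 - \<gamma> * q ^ N) *
      (\<Sum>k<Suc K. rcoef \<gamma> q k * rcoef \<gamma> q (2 * N - k) * ((1 + q ^ (N - k)) * skew_moment \<gamma> q (N - k))) =
    c * d * (1 - u) * (1 - \<gamma> * (u * v\<^sup>2)) * ((\<gamma> - v) * f) +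
      (1 - \<gamma>) * (1 - u * v) * (1 - \<gamma> * (u * v)) * (c * d * ((1 + v) * f))"
    using Suc unfolding sum.lessThan_Suc distrib_left pw idx(1) c_def[symmetric] d_def[symmetric] f_def[symmetric]
      u_def[symmetric] v_def[symmetric] by simp
  also have "\<dots> = (c * (1 - \<gamma> * u)) * (d * (1 - u * v\<^sup>2)) * ((1 - \<gamma> * v) * f)"
    by (simp add: algebra_simps power2_eq_square)
  also have "\<dots> = rcoef \<gamma> q (Suc K) * rcoef \<gamma> q (2 * N - Suc K) * (1 - q ^ Suc K) * (1 - \<gamma> * q ^ (2 * N - Suc K)) *
      ((\<gamma> - q ^ l) * skew_moment \<gamma> q l)"
    unfolding r1[symmetric] r2[symmetric] r3[symmetric] by (simp only: mult_ac)
  finally show ?case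
    unfolding l_def .
qed simp

lemma sum_symmetric_split:
  fixes g :: "nat \<Rightarrow> complex"
  assumes "\<And>k. k < N \<Longrightarrow> g (2 * N - k) = g k"
  shows "(\<Sum>k\<le>2 * N. g k) = 2 * (\<Sum>k<N. g k) + g N"
proof -
  have "(\<Sum>k\<le>2 * N. g k) = (\<Sum>k\<in>{..<N} \<union> insert N {N<..2 * N}. g k)"
    by (rule sum.cong) auto
  also have "\<dots> = (\<Sum>k<N. g k) + (\<Sum>k\<in>insert N {N<..2 * N}. g k)"
    by (rule sum.union_disjoint) auto
  also have "(\<Sum>k\<in>insert N {N<..2 * N}. g k) = g N + (\<Sum>k\<in>{N<..2 * N}. g k)"
    by simp
  also have "(\<Sum>k\<in>{N<..2 * N}. g k) = (\<Sum>k<N. g (2 * N - k))"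
    by (rule sum.reindex_bij_witness[of _ "\<lambda>k. 2 * N - k" "\<lambda>k. 2 * N - k"]) auto
  also have "\<dots> = (\<Sum>k<N. g k)"
    by (rule sum.cong) (use assms in auto)
  finally show ?thesis
    by simp
qed

text \<open>
  At the midpoint \<open>K = N\<close> the closed form is minus half of the central term, so the two
  halves of the full sum cancel it.
\<close>

lemma rogers_moment_sum_eq_0:
  assumes "N \<ge> 1"
  shows "(\<Sum>k\<le>2 * N. rcoef \<gamma> q k * rcoef \<gamma> q (2 * N - k) * moment \<gamma> q (N - k + (k - N))) = 0"
proof -
  define g where "g = (\<lambda>k. rcoef \<gamma> q k * rcoef \<gamma> q (2 * N - k) * moment \<gamma> q (N - k + (k - N)))"
  have \<gamma>1: "1 + \<gamma> \<noteq> 0" "1 - \<gamma> \<noteq> 0"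
    using one_minus_nonzero[of "- \<gamma>"] one_minus_nonzero[OF \<gamma>] \<gamma> by simp_all
  have qN: "1 - q ^ N \<noteq> 0" "1 - \<gamma> * q ^ N \<noteq> 0"
    using assms one_minus_nonzero[OF norm_mult_power_less_1[OF q q, of "N - 1"]]
      one_minus_nonzero[OF norm_mult_power_less_1[OF \<gamma> q, of N]]
    by (simp_all add: power_Suc[symmetric] del: power_Suc)
  have "(1 + \<gamma>) * (\<Sum>k\<le>2 * N. g k) = 2 * (\<Sum>k<N. (1 + \<gamma>) * g k) + (1 + \<gamma>) * g N"
    by (subst sum_symmetric_split) (auto simp: g_def sum_distrib_left algebra_simps)
  also have "(\<Sum>k<N. (1 + \<gamma>) * g k) =
      (\<Sum>k<N. rcoef \<gamma> q k * rcoef \<gamma> q (2 * N - k) * ((1 + q ^ (N - k)) * skew_moment \<gamma> q (N - k)))"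
  proof (rule sum.cong[OF refl])
    fix k assume "k \<in> {..<N}"
    then have "(1 + \<gamma>) * g k = rcoef \<gamma> q k * rcoef \<gamma> q (2 * N - k) * ((1 + \<gamma>) * moment \<gamma> q (N - k))"
      by (simp add: g_def)
    then show "(1 + \<gamma>) * g k =
        rcoef \<gamma> q k * rcoef \<gamma> q (2 * N - k) * ((1 + q ^ (N - k)) * skew_moment \<gamma> q (N - k))"
      by (simp only: moment_eq_skew_moment[OF q \<gamma>])
  qed
  also have "\<dots> = - (rcoef \<gamma> q N * rcoef \<gamma> q N * skew_moment \<gamma> q 0)"
  proof -
    define S where "S = (\<Sum>k<N. rcoef \<gamma> q k * rcoef \<gamma> q (2 * N - k) * ((1 + q ^ (N - k)) * skew_moment \<gamma> q (N - k)))"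
    have "((1 - \<gamma>) * (1 - q ^ N) * (1 - \<gamma> * q ^ N)) * S =
        ((1 - \<gamma>) * (1 - q ^ N) * (1 - \<gamma> * q ^ N)) * - (rcoef \<gamma> q N * rcoef \<gamma> q N * skew_moment \<gamma> q 0)"
      using well_poised_partial_sum[of N N] unfolding S_def by (simp add: algebra_simps)
    then show ?thesis
      using \<gamma>1 qN unfolding S_def by (subst (asm) mult_left_cancel) auto
  qed
  also have "2 * - (rcoef \<gamma> q N * rcoef \<gamma> q N * skew_moment \<gamma> q 0) + (1 + \<gamma>) * g N = 0"
    using moment_eq_skew_moment[OF q \<gamma>, of 0] by (simp add: g_def mult_ac)
  finally show ?thesis
    using \<gamma>1 by (simp add: g_def)
qed

lemma integral_rogers:
  "((\<lambda>\<theta>. rogers n \<gamma> q (cis \<theta>) * weight \<gamma> q (cis \<theta>)) has_integral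
      (if n = 0 then 2 * of_real pi * moment \<gamma> q 0 else 0)) {-pi..pi}"
proof -
  have "((\<lambda>\<theta>. \<Sum>k\<le>n. rcoef \<gamma> q k * rcoef \<gamma> q (n - k) *
            (cis \<theta> ^ (n - k) * inverse (cis \<theta>) ^ k * weight \<gamma> q (cis \<theta>))) has_integral
        (\<Sum>k\<le>n. rcoef \<gamma> q k * rcoef \<gamma> q (n - k) * (2 * of_real pi *
            (if even (n - k + k) then moment \<gamma> q ((n - k - k + (k - (n - k))) div 2) else 0)))) {-pi..pi}"
    by (intro has_integral_sum has_integral_mult_right weight_moments) simp
  moreover have "(\<Sum>k\<le>n. rcoef \<gamma> q k * rcoef \<gamma> q (n - k) * (2 * of_real pi *
            (if even (n - k + k) then moment \<gamma> q ((n - k - k + (k - (n - k))) div 2) else 0))) =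
      (if n = 0 then 2 * of_real pi * moment \<gamma> q 0 else 0)" (is "?lhs = _")
  proof (cases "even n")
    case False
    then show ?thesis
      by (auto intro!: sum.neutral)
  next
    case True
    then obtain N where N: "n = 2 * N"
      by blast
    have "(2 * N - k - k + (k - (2 * N - k))) div 2 = N - k + (k - N)" if "k \<le> 2 * N" for k
      using that by (cases "k \<le> N") auto
    then have "?lhs = 2 * of_real pi * (\<Sum>k\<le>2 * N. rcoef \<gamma> q k * rcoef \<gamma> q (2 * N - k) * moment \<gamma> q (N - k + (k - N)))"
      unfolding sum_distrib_left N by (intro sum.cong) auto
    then show ?thesis
      using rogers_moment_sum_eq_0[of N] N by (cases "N = 0") auto
  qed
  moreover have "rogers n \<gamma> q (cis \<theta>) * weight \<gamma> q (cis \<theta>) =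
      (\<Sum>k\<le>n. rcoef \<gamma> q k * rcoef \<gamma> q (n - k) *
            (cis \<theta> ^ (n - k) * inverse (cis \<theta>) ^ k * weight \<gamma> q (cis \<theta>)))" for \<theta>
    by (simp only: rogers_def sum_distrib_right mult.assoc)
  ultimately show ?thesis
    by (simp only:)
qed

end

section \<open>Integrals of products of Rogers polynomials with different parameters\<close>

text \<open>
  The lower neighbour in the three-term recurrence, set to \<open>0\<close> for \<open>n = 0\<close>, where the recurrence
  has only two terms.
\<close>

definition rogers_down :: "nat \<Rightarrow> complex \<Rightarrow> complex \<Rightarrow> complex \<Rightarrow> complex" where
  "rogers_down n \<gamma> q z = (case n of 0 \<Rightarrow> 0 | Suc k \<Rightarrow> (1 - \<gamma>\<^sup>2 * q ^ k) * rogers k \<gamma> q z)"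

lemma rogers_three_term:
  assumes "norm q < 1" "z \<noteq> 0"
  shows "(z + inverse z) * (1 - \<gamma> * q ^ n) * rogers n \<gamma> q z =
         (1 - q ^ Suc n) * rogers (Suc n) \<gamma> q z + rogers_down n \<gamma> q z"
proof (cases n)
  case 0
  then show ?thesis
    using rogers_recurrence(2)[OF assms, of \<gamma>] by (simp add: rogers_down_def)
next
  case (Suc k)
  show ?thesis
    unfolding Suc rogers_recurrence(1)[OF assms] by (simp add: rogers_down_def)
qed

text \<open>
  The integral of \<open>C\<^bsub>n+2k\<^esub>(x; \<beta>) C\<^sub>n(x; \<gamma>)\<close> against the weight of parameter \<open>\<gamma>\<close>,
  relative to the total mass. It is the connection coefficient times the squared norm.
\<close>

definition mixed_value :: "complex \<Rightarrow> complex \<Rightarrow> complex \<Rightarrow> nat \<Rightarrow> nat \<Rightarrow> complex" where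
  "mixed_value \<beta> \<gamma> q k n =
     qpoch (\<gamma>\<^sup>2) q n / qpoch q q n * ((\<Prod>j<k. \<gamma> - \<beta> * q ^ j) / qpoch q q k)
       * (qpoch \<beta> q (n + k) / qpoch (q * \<gamma>) q (n + k))"

definition mixed :: "complex \<Rightarrow> complex \<Rightarrow> complex \<Rightarrow> nat \<Rightarrow> nat \<Rightarrow> complex" where
  "mixed \<beta> \<gamma> q m n = (if n \<le> m \<and> even (m - n) then mixed_value \<beta> \<gamma> q ((m - n) div 2) n else 0)"

lemma mixed_eq_value: "mixed \<beta> \<gamma> q (n + 2 * k) n = mixed_value \<beta> \<gamma> q k n"
  by (simp add: mixed_def)

lemma mixed_eq_0:
  assumes "\<And>k. m \<noteq> n + 2 * k"
  shows "mixed \<beta> \<gamma> q m n = 0"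
proof -
  have False if le: "n \<le> m" and ev: "even (m - n)"
  proof -
    obtain k where "m - n = 2 * k"
      using ev by (rule evenE)
    with le have "m = n + 2 * k"
      by simp
    with assms show False
      by blast
  qed
  then show ?thesis
    by (auto simp: mixed_def)
qed

context
  fixes \<beta> \<gamma> q :: complex
  assumes q: "norm q < 1" and \<gamma>: "norm \<gamma> < 1"
begin

lemma one_minus_q_power_nonzero: "1 - q ^ Suc n \<noteq> 0" "1 - \<gamma> * q ^ n \<noteq> 0"
  using one_minus_nonzero[OF norm_mult_power_less_1[OF q q, of n]]
    one_minus_nonzero[OF norm_mult_power_less_1[OF \<gamma> q, of n]] by simp_all

text \<open>
  The value is a product of three factors, each a function of one index and with a
  recurrence of first order.
\<close>

definition "mg n = qpoch (\<gamma>\<^sup>2) q n / qpoch q q n"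
definition "mh k = (\<Prod>j<k. \<gamma> - \<beta> * q ^ j) / qpoch q q k"
definition "ms j = qpoch \<beta> q j / qpoch (q * \<gamma>) q j"

lemma mixed_value_factors: "mixed_value \<beta> \<gamma> q k n = mg n * mh k * ms (n + k)"
  by (simp add: mixed_value_def mg_def mh_def ms_def)

lemma mixed_factor_steps:
  "mg (Suc n) * (1 - q ^ Suc n) = mg n * (1 - \<gamma>\<^sup>2 * q ^ n)"
  "mh (Suc n) * (1 - q ^ Suc n) = mh n * (\<gamma> - \<beta> * q ^ n)"
  "ms (Suc n) * (1 - \<gamma> * q ^ Suc n) = ms n * (1 - \<beta> * q ^ n)"
proof -
  have "qpoch q q k \<noteq> 0" "qpoch (q * \<gamma>) q k \<noteq> 0" for k
    using qpoch_nonzero[OF q q] qpoch_nonzero[OF norm_mult_power_less_1[OF \<gamma> q, of 1] q]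
    by (simp_all add: mult.commute)
  moreover have "1 - q * q ^ n \<noteq> 0" "1 - q * \<gamma> * q ^ n \<noteq> 0"
    using one_minus_q_power_nonzero(1)[of n] one_minus_q_power_nonzero(2)[of "Suc n"]
    by (simp_all add: mult_ac)
  ultimately show "mg (Suc n) * (1 - q ^ Suc n) = mg n * (1 - \<gamma>\<^sup>2 * q ^ n)"
    "mh (Suc n) * (1 - q ^ Suc n) = mh n * (\<gamma> - \<beta> * q ^ n)"
    "ms (Suc n) * (1 - \<gamma> * q ^ Suc n) = ms n * (1 - \<beta> * q ^ n)"
    by (simp_all add: mg_def mh_def ms_def qpoch_Suc mult_ac)
qed

definition "mixed_down_left m n =
  (case m of 0 \<Rightarrow> 0 | Suc k \<Rightarrow> (1 - \<beta>\<^sup>2 * q ^ k) * mixed \<beta> \<gamma> q k n)"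

definition "mixed_down_right m n =
  (case n of 0 \<Rightarrow> 0 | Suc k \<Rightarrow> (1 - \<gamma>\<^sup>2 * q ^ k) * mixed \<beta> \<gamma> q m k)"

text \<open>
  Expanding \<open>2 x C\<^sub>m(x; \<beta>) C\<^sub>n(x; \<gamma>)\<close> with the recurrence of either factor gives a relation
  between the integrals; here it is verified for the claimed values.
\<close>

lemma mixed_recurrence:
  "mixed \<beta> \<gamma> q (Suc m) n * (1 - q ^ Suc m) * (1 - \<gamma> * q ^ n) =
     (1 - \<beta> * q ^ m) * ((1 - q ^ Suc n) * mixed \<beta> \<gamma> q m (Suc n) + mixed_down_right m n)
     - (1 - \<gamma> * q ^ n) * mixed_down_left m n"
proof -
  consider j where "Suc m = n + 2 * Suc j" | "Suc m = n" | "\<And>k. Suc m \<noteq> n + 2 * k"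
    by (metis add.right_neutral mult_0_right not0_implies_Suc)
  then show ?thesis
  proof cases
    case 1
    then have m: "m = Suc (n + 2 * j)" "m = Suc n + 2 * j"
      by auto
    define X J where "X = q ^ n" and "J = q ^ j"
    have pw: "q ^ (n + 2 * j) = X * J\<^sup>2" "q ^ m = q * (X * J\<^sup>2)" "q ^ Suc m = q\<^sup>2 * (X * J\<^sup>2)"
      "q ^ (n + j) = X * J"
      unfolding m(1) X_def J_def by (simp_all add: power_add power_mult power2_eq_square mult_ac power_commutes)
    define g h s where "g = mg n" and "h = mh j" and "s = ms (n + j)"
    have v1: "mixed \<beta> \<gamma> q (Suc m) n = g * mh (Suc j) * ms (Suc (n + j))"
      using 1 by (simp only: mixed_eq_value mixed_value_factors g_def add_Suc_right)
    have v2: "mixed \<beta> \<gamma> q m (Suc n) = mg (Suc n) * h * ms (Suc (n + j))"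
      unfolding m(2) mixed_eq_value mixed_value_factors h_def by simp
    have v3: "mixed_down_left m n = (1 - \<beta>\<^sup>2 * q ^ (n + 2 * j)) * (g * h * s)"
      by (simp only: mixed_down_left_def m(1) nat.case mixed_eq_value mixed_value_factors g_def h_def s_def)
    have v4: "mixed_down_right m n = g * (1 - q ^ n) * mh (Suc j) * s"
    proof (cases n)
      case (Suc i)
      have "mixed \<beta> \<gamma> q m i = mg i * mh (Suc j) * ms (Suc (i + j))"
      proof -
        have "m = i + 2 * Suc j"
          using m(1) Suc by simp
        then show ?thesis
          by (simp only: mixed_eq_value mixed_value_factors add_Suc_right)
      qed
      moreover have "g * (1 - q ^ n) = mg i * (1 - \<gamma>\<^sup>2 * q ^ i)"
        unfolding g_def Suc by (rule mixed_factor_steps)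
      ultimately show ?thesis
        by (simp add: mixed_down_right_def Suc s_def mult_ac)
    qed (simp add: mixed_down_right_def)
    have g': "mg (Suc n) * (1 - q ^ Suc n) = g * (1 - \<gamma>\<^sup>2 * X)"
      unfolding g_def X_def by (rule mixed_factor_steps)
    have nz: "1 - q * J \<noteq> 0" "1 - \<gamma> * (q * (X * J)) \<noteq> 0"
      using one_minus_q_power_nonzero(1)[of j] one_minus_q_power_nonzero(2)[of "Suc (n + j)"]
      by (simp_all add: J_def X_def power_add mult_ac)
    have h': "mh (Suc j) = h * (\<gamma> - \<beta> * J) / (1 - q * J)"
      using mixed_factor_steps(2)[of j] nz by (simp add: h_def J_def eq_divide_eq)
    have s': "ms (Suc (n + j)) = s * (1 - \<beta> * (X * J)) / (1 - \<gamma> * (q * (X * J)))"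
      using mixed_factor_steps(3)[of "n + j"] nz unfolding s_def pw(4)[symmetric] by (simp add: eq_divide_eq)
    define D1 D2 where "D1 = 1 - q * J" and "D2 = 1 - \<gamma> * (q * (X * J))"
    have key: "(\<gamma> - \<beta> * J) * (1 - \<beta> * (X * J)) * (1 - q\<^sup>2 * (X * J\<^sup>2)) * (1 - \<gamma> * X) =
        (1 - \<beta> * (q * (X * J\<^sup>2))) *
          ((1 - \<gamma>\<^sup>2 * X) * (1 - \<beta> * (X * J)) * D1 + (1 - X) * (\<gamma> - \<beta> * J) * D2)
        - (1 - \<gamma> * X) * (1 - \<beta>\<^sup>2 * (X * J\<^sup>2)) * D1 * D2"
      unfolding D1_def D2_def by (simp add: algebra_simps power2_eq_square)
    have D: "D1 \<noteq> 0" "D2 \<noteq> 0"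
      using nz by (simp_all add: D1_def D2_def)
    have "mixed \<beta> \<gamma> q (Suc m) n * (1 - q ^ Suc m) * (1 - \<gamma> * q ^ n) =
        g * h * s * ((\<gamma> - \<beta> * J) * (1 - \<beta> * (X * J)) * (1 - q\<^sup>2 * (X * J\<^sup>2)) * (1 - \<gamma> * X)) / (D1 * D2)"
      unfolding v1 h' s' pw D1_def[symmetric] D2_def[symmetric] X_def[symmetric] using D by (simp add: field_simps)
    also have "\<dots> = g * h * s * (1 - \<beta> * (q * (X * J\<^sup>2))) *
          ((1 - \<gamma>\<^sup>2 * X) * ((1 - \<beta> * (X * J)) / D2) + (1 - X) * ((\<gamma> - \<beta> * J) / D1))
        - g * h * s * (1 - \<gamma> * X) * (1 - \<beta>\<^sup>2 * (X * J\<^sup>2))"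
      unfolding key using D by (simp add: field_simps)
    also have "\<dots> = (1 - \<beta> * (q * (X * J\<^sup>2))) * ((g * (1 - \<gamma>\<^sup>2 * X)) * h * (s * (1 - \<beta> * (X * J)) / D2)
          + g * (1 - X) * (h * (\<gamma> - \<beta> * J) / D1) * s)
        - (1 - \<gamma> * X) * ((1 - \<beta>\<^sup>2 * (X * J\<^sup>2)) * (g * h * s))"
    proof -
      have "g * h * s * e * (u * a + v * b) - g * h * s * w * r = e * ((g * u) * h * (s * a) + g * v * (h * b) * s) - w * (r * (g * h * s))"
        for e u v w a b r
        by (simp add: algebra_simps)
      then show ?thesis
        unfolding times_divide_eq_right[symmetric] .
    qed
    also have "\<dots> = (1 - \<beta> * q ^ m) * ((1 - q ^ Suc n) * mixed \<beta> \<gamma> q m (Suc n) + mixed_down_right m n)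
     - (1 - \<gamma> * q ^ n) * mixed_down_left m n"
      unfolding v2 v3 v4 pw g'[symmetric] h' s' D1_def[symmetric] D2_def[symmetric] X_def[symmetric]
      by (simp only: mult_ac)
    finally show ?thesis .
  next
    case 2
    have 0: "mixed \<beta> \<gamma> q m (Suc n) = 0" "mixed_down_left m n = 0"
      using 2 by (auto simp: mixed_def mixed_down_left_def split: nat.split)
    have "mixed \<beta> \<gamma> q (Suc m) n = mg (Suc m) * ms (Suc m)" "mixed \<beta> \<gamma> q m m = mg m * ms m"
      using mixed_eq_value[of \<beta> \<gamma> q "Suc m" 0] mixed_eq_value[of \<beta> \<gamma> q m 0] 2
      by (simp_all add: mixed_value_factors mh_def)
    moreover have "mg (Suc m) * ms (Suc m) * (1 - q ^ Suc m) * (1 - \<gamma> * q ^ Suc m) =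
        (1 - \<beta> * q ^ m) * ((1 - \<gamma>\<^sup>2 * q ^ m) * (mg m * ms m))"
    proof -
      have "mg (Suc m) * ms (Suc m) * (1 - q ^ Suc m) * (1 - \<gamma> * q ^ Suc m) =
          (mg (Suc m) * (1 - q ^ Suc m)) * (ms (Suc m) * (1 - \<gamma> * q ^ Suc m))"
        by (simp only: mult_ac)
      then show ?thesis
        unfolding mixed_factor_steps by (simp only: mult_ac)
    qed
    ultimately show ?thesis
      using 0 2 by (auto simp: mixed_down_right_def)
  next
    case 3
    have "m \<noteq> Suc n + 2 * k" for k
      using 3[of "Suc k"] by auto
    then have "mixed \<beta> \<gamma> q m (Suc n) = 0"
      by (rule mixed_eq_0)
    moreover have "mixed_down_left m n = 0"
    proof (cases m)
      case (Suc i)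
      have "i \<noteq> n + 2 * k" for k
        using 3[of "Suc k"] Suc by auto
      then have "mixed \<beta> \<gamma> q i n = 0"
        by (rule mixed_eq_0)
      then show ?thesis
        by (simp add: mixed_down_left_def Suc)
    qed (simp add: mixed_down_left_def)
    moreover have "mixed_down_right m n = 0"
    proof (cases n)
      case (Suc i)
      have "m \<noteq> i + 2 * k" for k
        using 3[of k] Suc by auto
      then have "mixed \<beta> \<gamma> q m i = 0"
        by (rule mixed_eq_0)
      then show ?thesis
        by (simp add: mixed_down_right_def Suc)
    qed (simp add: mixed_down_right_def)
    moreover have "mixed \<beta> \<gamma> q (Suc m) n = 0"
      using 3 by (rule mixed_eq_0)
    ultimately show ?thesis
      by simp
  qed
qed

text \<open>
  The recurrence determines everything from the row \<open>m = 0\<close>, where only \<open>C\<^sub>n(x; \<gamma>)\<close> is integrated.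
\<close>

theorem integral_mixed:
  "((\<lambda>\<theta>. rogers m \<beta> q (cis \<theta>) * rogers n \<gamma> q (cis \<theta>) * weight \<gamma> q (cis \<theta>)) has_integral
      2 * of_real pi * moment \<gamma> q 0 * mixed \<beta> \<gamma> q m n) {-pi..pi}"
proof (induction m arbitrary: n rule: less_induct)
  case (less m)
  define c where "c = 2 * of_real pi * moment \<gamma> q 0"
  show ?case
  proof (cases m)
    case 0
    have "mixed \<beta> \<gamma> q 0 n = (if n = 0 then 1 else 0)"
      by (simp add: mixed_def mixed_value_def)
    then show ?thesis
      using integral_rogers[OF q \<gamma>, of n] 0 by (auto split: if_splits)
  next
    case (Suc i)
    define F where "F = (\<lambda>m n \<theta>. rogers m \<beta> q (cis \<theta>) * rogers n \<gamma> q (cis \<theta>) * weight \<gamma> q (cis \<theta>))"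
    have IH: "(F k n has_integral c * mixed \<beta> \<gamma> q k n) {-pi..pi}" if "k \<le> i" for k n
      using less.IH[of k n] that Suc by (simp add: F_def c_def)
    have R: "((\<lambda>\<theta>. rogers i \<beta> q (cis \<theta>) * rogers_down n \<gamma> q (cis \<theta>) * weight \<gamma> q (cis \<theta>))
        has_integral c * mixed_down_right i n) {-pi..pi}"
    proof (cases n)
      case (Suc k)
      then show ?thesis
        using has_integral_mult_right[OF IH[of i k], of "1 - \<gamma>\<^sup>2 * q ^ k"]
        by (simp add: F_def mixed_down_right_def rogers_down_def mult_ac)
    qed (simp add: mixed_down_right_def rogers_down_def)
    have L: "((\<lambda>\<theta>. rogers_down i \<beta> q (cis \<theta>) * rogers n \<gamma> q (cis \<theta>) * weight \<gamma> q (cis \<theta>))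
        has_integral c * mixed_down_left i n) {-pi..pi}"
    proof (cases i)
      case (Suc k)
      then show ?thesis
        using has_integral_mult_right[OF IH[of k n], of "1 - \<beta>\<^sup>2 * q ^ k"]
        by (simp add: F_def mixed_down_left_def rogers_down_def mult_ac)
    qed (simp add: mixed_down_left_def rogers_down_def)
    define d where "d = (1 - q ^ Suc i) * (1 - \<gamma> * q ^ n)"
    have d: "d \<noteq> 0"
      using one_minus_q_power_nonzero by (simp add: d_def del: power_Suc)
    have "((\<lambda>\<theta>. inverse d * ((1 - \<beta> * q ^ i) * ((1 - q ^ Suc n) * F i (Suc n) \<theta> +
            rogers i \<beta> q (cis \<theta>) * rogers_down n \<gamma> q (cis \<theta>) * weight \<gamma> q (cis \<theta>))
          - (1 - \<gamma> * q ^ n) * (rogers_down i \<beta> q (cis \<theta>) * rogers n \<gamma> q (cis \<theta>) * weight \<gamma> q (cis \<theta>))))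
        has_integral inverse d * ((1 - \<beta> * q ^ i) * ((1 - q ^ Suc n) * (c * mixed \<beta> \<gamma> q i (Suc n)) + c * mixed_down_right i n)
          - (1 - \<gamma> * q ^ n) * (c * mixed_down_left i n))) {-pi..pi}"
      by (intro has_integral_mult_right has_integral_diff has_integral_add IH R L) simp
    moreover have "inverse d * ((1 - \<beta> * q ^ i) * ((1 - q ^ Suc n) * (c * mixed \<beta> \<gamma> q i (Suc n)) + c * mixed_down_right i n)
          - (1 - \<gamma> * q ^ n) * (c * mixed_down_left i n)) = c * mixed \<beta> \<gamma> q (Suc i) n"
    proof -
      have "(1 - \<beta> * q ^ i) * ((1 - q ^ Suc n) * (c * mixed \<beta> \<gamma> q i (Suc n)) + c * mixed_down_right i n)
          - (1 - \<gamma> * q ^ n) * (c * mixed_down_left i n) =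
        c * ((1 - \<beta> * q ^ i) * ((1 - q ^ Suc n) * mixed \<beta> \<gamma> q i (Suc n) + mixed_down_right i n)
          - (1 - \<gamma> * q ^ n) * mixed_down_left i n)"
        by (simp only: distrib_left right_diff_distrib mult_ac)
      also have "\<dots> = d * (c * mixed \<beta> \<gamma> q (Suc i) n)"
        unfolding mixed_recurrence[symmetric] d_def by (simp only: mult_ac)
      finally show ?thesis
        using d by simp
    qed
    moreover have "inverse d * ((1 - \<beta> * q ^ i) * ((1 - q ^ Suc n) * F i (Suc n) \<theta> +
            rogers i \<beta> q (cis \<theta>) * rogers_down n \<gamma> q (cis \<theta>) * weight \<gamma> q (cis \<theta>))
          - (1 - \<gamma> * q ^ n) * (rogers_down i \<beta> q (cis \<theta>) * rogers n \<gamma> q (cis \<theta>) * weight \<gamma> q (cis \<theta>))) =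
        F (Suc i) n \<theta>" for \<theta>
    proof -
      define z where "z = cis \<theta>"
      have z: "z \<noteq> 0"
        by (simp add: z_def)
      define A B A' B' C E w where "A = rogers i \<beta> q z" and "B = rogers n \<gamma> q z" and "A' = rogers (Suc i) \<beta> q z"
        and "B' = (1 - q ^ Suc n) * rogers (Suc n) \<gamma> q z" and "C = rogers_down n \<gamma> q z" and "E = rogers_down i \<beta> q z"
        and "w = weight \<gamma> q z"
      have 1: "(z + inverse z) * (1 - \<beta> * q ^ i) * A = (1 - q ^ Suc i) * A' + E"
        unfolding A_def A'_def E_def by (rule rogers_three_term[OF q z])
      have 2: "B' + C = (z + inverse z) * (1 - \<gamma> * q ^ n) * B"
        unfolding B_def B'_def C_def by (rule rogers_three_term[OF q z, symmetric])
      have "(1 - \<beta> * q ^ i) * (A * B' * w + A * C * w) - (1 - \<gamma> * q ^ n) * (E * B * w) =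
          (1 - \<beta> * q ^ i) * A * (B' + C) * w - (1 - \<gamma> * q ^ n) * (E * B * w)"
        by (simp add: algebra_simps)
      also have "\<dots> = ((z + inverse z) * (1 - \<beta> * q ^ i) * A) * ((1 - \<gamma> * q ^ n) * B * w) - (1 - \<gamma> * q ^ n) * (E * B * w)"
        unfolding 2 by (simp only: mult_ac)
      also have "\<dots> = d * (A' * B * w)"
        unfolding 1 d_def by (simp add: algebra_simps)
      finally have "inverse d * ((1 - \<beta> * q ^ i) * (A * B' * w + A * C * w) - (1 - \<gamma> * q ^ n) * (E * B * w)) = A' * B * w"
        using d by simp
      then show ?thesis
        unfolding F_def A_def B_def A'_def B'_def C_def E_def w_def z_def by (simp only: mult_ac)
    qed
    ultimately have "(F (Suc i) n has_integral c * mixed \<beta> \<gamma> q (Suc i) n) {-pi..pi}"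
      by (simp only:)
    then show ?thesis
      by (simp add: F_def c_def Suc)
  qed
qed

end

section \<open>The generating function\<close>

definition gf_denom :: "complex \<Rightarrow> complex \<Rightarrow> nat \<Rightarrow> complex" where
  "gf_denom \<beta> p i = qpoch (p\<^sup>2) (p\<^sup>2) i * qpoch (\<beta> * p) (p\<^sup>2) i"

text \<open>
  The coefficient of \<open>t\<^sup>m\<close> in the product of the two series \<open>\<^sub>2\<phi>\<^sub>1\<close>, with \<open>\<beta> = b\<^sup>2\<close>
  and base \<open>q = p\<^sup>2\<close>, where \<open>p = - q\<^bsup>1/2\<^esup>\<close>. With this sign of the root the two upper
  parameters of either series combine to a single shifted factorial of base \<open>p\<close>.
\<close>

definition gf_coeff :: "nat \<Rightarrow> complex \<Rightarrow> complex \<Rightarrow> complex \<Rightarrow> complex" where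
  "gf_coeff m b p z = (\<Sum>i\<le>m. inverse (gf_denom (b\<^sup>2) p i * gf_denom (b\<^sup>2) p (m - i)) * (z ^ (m - i) * inverse z ^ i *
       qpoch (b * z) p (2 * i) * qpoch (- b * inverse z) p (2 * (m - i))))"

definition gf_scale :: "nat \<Rightarrow> complex \<Rightarrow> complex \<Rightarrow> complex" where
  "gf_scale m b p = qpoch (- b\<^sup>2) p (2 * m) / (qpoch (b ^ 4) (p\<^sup>2) m * qpoch (b\<^sup>2 * p) (p\<^sup>2) m)"

lemma qpoch_Suc_Suc_left: "qpoch a p (2 * Suc n) = (1 - a) * (1 - a * p) * qpoch (a * p * p) p (2 * n)"
  by (simp add: qpoch_Suc_left mult.assoc)

lemma qpoch_Suc_Suc: "qpoch a p (2 * Suc n) = qpoch a p (2 * n) * (1 - a * p ^ (2 * n)) * (1 - a * p ^ (2 * n + 1))"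
  by (simp add: qpoch_Suc)

subsection \<open>The lowering relation\<close>

text \<open>
  Let \<open>D\<^sub>m(z; b)\<close> be the coefficient above, \<open>\<alpha>\<^sub>i\<close> the reciprocal of the denominator, and \<open>\<Psi>\<^bsub>i,j\<^esub>\<close> the
  numerator of the \<open>i\<close>-th term of \<open>D\<^bsub>i+j\<^esub>(z; b p)\<close>. The shifted factorials in \<open>D\<^sub>m(p z; b)\<close> and
  \<open>D\<^sub>m(z / p; b)\<close> are multiples of \<open>\<Psi>\<close>, and
  \<open>p\<^sup>m (D\<^sub>m(p z; b) - D\<^sub>m(z / p; b))\<close> differs from a multiple of \<open>(z - z\<^sup>-\<^sup>1) D\<^bsub>m-1\<^esub>(z; b p)\<close>, term by term, by the
  difference of two consecutive values of \<open>T\<^sub>i = \<alpha>\<^sub>i \<alpha>\<^bsub>m-i\<^esub> \<Psi>\<^bsub>i,m-i\<^esub>\<close>, whose sum cancels against the two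
  end terms. The comparison of the terms with \<open>i + j = m - 1\<close> is the identity below, in which
  \<open>w = z\<^sup>-\<^sup>1\<close>, \<open>v = p\<^sup>-\<^sup>1\<close>, \<open>R = q\<^bsup>i+1\<^esup>\<close> and \<open>Q = q\<^bsup>j+1\<^esup>\<close>.
\<close>

lemma lowering_term:
  fixes z w v b Q R a0 a1 c0 c1 :: complex
  assumes zw: "z * w = 1"
    and a: "a0 = a1 * ((1 - R) * (1 - b\<^sup>2 * (R * v)))" and c: "c0 = c1 * ((1 - Q) * (1 - b\<^sup>2 * (Q * v)))"
    and nz: "1 - b\<^sup>2 * (R * v) \<noteq> 0" "1 - b\<^sup>2 * (Q * v) \<noteq> 0"
  shows "a0 * c1 * (z * (Q * ((1 + b * (v * w)) * (1 + b * w)) - (1 + b * (Q * v * w)) * (1 + b * (Q * w)))) -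
         a1 * c0 * (w * (R * ((1 - b * (v * z)) * (1 - b * z)) - (1 - b * (R * v * z)) * (1 - b * (R * z)))) =
         - (z - w) * (1 - b ^ 4 * (Q * R * v\<^sup>2)) * (a0 / (1 - b\<^sup>2 * (R * v))) * (c0 / (1 - b\<^sup>2 * (Q * v)))"
proof -
  define \<beta> where "\<beta> = b\<^sup>2"
  have b4: "b ^ 4 = \<beta>\<^sup>2"
    by (simp add: \<beta>_def power_mult[symmetric])
  have "z * (Q * ((1 + b * (v * w)) * (1 + b * w)) - (1 + b * (Q * v * w)) * (1 + b * (Q * w))) =
      - (1 - Q) * (z - \<beta> * (Q * v) * w * (z * w))"
    by (simp add: \<beta>_def algebra_simps power2_eq_square)
  then have e1: "z * (Q * ((1 + b * (v * w)) * (1 + b * w)) - (1 + b * (Q * v * w)) * (1 + b * (Q * w))) =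
      - (1 - Q) * (z - \<beta> * (Q * v) * w)"
    unfolding zw by simp
  have "w * (R * ((1 - b * (v * z)) * (1 - b * z)) - (1 - b * (R * v * z)) * (1 - b * (R * z))) =
      - (1 - R) * (w - \<beta> * (R * v) * z * (z * w))"
    by (simp add: \<beta>_def algebra_simps power2_eq_square)
  then have e2: "w * (R * ((1 - b * (v * z)) * (1 - b * z)) - (1 - b * (R * v * z)) * (1 - b * (R * z))) =
      - (1 - R) * (w - \<beta> * (R * v) * z)"
    unfolding zw by simp
  have r: "a0 / (1 - b\<^sup>2 * (R * v)) = a1 * (1 - R)" "c0 / (1 - b\<^sup>2 * (Q * v)) = c1 * (1 - Q)"
    using nz by (simp_all add: a c)
  show ?thesis
    unfolding e1 e2 r b4 unfolding a c \<beta>_def[symmetric] by (simp add: algebra_simps power2_eq_square)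
qed

lemma gf_denom_Suc:
  "p \<noteq> 0 \<Longrightarrow> gf_denom \<beta> p (Suc i) = gf_denom \<beta> p i * ((1 - p ^ (2 * Suc i)) * (1 - \<beta> * (p ^ (2 * Suc i) * inverse p)))"
proof -
  assume p: "p \<noteq> 0"
  have e1: "p ^ (2 * Suc i) = p\<^sup>2 * (p\<^sup>2) ^ i"
    unfolding power_mult by simp
  have e2: "p\<^sup>2 * (p\<^sup>2) ^ i * inverse p = p * (p\<^sup>2) ^ i"
    using p by (simp add: power2_eq_square)
  show ?thesis
    unfolding e1 e2 gf_denom_def qpoch_Suc by (simp only: mult_ac)
qed

lemma gf_coeff_lowering:
  assumes p: "p \<noteq> 0" "norm p < 1" and b: "norm b < 1" and z: "z \<noteq> 0"
  shows "p ^ Suc M * (gf_coeff (Suc M) b p (p * z) - gf_coeff (Suc M) b p (inverse p * z)) =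
    - (z - inverse z) * ((1 - b ^ 4 * p ^ (2 * Suc M)) / (1 - b\<^sup>2 * p)\<^sup>2) * gf_coeff M (b * p) p z"
proof -
  define w v where "w = inverse z" and "v = inverse p"
  have zw: "z * w = 1" and pv: "p * v = 1"
    using z p by (simp_all add: w_def v_def)
  have b2: "norm (b\<^sup>2) < 1"
    using b by (simp add: norm_power power_less_one_iff)
  define al where "al = (\<lambda>i. inverse (gf_denom (b\<^sup>2) p i))"
  define Psi where "Psi = (\<lambda>i j. z ^ j * w ^ i * qpoch (b * p * z) p (2 * i) * qpoch (- (b * p) * w) p (2 * j))"
  define X where "X = (\<lambda>i j. al i * al j * p ^ (2 * j) *
     (z ^ j * w ^ i * qpoch (b * (p * z)) p (2 * i) * qpoch (- b * (v * w)) p (2 * j)))"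
  define Y where "Y = (\<lambda>i j. al i * al j * p ^ (2 * i) *
     (z ^ j * w ^ i * qpoch (b * (v * z)) p (2 * i) * qpoch (- b * (p * w)) p (2 * j)))"
  define T where "T = (\<lambda>i. al i * al (Suc M - i) * Psi i (Suc M - i))"
  define ga where "ga = (\<lambda>i. al i / (1 - b\<^sup>2 * (p ^ (2 * Suc i) * v)))"
  have DX: "p ^ Suc M * gf_coeff (Suc M) b p (p * z) = (\<Sum>i\<le>Suc M. X i (Suc M - i))"
    unfolding gf_coeff_def sum_distrib_left
  proof (rule sum.cong[OF refl])
    fix i assume i: "i \<in> {..Suc M}"
    define j where "j = Suc M - i"
    have M: "Suc M = i + j"
      using i by (simp add: j_def)
    have "p ^ Suc M * ((p * z) ^ j * inverse (p * z) ^ i) = p ^ (2 * j) * (z ^ j * w ^ i) * (p * v) ^ i"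
      unfolding M w_def v_def mult_2 power_add power_mult_distrib inverse_mult_distrib
      by (simp only: mult_ac)
    then have "p ^ Suc M * ((p * z) ^ j * inverse (p * z) ^ i) = p ^ (2 * j) * (z ^ j * w ^ i)"
      unfolding pv by simp
    then have e: "p ^ Suc M * ((p * z) ^ j * inverse (p * z) ^ i) * U = p ^ (2 * j) * (z ^ j * w ^ i) * U" for U
      by simp
    have "inverse (p * z) = v * w"
      by (simp add: v_def w_def)
    then show "p ^ Suc M * (inverse (gf_denom (b\<^sup>2) p i * gf_denom (b\<^sup>2) p (Suc M - i)) * ((p * z) ^ (Suc M - i) * inverse (p * z) ^ i *
       qpoch (b * (p * z)) p (2 * i) * qpoch (- b * inverse (p * z)) p (2 * (Suc M - i)))) = X i (Suc M - i)"
      using e[of "al i * al j * qpoch (b * (p * z)) p (2 * i) * qpoch (- b * (v * w)) p (2 * j)"]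
      unfolding X_def al_def j_def[symmetric] by (simp only: inverse_mult_distrib mult_ac)
  qed
  have DY: "p ^ Suc M * gf_coeff (Suc M) b p (inverse p * z) = (\<Sum>i\<le>Suc M. Y i (Suc M - i))"
    unfolding gf_coeff_def sum_distrib_left
  proof (rule sum.cong[OF refl])
    fix i assume i: "i \<in> {..Suc M}"
    define j where "j = Suc M - i"
    have M: "Suc M = i + j"
      using i by (simp add: j_def)
    have iv: "inverse (inverse p * z) = p * w"
      by (simp add: w_def)
    have "p ^ Suc M * ((v * z) ^ j * (p * w) ^ i) = p ^ (2 * i) * (z ^ j * w ^ i) * (p * v) ^ j"
      unfolding M mult_2 power_add power_mult_distrib by (simp only: mult_ac)
    then have "p ^ Suc M * ((v * z) ^ j * (p * w) ^ i) = p ^ (2 * i) * (z ^ j * w ^ i)"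
      unfolding pv by simp
    then have e: "p ^ Suc M * ((v * z) ^ j * (p * w) ^ i) * U = p ^ (2 * i) * (z ^ j * w ^ i) * U" for U
      by simp
    show "p ^ Suc M * (inverse (gf_denom (b\<^sup>2) p i * gf_denom (b\<^sup>2) p (Suc M - i)) * ((inverse p * z) ^ (Suc M - i) * inverse (inverse p * z) ^ i *
       qpoch (b * (inverse p * z)) p (2 * i) * qpoch (- b * inverse (inverse p * z)) p (2 * (Suc M - i)))) = Y i (Suc M - i)"
      using e[of "al i * al j * qpoch (b * (v * z)) p (2 * i) * qpoch (- b * (p * w)) p (2 * j)"]
      unfolding iv unfolding Y_def al_def j_def[symmetric] v_def[symmetric] by (simp only: inverse_mult_distrib mult_ac)
  qed
  \<comment> \<open>The first term of one sum and the last of the other have no partner in \<open>D\<^bsub>m-1\<^esub>\<close>; they are the end values of \<open>T\<close>.\<close>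
  have ends: "X (Suc M) 0 = T (Suc M)" "Y 0 (Suc M) = T 0"
    by (simp_all add: X_def Y_def T_def Psi_def al_def mult_ac)
  have term_identity: "X i (Suc j) - Y (Suc i) j + (al (Suc i) * al j * Psi (Suc i) j - al i * al (Suc j) * Psi i (Suc j)) =
      - (z - w) * (1 - b ^ 4 * p ^ (2 * Suc M)) * (ga i * ga j * Psi i j)" if ij: "i + j = M" for i j
  proof -
    define Q R where "Q = p ^ (2 * Suc j)" and "R = p ^ (2 * Suc i)"
    have X: "X i (Suc j) = al i * al (Suc j) * (z * (Q * ((1 + b * (v * w)) * (1 + b * w)))) * Psi i j"
    proof -
      have "qpoch (- b * (v * w)) p (2 * Suc j) = (1 + b * (v * w)) * (1 + b * w) * qpoch (- (b * p) * w) p (2 * j)"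
      proof -
        have "- b * (v * w) * p = - (b * w) * (p * v)"
          by simp
        then have a1: "- b * (v * w) * p = - (b * w)"
          unfolding pv by simp
        have a2: "- (b * w) * p = - (b * p) * w"
          by simp
        show ?thesis
          unfolding qpoch_Suc_Suc_left a1 unfolding a2 by simp
      qed
      then show ?thesis
        unfolding X_def Psi_def Q_def by (simp only: power_Suc mult_ac)
    qed
    have Y: "Y (Suc i) j = al (Suc i) * al j * (w * (R * ((1 - b * (v * z)) * (1 - b * z)))) * Psi i j"
    proof -
      have "qpoch (b * (v * z)) p (2 * Suc i) = (1 - b * (v * z)) * (1 - b * z) * qpoch (b * p * z) p (2 * i)"
      proof -
        have "b * (v * z) * p = b * z * (p * v)"
          by simp
        then have a1: "b * (v * z) * p = b * z"
          unfolding pv by simp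
        have a2: "b * z * p = b * p * z"
          by simp
        show ?thesis
          unfolding qpoch_Suc_Suc_left a1 unfolding a2 by simp
      qed
      moreover have "- b * (p * w) = - (b * p) * w"
        by simp
      ultimately show ?thesis
        unfolding Y_def Psi_def R_def by (simp only: power_Suc mult_ac)
    qed
    have Qv: "Q * v = p ^ (2 * j + 1)" "Q = p ^ (2 * j + 1) * p" "R * v = p ^ (2 * i + 1)" "R = p ^ (2 * i + 1) * p"
      using p by (simp_all add: Q_def R_def v_def mult_ac)
    have P1: "Psi (Suc i) j = w * ((1 - b * (R * v * z)) * (1 - b * (R * z))) * Psi i j"
    proof -
      have "qpoch (b * p * z) p (2 * Suc i) = qpoch (b * p * z) p (2 * i) * ((1 - b * (R * v * z)) * (1 - b * (R * z)))"
        unfolding qpoch_Suc_Suc Qv(3) unfolding Qv(4) by (simp add: mult_ac)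
      then show ?thesis
        unfolding Psi_def by (simp only: power_Suc mult_ac)
    qed
    have P2: "Psi i (Suc j) = z * ((1 + b * (Q * v * w)) * (1 + b * (Q * w))) * Psi i j"
    proof -
      have "qpoch (- (b * p) * w) p (2 * Suc j) = qpoch (- (b * p) * w) p (2 * j) * ((1 + b * (Q * v * w)) * (1 + b * (Q * w)))"
        unfolding qpoch_Suc_Suc Qv(1) unfolding Qv(2) by (simp add: mult_ac)
      then show ?thesis
        unfolding Psi_def by (simp only: power_Suc mult_ac)
    qed
    have nz: "1 - b\<^sup>2 * (R * v) \<noteq> 0" "1 - b\<^sup>2 * (Q * v) \<noteq> 0"
      unfolding Qv(1) Qv(3) using one_minus_nonzero[OF norm_mult_power_less_1[OF b2 p(2)]] by blast+
    have nz': "1 - R \<noteq> 0" "1 - Q \<noteq> 0"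
      unfolding Q_def R_def using one_minus_nonzero[OF norm_mult_power_less_1[OF p(2) p(2)], of "2 * i + 1"]
        one_minus_nonzero[OF norm_mult_power_less_1[OF p(2) p(2)], of "2 * j + 1"] by simp_all
    have cancel: "inverse d = inverse (d * (x * y)) * (x * y)" if "x \<noteq> 0" "y \<noteq> 0" for d x y :: complex
      using that by (simp add: field_simps)
    have a: "al i = al (Suc i) * ((1 - R) * (1 - b\<^sup>2 * (R * v)))" "al j = al (Suc j) * ((1 - Q) * (1 - b\<^sup>2 * (Q * v)))"
      unfolding al_def gf_denom_Suc[OF p(1)] R_def[symmetric] Q_def[symmetric] v_def[symmetric]
      by (rule cancel[OF nz'(1) nz(1)], rule cancel[OF nz'(2) nz(2)])
    have QR: "Q * R * v\<^sup>2 = p ^ (2 * Suc M)"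
    proof -
      have "Q * R * v\<^sup>2 = (Q * v) * (R * v)"
        by (simp add: power2_eq_square)
      also have "\<dots> = p ^ (2 * Suc M)"
        unfolding Qv(1,3) power_add[symmetric] ij[symmetric] by (simp add: add.commute)
      finally show ?thesis .
    qed
    have "X i (Suc j) - Y (Suc i) j + (al (Suc i) * al j * Psi (Suc i) j - al i * al (Suc j) * Psi i (Suc j)) =
      (al i * al (Suc j) * (z * (Q * ((1 + b * (v * w)) * (1 + b * w)) - (1 + b * (Q * v * w)) * (1 + b * (Q * w)))) -
         al (Suc i) * al j * (w * (R * ((1 - b * (v * z)) * (1 - b * z)) - (1 - b * (R * v * z)) * (1 - b * (R * z))))) * Psi i j"
      unfolding X Y P1 P2 by (simp only: right_diff_distrib left_diff_distrib mult_ac) simp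
    also have "\<dots> = - (z - w) * (1 - b ^ 4 * (Q * R * v\<^sup>2)) * (al i / (1 - b\<^sup>2 * (R * v))) * (al j / (1 - b\<^sup>2 * (Q * v))) * Psi i j"
      unfolding lowering_term[OF zw a nz] ..
    finally show ?thesis
      unfolding QR ga_def R_def[symmetric] Q_def[symmetric] by (simp only: mult_ac)
  qed
  have ga: "ga i = inverse (gf_denom ((b * p)\<^sup>2) p i) / (1 - b\<^sup>2 * p)" for i
  proof -
    have f1: "p ^ (2 * Suc i) * v = p * (p\<^sup>2) ^ i"
      unfolding power_mult using p by (simp add: v_def power2_eq_square)
    have f2: "(b * p)\<^sup>2 * p = b\<^sup>2 * p * p\<^sup>2"
      by (simp add: power_mult_distrib mult_ac)
    have k: "qpoch (b\<^sup>2 * p) (p\<^sup>2) i * (1 - b\<^sup>2 * (p ^ (2 * Suc i) * v)) = (1 - b\<^sup>2 * p) * qpoch ((b * p)\<^sup>2 * p) (p\<^sup>2) i"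
      unfolding f1 f2 using qpoch_Suc[of "b\<^sup>2 * p" "p\<^sup>2" i] qpoch_Suc_left[of "b\<^sup>2 * p" "p\<^sup>2" i]
      by (simp add: mult.assoc)
    have "ga i = inverse (qpoch (p\<^sup>2) (p\<^sup>2) i * (qpoch (b\<^sup>2 * p) (p\<^sup>2) i * (1 - b\<^sup>2 * (p ^ (2 * Suc i) * v))))"
      by (simp only: ga_def al_def gf_denom_def divide_inverse inverse_mult_distrib mult_ac)
    also have "\<dots> = inverse (1 - b\<^sup>2 * p) * inverse (gf_denom ((b * p)\<^sup>2) p i)"
      unfolding k gf_denom_def by (simp only: inverse_mult_distrib mult_ac)
    finally show ?thesis
      by (simp add: divide_inverse mult_ac)
  qed
  have low: "(\<Sum>i\<le>M. ga i * ga (M - i) * Psi i (M - i)) = gf_coeff M (b * p) p z / (1 - b\<^sup>2 * p)\<^sup>2"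
    unfolding gf_coeff_def sum_divide_distrib
    by (rule sum.cong[OF refl]) (simp add: ga Psi_def w_def divide_inverse power2_eq_square mult_ac)
  have "p ^ Suc M * (gf_coeff (Suc M) b p (p * z) - gf_coeff (Suc M) b p (inverse p * z)) =
      (\<Sum>i\<le>Suc M. X i (Suc M - i)) - (\<Sum>i\<le>Suc M. Y i (Suc M - i))"
    unfolding right_diff_distrib DX DY ..
  also have "(\<Sum>i\<le>Suc M. X i (Suc M - i)) = (\<Sum>i\<le>M. X i (Suc (M - i))) + T (Suc M)"
    by (simp add: Suc_diff_le ends[symmetric])
  also have "(\<Sum>i\<le>Suc M. Y i (Suc M - i)) = T 0 + (\<Sum>i\<le>M. Y (Suc i) (M - i))"
    by (subst sum.atMost_Suc_shift) (simp add: ends)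
  also have "(\<Sum>i\<le>M. X i (Suc (M - i))) + T (Suc M) - (T 0 + (\<Sum>i\<le>M. Y (Suc i) (M - i))) =
      (\<Sum>i\<le>M. X i (Suc (M - i)) - Y (Suc i) (M - i) + (T (Suc i) - T i))"
    using sum_lessThan_telescope[of T "Suc M"]
    by (simp add: sum.distrib sum_subtractf lessThan_Suc_atMost)
  also have "\<dots> = (\<Sum>i\<le>M. - (z - w) * (1 - b ^ 4 * p ^ (2 * Suc M)) * (ga i * ga (M - i) * Psi i (M - i)))"
  proof (rule sum.cong[OF refl])
    fix i assume "i \<in> {..M}"
    then have i: "i + (M - i) = M" and S: "Suc M - i = Suc (M - i)"
      by auto
    show "X i (Suc (M - i)) - Y (Suc i) (M - i) + (T (Suc i) - T i) =
        - (z - w) * (1 - b ^ 4 * p ^ (2 * Suc M)) * (ga i * ga (M - i) * Psi i (M - i))"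
      using term_identity[OF i] unfolding T_def S diff_Suc_Suc .
  qed
  also have "\<dots> = - (z - w) * (1 - b ^ 4 * p ^ (2 * Suc M)) * (gf_coeff M (b * p) p z / (1 - b\<^sup>2 * p)\<^sup>2)"
    unfolding sum_distrib_left[symmetric] low ..
  finally show ?thesis
    unfolding w_def by (simp only: times_divide_eq_right times_divide_eq_left mult_ac)
qed

lemma rcoef_shift:
  "(1 - \<beta>) * rcoef (\<beta> * q) q k = rcoef \<beta> q k * (1 - \<beta> * q ^ k)"
  using qpoch_Suc[of \<beta> q k] qpoch_Suc_left[of \<beta> q k] by (simp add: rcoef_def)

text \<open>
  For the power series \<open>C(t) = \<Sum>\<^sub>k (\<beta>; q)\<^sub>k t\<^sup>k / (q; q)\<^sub>k\<close> one has \<open>(1 - t) C(t) = (1 - \<beta> t) C(q t)\<close>, and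
  \<open>C(t) / (1 - \<beta> t)\<close> is the series of parameter \<open>\<beta> q\<close>. The difference
  \<open>C(q t z) C(t / z) - C(t z) C(q t / z)\<close> is then a multiple of \<open>t (z - z\<^sup>-\<^sup>1)\<close> times the product of the latter
  series.
\<close>

lemma rogers_lowering:
  assumes p: "p \<noteq> 0" "norm p < 1" and \<beta>: "norm \<beta> < 1" and z: "z \<noteq> 0"
  shows "p ^ Suc M * (rogers (Suc M) \<beta> (p\<^sup>2) (p * z) - rogers (Suc M) \<beta> (p\<^sup>2) (inverse p * z)) =
    - (1 - \<beta>) * (z - inverse z) * rogers M (\<beta> * p\<^sup>2) (p\<^sup>2) z"
proof -
  define q where "q = p\<^sup>2"
  have q: "norm q < 1"
    using p by (simp add: q_def norm_power power_less_one_iff)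
  define P where "P = (\<lambda>w::complex. Abs_fps (\<lambda>k. rcoef \<beta> q k * w ^ k))"
  define Q where "Q = (\<lambda>w::complex. Abs_fps (\<lambda>k. q ^ k * (rcoef \<beta> q k * w ^ k)))"
  define S where "S = (\<lambda>w::complex. Abs_fps (\<lambda>k. rcoef (\<beta> * q) q k * w ^ k))"
  define w where "w = inverse z"
  have \<beta>1: "1 - \<beta> \<noteq> 0"
    using one_minus_nonzero[OF \<beta>] .
  have step: "(1 - fps_const w * fps_X) * P w = (1 - fps_const (\<beta> * w) * fps_X) * Q w" for w
    unfolding P_def Q_def by (rule rcoef_fps_step[OF q])
  have S: "fps_const (1 - \<beta>) * S w = P w - fps_const \<beta> * Q w" for w
    by (rule fps_ext) (simp add: S_def P_def Q_def rcoef_shift mult.assoc[symmetric], simp add: algebra_simps)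
  have lin: "(1 - fps_const (\<beta> * w) * fps_X) * S w = P w" for w
  proof -
    have "fps_const (1 - \<beta>) * ((1 - fps_const (\<beta> * w) * fps_X) * S w) =
        (1 - fps_const (\<beta> * w) * fps_X) * P w - fps_const \<beta> * ((1 - fps_const (\<beta> * w) * fps_X) * Q w)"
      using S[of w] by (simp only: mult.left_commute[of "fps_const (1 - \<beta>)"] right_diff_distrib mult.left_commute[of "fps_const \<beta>"])
    also have "\<dots> = (1 - fps_const (\<beta> * w) * fps_X) * P w - fps_const \<beta> * ((1 - fps_const w * fps_X) * P w)"
      unfolding step ..
    also have "\<dots> = fps_const (1 - \<beta>) * P w"
      by (simp add: algebra_simps flip: fps_const_mult fps_const_sub)
    finally show ?thesis
      using \<beta>1 by simp
  qed
  define A B where "A = 1 - fps_const (\<beta> * z) * fps_X" and "B = 1 - fps_const (\<beta> * w) * fps_X"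
  have nz: "A \<noteq> 0" "B \<noteq> 0"
    by (auto simp: A_def B_def fps_eq_iff intro!: exI[of _ 0])
  have "(A * B) * (P w * Q z - Q w * P z) = (B * P w) * (A * Q z) - (B * Q w) * (A * P z)"
    by (simp add: algebra_simps)
  also have "\<dots> = (B * P w) * ((1 - fps_const z * fps_X) * P z) - ((1 - fps_const w * fps_X) * P w) * (A * P z)"
    unfolding A_def B_def step ..
  also have "\<dots> = (B * (1 - fps_const z * fps_X) - (1 - fps_const w * fps_X) * A) * (P w * P z)"
    by (simp add: algebra_simps)
  also have "B * (1 - fps_const z * fps_X) - (1 - fps_const w * fps_X) * A = - (fps_const ((1 - \<beta>) * (z - w)) * fps_X)"
    unfolding A_def B_def by (simp add: algebra_simps flip: fps_const_mult fps_const_sub)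
  also have "P w * P z = (B * S w) * (A * S z)"
    unfolding A_def B_def lin ..
  finally have "(A * B) * (P w * Q z - Q w * P z) = (A * B) * - (fps_const ((1 - \<beta>) * (z - w)) * fps_X * (S w * S z))"
    by (simp add: algebra_simps)
  then have main: "P w * Q z - Q w * P z = - (fps_const ((1 - \<beta>) * (z - w)) * fps_X * (S w * S z))"
    using nz by (simp only: mult_cancel_left mult_eq_0_iff simp_thms)
  have pv: "p * inverse p = 1"
    using p by simp
  have 1: "fps_nth (P w * Q z) m = p ^ m * rogers m \<beta> q (p * z)" for m
    unfolding fps_mult_nth rogers_def sum_distrib_left atLeast0AtMost
  proof (rule sum.cong[OF refl])
    fix i assume "i \<in> {..m}"
    then obtain j where m: "m = i + j"
      by (auto simp: le_iff_add)
    have "p ^ m * ((p * z) ^ j * inverse (p * z) ^ i) = q ^ j * (z ^ j * w ^ i) * (p * inverse p) ^ i"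
      unfolding m q_def w_def by (simp add: power_add power_mult_distrib power2_eq_square mult_ac)
    then show "fps_nth (P w) i * fps_nth (Q z) (m - i) =
        p ^ m * (rcoef \<beta> q i * rcoef \<beta> q (m - i) * ((p * z) ^ (m - i) * inverse (p * z) ^ i))"
      unfolding pv P_def Q_def m by (simp add: mult_ac)
  qed
  have 2: "fps_nth (Q w * P z) m = p ^ m * rogers m \<beta> q (inverse p * z)" for m
    unfolding fps_mult_nth rogers_def sum_distrib_left atLeast0AtMost
  proof (rule sum.cong[OF refl])
    fix i assume "i \<in> {..m}"
    then obtain j where m: "m = i + j"
      by (auto simp: le_iff_add)
    have "p ^ m * ((inverse p * z) ^ j * inverse (inverse p * z) ^ i) = q ^ i * (z ^ j * w ^ i) * (p * inverse p) ^ j"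
      unfolding m q_def w_def by (simp add: power_add power_mult_distrib power2_eq_square mult_ac)
    then show "fps_nth (Q w) i * fps_nth (P z) (m - i) =
        p ^ m * (rcoef \<beta> q i * rcoef \<beta> q (m - i) * ((inverse p * z) ^ (m - i) * inverse (inverse p * z) ^ i))"
      unfolding pv P_def Q_def m by (simp add: mult_ac)
  qed
  have 3: "fps_nth (S w * S z) m = rogers m (\<beta> * q) q z" for m
    unfolding S_def w_def rogers_fps[symmetric] by simp
  have "fps_nth (P w * Q z - Q w * P z) (Suc M) = - ((1 - \<beta>) * (z - w) * fps_nth (S w * S z) M)"
    unfolding main by (simp add: mult.assoc)
  from this[unfolded fps_sub_nth 1 2 3] show ?thesis
    unfolding q_def w_def by (simp add: algebra_simps)
qed

subsection \<open>The evaluation at one point, and uniqueness\<close>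

text \<open>
  At \<open>z = b\<^sup>-\<^sup>1\<close> the factors \<open>(b z; p)\<^bsub>2i\<^esub>\<close> with \<open>i \<ge> 1\<close> vanish, so that the generating function
  coefficient has a single term, and the Rogers polynomial is a product as well: its recurrence is
  then solved by a sequence of first order.
\<close>

lemma rogers_at_inverse_root:
  assumes q: "norm q < 1" and b: "b \<noteq> 0"
  shows "rogers m (b\<^sup>2) q (inverse b) = inverse b ^ m * rcoef (b ^ 4) q m"
proof (induction m rule: less_induct)
  case (less m)
  define u where "u = (\<lambda>m. inverse b ^ m * rcoef (b ^ 4) q m)"
  have nz: "1 - q ^ Suc n \<noteq> 0" for n
    using one_minus_nonzero[OF norm_mult_power_less_1[OF q q, of n]] by simp
  have b4: "b ^ 4 = b\<^sup>2 * b\<^sup>2"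
    by (simp add: power_add[symmetric])
  have us: "(1 - q ^ Suc n) * u (Suc n) = inverse b * (1 - b ^ 4 * q ^ n) * u n" for n
    using rcoef_Suc[OF q, of "b ^ 4" n] by (simp add: u_def mult_ac)
  have z: "inverse b \<noteq> 0"
    using b by simp
  consider "m = 0" | "m = 1" | n where "m = Suc (Suc n)"
    by (metis One_nat_def not0_implies_Suc)
  then show ?case
  proof cases
    case 2
    have "(1 - q) * rogers 1 (b\<^sup>2) q (inverse b) = (inverse b + b) * (1 - b\<^sup>2)"
      using rogers_recurrence(2)[OF q z, of "b\<^sup>2"] by simp
    also have "\<dots> = (1 - q) * u 1"
      using us[of 0] b unfolding b4 by (simp add: u_def field_simps power2_eq_square)
    finally show ?thesis
      using nz[of 0] 2 by (simp add: u_def)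
  next
    case (3 n)
    have b1: "b * (1 - q ^ Suc n) * u (Suc n) = (1 - b ^ 4 * q ^ n) * u n"
      using us[of n] b by (simp add: mult.assoc)
    have "(1 - q ^ Suc (Suc n)) * rogers m (b\<^sup>2) q (inverse b) =
        (inverse b + b) * (1 - b\<^sup>2 * q ^ Suc n) * u (Suc n) - (1 - b ^ 4 * q ^ n) * u n"
      using rogers_recurrence(1)[OF q z, of "b\<^sup>2" n] less[of n] less[of "Suc n"] 3
      by (simp add: u_def power_mult[symmetric])
    also have "\<dots> = ((inverse b + b) * (1 - b\<^sup>2 * q ^ Suc n) - b * (1 - q ^ Suc n)) * u (Suc n)"
      unfolding b1[symmetric] by (simp only: left_diff_distrib)
    also have "(inverse b + b) * (1 - b\<^sup>2 * q ^ Suc n) - b * (1 - q ^ Suc n) = inverse b * (1 - b ^ 4 * q ^ Suc n)"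
      unfolding b4 using b by (simp add: field_simps power2_eq_square)
    also have "inverse b * (1 - b ^ 4 * q ^ Suc n) * u (Suc n) = (1 - q ^ Suc (Suc n)) * u m"
      unfolding 3 us ..
    finally show ?thesis
      using nz[of "Suc n"] by (simp add: u_def del: power_Suc)
  qed simp
qed

lemma gf_coeff_at_inverse_root:
  assumes b: "b \<noteq> 0"
  shows "gf_coeff m b p (inverse b) = inverse b ^ m * qpoch (- b\<^sup>2) p (2 * m) / gf_denom (b\<^sup>2) p m"
proof -
  have "gf_coeff m b p (inverse b) = (\<Sum>i\<in>{0}. inverse (gf_denom (b\<^sup>2) p i * gf_denom (b\<^sup>2) p (m - i)) *
      (inverse b ^ (m - i) * inverse (inverse b) ^ i *
       qpoch (b * inverse b) p (2 * i) * qpoch (- b * inverse (inverse b)) p (2 * (m - i))))"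
    unfolding gf_coeff_def
  proof (rule sum.mono_neutral_right)
    show "\<forall>i\<in>{..m} - {0}. inverse (gf_denom (b\<^sup>2) p i * gf_denom (b\<^sup>2) p (m - i)) *
      (inverse b ^ (m - i) * inverse (inverse b) ^ i *
       qpoch (b * inverse b) p (2 * i) * qpoch (- b * inverse (inverse b)) p (2 * (m - i))) = 0"
    proof
      fix i assume "i \<in> {..m} - {0}"
      then obtain k where "i = Suc k"
        by (cases i) auto
      then have "qpoch (b * inverse b) p (2 * i) = 0"
        using b by (simp add: qpoch_Suc_left)
      then show "inverse (gf_denom (b\<^sup>2) p i * gf_denom (b\<^sup>2) p (m - i)) *
      (inverse b ^ (m - i) * inverse (inverse b) ^ i *
       qpoch (b * inverse b) p (2 * i) * qpoch (- b * inverse (inverse b)) p (2 * (m - i))) = 0"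
        by simp
    qed
  qed auto
  then show ?thesis
    by (simp add: gf_denom_def divide_inverse power2_eq_square mult_ac)
qed

text \<open>
  Multiplied by \<open>z\<^sup>m\<close>, both sides of the generating function identity are polynomials. A function of
  this kind that is invariant under \<open>z \<mapsto> q z\<close> takes each of its values infinitely often.
\<close>

lemma gf_coeff_poly: "\<exists>F. \<forall>z. z \<noteq> 0 \<longrightarrow> poly F z = z ^ m * gf_coeff m b p z"
proof -
  define c where "c = (\<lambda>i. inverse (gf_denom (b\<^sup>2) p i * gf_denom (b\<^sup>2) p (m - i)))"
  have "poly (\<Sum>i\<le>m. smult (c i)
      ((\<Prod>l<2 * i. [:1, - b * p ^ l:]) * (\<Prod>l<2 * (m - i). [:b * p ^ l, 1:]))) z = z ^ m * gf_coeff m b p z"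
    if z: "z \<noteq> 0" for z
    unfolding gf_coeff_def poly_sum sum_distrib_left
  proof (rule sum.cong[OF refl])
    fix i assume "i \<in> {..m}"
    then obtain j where m: "m = i + j"
      by (auto simp: le_iff_add)
    then have mi: "m - i = j"
      by simp
    have "(\<Prod>l<2 * j. b * p ^ l + z) = (\<Prod>l<2 * j. z * (1 - - b * inverse z * p ^ l))"
      using z by (intro prod.cong) (simp_all add: field_simps)
    also have "\<dots> = z ^ (2 * j) * qpoch (- b * inverse z) p (2 * j)"
      by (simp add: prod.distrib qpoch_def)
    finally have e: "(\<Prod>l<2 * j. b * p ^ l + z) = z ^ (2 * j) * qpoch (- b * inverse z) p (2 * j)" .
    have "z ^ m * (z ^ j * inverse z ^ i) = z ^ (2 * j) * (z * inverse z) ^ i"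
      unfolding m mult_2 power_add power_mult_distrib by (simp only: mult_ac)
    then have e2: "z ^ m * (z ^ j * inverse z ^ i) = z ^ (2 * j)"
      using z by simp
    have "poly (smult (c i) ((\<Prod>l<2 * i. [:1, - b * p ^ l:]) * (\<Prod>l<2 * j. [:b * p ^ l, 1:]))) z =
        c i * (qpoch (b * z) p (2 * i) * (\<Prod>l<2 * j. b * p ^ l + z))"
      by (simp add: poly_prod qpoch_def mult_ac)
    also have "\<dots> = z ^ m * (z ^ j * inverse z ^ i) * (c i * qpoch (b * z) p (2 * i) * qpoch (- b * inverse z) p (2 * j))"
      unfolding e e2 by (simp only: mult_ac)
    finally show "poly (smult (c i) ((\<Prod>l<2 * i. [:1, - b * p ^ l:]) * (\<Prod>l<2 * (m - i). [:b * p ^ l, 1:]))) z =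
        z ^ m * (inverse (gf_denom (b\<^sup>2) p i * gf_denom (b\<^sup>2) p (m - i)) *
          (z ^ (m - i) * inverse z ^ i * qpoch (b * z) p (2 * i) * qpoch (- b * inverse z) p (2 * (m - i))))"
      using mi by (simp add: c_def mult_ac)
  qed
  then show ?thesis
    by blast
qed

lemma rogers_poly: "\<exists>F. \<forall>z. z \<noteq> 0 \<longrightarrow> poly F z = z ^ m * rogers m \<beta> q z"
proof (intro exI allI impI)
  fix z :: complex assume z: "z \<noteq> 0"
  show "poly (\<Sum>k\<le>m. monom (rcoef \<beta> q k * rcoef \<beta> q (m - k)) (2 * (m - k))) z = z ^ m * rogers m \<beta> q z"
    unfolding rogers_def poly_sum sum_distrib_left
  proof (rule sum.cong[OF refl])
    fix i assume "i \<in> {..m}"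
    then obtain j where m: "m = i + j"
      by (auto simp: le_iff_add)
    have "z ^ m * (z ^ j * inverse z ^ i) = z ^ (2 * j) * (z * inverse z) ^ i"
      unfolding m mult_2 power_add power_mult_distrib by (simp only: mult_ac)
    then have "z ^ m * (z ^ j * inverse z ^ i) = z ^ (2 * j)"
      using z by simp
    then show "poly (monom (rcoef \<beta> q i * rcoef \<beta> q (m - i)) (2 * (m - i))) z =
        z ^ m * (rcoef \<beta> q i * rcoef \<beta> q (m - i) * (z ^ (m - i) * inverse z ^ i))"
      unfolding m poly_monom by (simp add: mult_ac)
  qed
qed

lemma laurent_unique:
  fixes f :: "complex \<Rightarrow> complex"
  assumes q: "q \<noteq> 0" "norm q < 1" and F: "\<And>z. z \<noteq> 0 \<Longrightarrow> poly F z = z ^ m * f z"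
    and inv: "\<And>z. z \<noteq> 0 \<Longrightarrow> f (q * z) = f z" and a: "a \<noteq> 0" "f a = 0" and z: "z \<noteq> 0"
  shows "f z = 0"
proof -
  have "f (q ^ k * a) = 0" for k
  proof (induction k)
    case (Suc k)
    have "q ^ k * a \<noteq> 0"
      using q a by simp
    from inv[OF this] Suc show ?case
      by (simp add: mult.assoc)
  qed (use a in simp)
  then have "range (\<lambda>k. q ^ k * a) \<subseteq> {z. poly F z = 0}"
    using F q a by auto
  moreover have "inj (\<lambda>k. q ^ k * a)"
  proof (rule injI)
    fix i j assume "q ^ i * a = q ^ j * a"
    then have "norm q ^ i = norm q ^ j"
      using a by (metis mult_right_cancel norm_power)
    then show "i = j"
      using q by (simp add: power_inject_exp')
  qed
  then have "infinite (range (\<lambda>k. q ^ k * a))"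
    by (rule range_inj_infinite)
  ultimately have "F = 0"
    using poly_roots_finite finite_subset by blast
  then show ?thesis
    using F[OF z] z by simp
qed

lemma gf_scale_lowering:
  assumes p: "norm p < 1" and b: "norm b < 1"
  shows "gf_scale (Suc M) b p * (1 - b\<^sup>2) = (1 - b ^ 4 * p ^ (2 * Suc M)) / (1 - b\<^sup>2 * p)\<^sup>2 * gf_scale M (b * p) p"
proof -
  define \<beta> q N K L where "\<beta> = b\<^sup>2" and "q = p\<^sup>2" and "N = qpoch (- (\<beta> * q)) p (2 * M)"
    and "K = qpoch (\<beta>\<^sup>2 * q * q) q M" and "L = qpoch (\<beta> * p * q) q M"
  have q: "norm q < 1" and \<beta>: "norm \<beta> < 1" and \<beta>2: "norm (\<beta>\<^sup>2) < 1" and \<beta>p: "norm (\<beta> * p) < 1"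
    using p b norm_mult_power_less_1[of \<beta> p 1]
    by (auto simp: q_def \<beta>_def norm_power power_less_one_iff)
  have b4: "b ^ 4 = \<beta>\<^sup>2"
    by (simp add: \<beta>_def power_mult[symmetric])
  have nz: "1 - \<beta>\<^sup>2 \<noteq> 0" "1 - \<beta>\<^sup>2 * q \<noteq> 0" "1 - \<beta> * p \<noteq> 0" "1 - \<beta>\<^sup>2 * q ^ Suc M \<noteq> 0"
      "1 + \<beta> * p \<noteq> 0" "1 - \<beta> \<noteq> 0" "1 + \<beta> \<noteq> 0"
    using one_minus_nonzero[OF \<beta>2] one_minus_nonzero[OF norm_mult_power_less_1[OF \<beta>2 q, of 1]]
      one_minus_nonzero[OF \<beta>p] one_minus_nonzero[OF norm_mult_power_less_1[OF \<beta>2 q, of "Suc M"]]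
      one_minus_nonzero[of "- (\<beta> * p)"] \<beta>p one_minus_nonzero[OF \<beta>] one_minus_nonzero[of "- \<beta>"] \<beta> by simp_all
  have KL: "K \<noteq> 0" "L \<noteq> 0"
    unfolding K_def L_def
    using qpoch_nonzero[OF norm_mult_power_less_1[OF \<beta>2 q, of 2] q] qpoch_nonzero[OF norm_mult_power_less_1[OF \<beta>p q, of 1] q]
    by (simp_all add: power2_eq_square mult_ac)
  have e1: "qpoch (- \<beta>) p (2 * Suc M) = (1 + \<beta>) * (1 + \<beta> * p) * N"
    unfolding qpoch_Suc_Suc_left N_def q_def by (simp add: power2_eq_square mult_ac)
  have "qpoch (\<beta>\<^sup>2) q (Suc M) * (1 - \<beta>\<^sup>2 * q ^ Suc M) = (1 - \<beta>\<^sup>2) * (1 - \<beta>\<^sup>2 * q) * K"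
    unfolding qpoch_Suc[symmetric] K_def by (simp add: qpoch_Suc_left mult_ac)
  then have e2': "qpoch (\<beta>\<^sup>2) q (Suc M) = (1 - \<beta>\<^sup>2) * (1 - \<beta>\<^sup>2 * q) * K / (1 - \<beta>\<^sup>2 * q ^ Suc M)"
    using nz by (simp add: eq_divide_eq)
  have e3: "qpoch (\<beta> * p) q (Suc M) = (1 - \<beta> * p) * L"
    by (simp add: qpoch_Suc_left L_def)
  have pq: "p ^ (2 * Suc M) = q ^ Suc M"
    unfolding q_def power_mult ..
  have f: "1 - \<beta>\<^sup>2 = (1 - \<beta>) * (1 + \<beta>)" "1 - \<beta>\<^sup>2 * q = (1 - \<beta> * p) * (1 + \<beta> * p)"
    unfolding q_def by (simp_all add: algebra_simps power2_eq_square)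
  have s: "gf_scale M (b * p) p = N / (K * L)"
  proof -
    have "(b * p) ^ 4 = \<beta>\<^sup>2 * q * q" "(b * p)\<^sup>2 = \<beta> * q"
      unfolding \<beta>_def q_def by (simp_all add: power_mult_distrib power_mult[symmetric] power_add[symmetric] mult.assoc)
    then show ?thesis
      unfolding gf_scale_def N_def K_def L_def q_def[symmetric] by (simp add: mult_ac)
  qed
  have "gf_scale (Suc M) b p * (1 - b\<^sup>2) =
      (1 + \<beta>) * (1 + \<beta> * p) * N * (1 - \<beta>) * (1 - \<beta>\<^sup>2 * q ^ Suc M) /
        (((1 - \<beta>) * (1 + \<beta>)) * ((1 - \<beta> * p) * (1 + \<beta> * p)) * K * ((1 - \<beta> * p) * L))"
    unfolding gf_scale_def b4 q_def[symmetric] \<beta>_def[symmetric] e1 e2' e3 unfolding f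
    using nz KL by (simp add: field_simps del: power_Suc)
  also have "\<dots> = (1 - \<beta>\<^sup>2 * q ^ Suc M) / (1 - \<beta> * p)\<^sup>2 * (N / (K * L))"
    using nz KL by (simp add: divide_simps power2_eq_square del: power_Suc)
  finally show ?thesis
    unfolding s b4 pq \<beta>_def[symmetric] .
qed

text \<open>
  The induction runs over all \<open>b\<close> at once, since lowering the index replaces \<open>b\<close> by \<open>b p\<close>.
\<close>

theorem gf_coeff_eq_rogers:
  assumes p: "p \<noteq> 0" "norm p < 1" and b: "b \<noteq> 0" "norm b < 1" and z: "z \<noteq> 0"
  shows "gf_coeff m b p z = gf_scale m b p * rogers m (b\<^sup>2) (p\<^sup>2) z"
  using b z
proof (induction m arbitrary: b z)
  case 0
  then show ?case
    by (simp add: gf_coeff_def gf_scale_def gf_denom_def)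
next
  case (Suc M)
  note b = Suc.prems(1,2)
  have q: "norm (p\<^sup>2) < 1" "p\<^sup>2 \<noteq> 0" and b2: "norm (b\<^sup>2) < 1"
    using p b by (simp_all add: norm_power power_less_one_iff)
  have bp: "b * p \<noteq> 0" "norm (b * p) < 1"
    using p b norm_mult_power_less_1[OF b(2) p(2), of 1] by simp_all
  define f where "f = (\<lambda>z. gf_coeff (Suc M) b p z - gf_scale (Suc M) b p * rogers (Suc M) (b\<^sup>2) (p\<^sup>2) z)"
  have shift: "f (p * z) = f (inverse p * z)" if z: "z \<noteq> 0" for z
  proof -
    have "p ^ Suc M * (f (p * z) - f (inverse p * z)) =
        p ^ Suc M * (gf_coeff (Suc M) b p (p * z) - gf_coeff (Suc M) b p (inverse p * z))
        - gf_scale (Suc M) b p *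
          (p ^ Suc M * (rogers (Suc M) (b\<^sup>2) (p\<^sup>2) (p * z) - rogers (Suc M) (b\<^sup>2) (p\<^sup>2) (inverse p * z)))"
      unfolding f_def by (simp add: algebra_simps)
    also have "\<dots> = - (z - inverse z) * ((1 - b ^ 4 * p ^ (2 * Suc M)) / (1 - b\<^sup>2 * p)\<^sup>2 * gf_scale M (b * p) p)
          * rogers M ((b * p)\<^sup>2) (p\<^sup>2) z
        - gf_scale (Suc M) b p * (- (1 - b\<^sup>2) * (z - inverse z) * rogers M (b\<^sup>2 * p\<^sup>2) (p\<^sup>2) z)"
      unfolding gf_coeff_lowering[OF p b(2) z] rogers_lowering[OF p b2 z] Suc.IH[OF bp z] by (simp only: mult.assoc)
    also have "\<dots> = 0"
      unfolding gf_scale_lowering[OF p(2) b(2), symmetric] power_mult_distrib[of b p 2] by (simp add: algebra_simps)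
    finally show ?thesis
      using p by simp
  qed
  have inv: "f (p\<^sup>2 * z) = f z" if "z \<noteq> 0" for z
    using shift[of "p * z"] that p by (simp add: power2_eq_square mult.assoc[symmetric])
  obtain F G where F: "\<And>z. z \<noteq> 0 \<Longrightarrow> poly F z = z ^ Suc M * gf_coeff (Suc M) b p z"
    and G: "\<And>z. z \<noteq> 0 \<Longrightarrow> poly G z = z ^ Suc M * rogers (Suc M) (b\<^sup>2) (p\<^sup>2) z"
    using gf_coeff_poly rogers_poly by metis
  have "poly (F - smult (gf_scale (Suc M) b p) G) z = z ^ Suc M * f z" if "z \<noteq> 0" for z
    using F[OF that] G[OF that] by (simp add: f_def algebra_simps)
  note FG = this
  have f0: "f (inverse b) = 0"
  proof -
    have "norm (b ^ 4) < 1"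
      using b by (simp add: norm_power power_less_one_iff)
    then have "qpoch (b ^ 4) (p\<^sup>2) (Suc M) \<noteq> 0"
      using q(1) by (rule qpoch_nonzero)
    then show ?thesis
      unfolding f_def gf_coeff_at_inverse_root[OF b(1)] rogers_at_inverse_root[OF q(1) b(1)]
      by (simp add: gf_scale_def gf_denom_def rcoef_def divide_inverse mult_ac)
  qed
  have ib: "inverse b \<noteq> 0"
    using b by simp
  have "f z = 0"
    by (rule laurent_unique[OF q(2,1) FG inv ib f0 Suc.prems(3)])
  then show ?case
    by (simp add: f_def)
qed

section \<open>Integration over the circle and over the interval\<close>

lemma has_integral_even_half:
  fixes h :: "real \<Rightarrow> complex"
  assumes cont: "continuous_on {-a..a} h" and even: "\<And>x. h (- x) = h x" and a: "0 \<le> a"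
    and int: "(h has_integral 2 * J) {-a..a}"
  shows "(h has_integral J) {0..a}"
proof -
  have "h integrable_on {0..a}"
    by (rule integrable_continuous_interval, rule continuous_on_subset[OF cont]) (use a in auto)
  then obtain K where K: "(h has_integral K) {0..a}"
    by blast
  have "((\<lambda>x. h (- x)) has_integral K) {-a..-0}"
    using K by (rule has_integral_reflect_lemma_real)
  then have "(h has_integral K) {-a..0}"
    by (simp add: even)
  then have "(h has_integral K + K) {-a..a}"
    using has_integral_combine[of "-a" 0 a h K K] a K by simp
  then have "K = J"
    using has_integral_unique[OF int] by fastforce
  with K show ?thesis
    by simp
qed

text \<open>
  The integrand is unbounded at the end points. The substitution \<open>x = cos \<theta>\<close> is carried
  out on an antiderivative, which is continuous there.
\<close>

lemma has_integral_arccos: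
  fixes h :: "real \<Rightarrow> complex"
  assumes cont: "continuous_on {0..pi} h" and int: "(h has_integral I) {0..pi}"
  shows "((\<lambda>x. h (arccos x) * of_real (1 / sqrt (1 - x\<^sup>2))) has_integral I) {-1..1}"
proof -
  define H where "H = (\<lambda>u. integral {0..u} h)"
  have Hc: "continuous_on {0..pi} H"
    unfolding H_def by (rule indefinite_integral_continuous_1) (use int in blast)
  have "((\<lambda>x. h (arccos x) * of_real (1 / sqrt (1 - x\<^sup>2))) has_integral
      - H (arccos 1) - - H (arccos (-1))) {-1..1}"
  proof (rule fundamental_theorem_of_calculus_interior)
    have "continuous_on {-1..1} (\<lambda>x. H (arccos x))"
      by (rule continuous_on_compose2[OF Hc continuous_on_arccos']) (auto intro: arccos_lbound arccos_ubound)
    then show "continuous_on {-1..1} (\<lambda>x. - H (arccos x))"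
      by (rule continuous_on_minus)
    fix x :: real assume x: "x \<in> {-1<..<1}"
    have u: "arccos x \<in> {0<..<pi}"
      using arccos_lt_bounded[of x] x by auto
    have "(H has_vector_derivative h (arccos x)) (at (arccos x) within {0..pi})"
      unfolding H_def using integral_has_vector_derivative[OF cont] u by auto
    then have d: "(H has_vector_derivative h (arccos x)) (at (arccos x))"
      using at_within_interior[of "arccos x" "{0..pi}"] u by (simp add: interior_atLeastAtMost_real)
    have "(arccos has_vector_derivative inverse (- sqrt (1 - x\<^sup>2))) (at x)"
      using DERIV_arccos[of x] x by (simp add: has_real_derivative_iff_has_vector_derivative)
    from vector_diff_chain_at[OF this d]
    have "((\<lambda>x. - H (arccos x)) has_vector_derivative - (inverse (- sqrt (1 - x\<^sup>2)) *\<^sub>R h (arccos x))) (at x)"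
      unfolding o_def by (rule has_vector_derivative_minus)
    then show "((\<lambda>x. - H (arccos x)) has_vector_derivative h (arccos x) * of_real (1 / sqrt (1 - x\<^sup>2))) (at x)"
      by (simp add: scaleR_conv_of_real divide_inverse mult.commute)
  qed simp
  moreover have "H 0 = 0" "H pi = I"
    using int by (simp_all add: H_def integral_unique)
  ultimately show ?thesis
    by simp
qed

lemma weight_eq_rogers_w:
  fixes \<gamma> q :: real
  assumes q: "\<bar>q\<bar> < 1" and \<gamma>: "\<bar>\<gamma>\<bar> < 1"
  shows "weight (of_real \<gamma>) (of_real q) (cis (arccos x)) = of_real (rogers_w x (of_real \<gamma>) (of_real q))"
proof -
  define y where "y = (cis (arccos x))\<^sup>2"
  have y: "norm y \<le> 1"
    by (simp add: y_def norm_power)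
  have ye: "exp (2 * \<i> * of_real (arccos x)) = y"
    unfolding y_def cis_conv_exp exp_double[symmetric] by (simp add: mult_ac)
  have n: "norm (complex_of_real q) < 1" "norm (complex_of_real \<gamma>) < 1"
    using q \<gamma> by simp_all
  have cq: "cnj (qbin (of_real \<gamma>) (of_real q) k) = qbin (of_real \<gamma>) (of_real q) k" for k
    by (simp add: qbin_def qpoch_def)
  have "cnj (qbin_sum (of_real \<gamma>) (of_real q) y) = qbin_sum (of_real \<gamma>) (of_real q) (cnj y)"
    unfolding qbin_sum_def
    by (subst bounded_linear.suminf[OF bounded_linear_cnj summable_qbin_power[OF n y]]) (simp add: cq)
  moreover have "cnj y = (inverse (cis (arccos x)))\<^sup>2"
    by (simp add: y_def cis_cnj)
  ultimately have "weight (of_real \<gamma>) (of_real q) (cis (arccos x)) =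
      qbin_sum (of_real \<gamma>) (of_real q) y * cnj (qbin_sum (of_real \<gamma>) (of_real q) y)"
    by (simp add: weight_def y_def)
  also have "\<dots> = of_real ((cmod (qbin_sum (of_real \<gamma>) (of_real q) y))\<^sup>2)"
    by (rule complex_norm_square[symmetric])
  finally show ?thesis
    unfolding rogers_w_def Let_def ye q_binomial[OF n y] .
qed

lemma basic_hyp_2_1:
  "basic_hyp [a, b] [c] q z = (\<Sum>k. qpoch a q k * qpoch b q k / (qpoch q q k * qpoch c q k) * z ^ k)"
  by (simp add: basic_hyp_def qpochs_def)

text \<open>
  All coefficients are bounded, because numerators and denominators converge and the limits of
  the latter are not zero. This gives absolute convergence for every \<open>t\<close> in the open unit disc.
\<close>

lemma gf_term_bounded:
  assumes p: "norm p < 1" and \<beta>: "norm \<beta> < 1"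
  obtains K where "K > 0" "\<And>k. norm (qpoch a p (2 * k) / gf_denom \<beta> p k) \<le> K"
proof -
  have q: "norm (p\<^sup>2) < 1" and \<beta>p: "norm (\<beta> * p) < 1"
    using p norm_mult_power_less_1[OF \<beta> p, of 1] by (simp_all add: norm_power power_less_one_iff)
  obtain K1 where K1: "K1 > 0" "\<And>n. norm (qpoch a p n) \<le> K1"
    using qpoch_bounded[OF p] by blast
  obtain K2 where K2: "K2 > 0" "\<And>n. norm (inverse (qpoch (p\<^sup>2) (p\<^sup>2) n)) \<le> K2"
    using inverse_qpoch_bounded[OF q q] by blast
  obtain K3 where K3: "K3 > 0" "\<And>n. norm (inverse (qpoch (\<beta> * p) (p\<^sup>2) n)) \<le> K3"
    using inverse_qpoch_bounded[OF \<beta>p q] by blast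
  have "norm (qpoch a p (2 * k) / gf_denom \<beta> p k) \<le> K1 * (K2 * K3)" for k
  proof -
    have "norm (qpoch a p (2 * k)) * (norm (inverse (qpoch (p\<^sup>2) (p\<^sup>2) k)) * norm (inverse (qpoch (\<beta> * p) (p\<^sup>2) k)))
        \<le> K1 * (K2 * K3)"
      using K1 K2 K3 by (intro mult_mono) (auto simp: less_imp_le)
    then show ?thesis
      by (simp only: gf_denom_def divide_inverse inverse_mult_distrib norm_mult)
  qed
  then show ?thesis
    using K1 K2 K3 by (intro that[of "K1 * (K2 * K3)"]) auto
qed

text \<open>The product of the two series is the generating function, for arguments on the unit circle.\<close>

lemma gf_sums:
  assumes p: "norm p < 1" and b: "norm b < 1" and z: "norm z = 1" and t: "norm t < 1"
  shows "(\<lambda>m. t ^ m * gf_coeff m b p z) sums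
    (basic_hyp [b * z, b * z * p] [b\<^sup>2 * p] (p\<^sup>2) (t * inverse z) *
     basic_hyp [- b * inverse z, - b * inverse z * p] [b\<^sup>2 * p] (p\<^sup>2) (t * z))"
proof -
  have b2: "norm (b\<^sup>2) < 1"
    using b by (simp add: norm_power power_less_one_iff)
  define X where "X = (\<lambda>a u k. qpoch a p (2 * k) / gf_denom (b\<^sup>2) p k * (t * u) ^ k)"
  have hyp: "basic_hyp [a, a * p] [b\<^sup>2 * p] (p\<^sup>2) (t * u) = (\<Sum>k. X a u k)" for a u
    by (simp add: basic_hyp_2_1 X_def qpoch_double gf_denom_def)
  have summ: "summable (\<lambda>k. norm (X a u k))" if u: "norm u = 1" for a u
  proof -
    obtain K where K: "K > 0" "\<And>k. norm (qpoch a p (2 * k) / gf_denom (b\<^sup>2) p k) \<le> K"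
      using gf_term_bounded[OF p b2, of a] by blast
    have "norm (X a u k) = norm (qpoch a p (2 * k) / gf_denom (b\<^sup>2) p k) * norm t ^ k" for k
      unfolding X_def norm_mult norm_power u by simp
    then have "norm (norm (X a u k)) \<le> K * norm t ^ k" for k
      using mult_right_mono[OF K(2)[of k], of "norm t ^ k"] by simp
    moreover have "summable (\<lambda>k. K * norm t ^ k)"
      using t by (intro summable_mult summable_geometric) simp
    ultimately show ?thesis
      by (rule summable_comparison_test'[where N = 0, rotated])
  qed
  have "(\<lambda>m. \<Sum>i\<le>m. X (b * z) (inverse z) i * X (- b * inverse z) z (m - i)) sums
      ((\<Sum>k. X (b * z) (inverse z) k) * (\<Sum>k. X (- b * inverse z) z k))"
    using z by (intro Cauchy_product_sums summ) (simp_all add: norm_inverse)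
  moreover have "(\<Sum>i\<le>m. X (b * z) (inverse z) i * X (- b * inverse z) z (m - i)) = t ^ m * gf_coeff m b p z" for m
    unfolding gf_coeff_def sum_distrib_left
  proof (rule sum.cong[OF refl])
    fix i assume "i \<in> {..m}"
    then have tm: "t ^ m = t ^ i * t ^ (m - i)"
      by (simp add: power_add[symmetric])
    show "X (b * z) (inverse z) i * X (- b * inverse z) z (m - i) =
        t ^ m * (inverse (gf_denom (b\<^sup>2) p i * gf_denom (b\<^sup>2) p (m - i)) *
          (z ^ (m - i) * inverse z ^ i * qpoch (b * z) p (2 * i) * qpoch (- b * inverse z) p (2 * (m - i))))"
      unfolding X_def tm power_mult_distrib divide_inverse inverse_mult_distrib by (simp only: mult_ac)
  qed
  ultimately show ?thesis
    by (simp only: hyp)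
qed

lemma gf_scale_bounded:
  assumes p: "norm p < 1" and b: "norm b < 1"
  obtains K where "K > 0" "\<And>m. norm (gf_scale m b p) \<le> K"
proof -
  have q: "norm (p\<^sup>2) < 1" and b2: "norm (b\<^sup>2) < 1" and b4: "norm (b ^ 4) < 1"
    using p b by (simp_all add: norm_power power_less_one_iff)
  have b2p: "norm (b\<^sup>2 * p) < 1"
    using norm_mult_power_less_1[OF b2 p, of 1] by simp
  obtain K1 where K1: "K1 > 0" "\<And>n. norm (qpoch (- b\<^sup>2) p n) \<le> K1"
    using qpoch_bounded[OF p] by blast
  obtain K2 where K2: "K2 > 0" "\<And>n. norm (inverse (qpoch (b ^ 4) (p\<^sup>2) n)) \<le> K2"
    using inverse_qpoch_bounded[OF b4 q] by blast
  obtain K3 where K3: "K3 > 0" "\<And>n. norm (inverse (qpoch (b\<^sup>2 * p) (p\<^sup>2) n)) \<le> K3"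
    using inverse_qpoch_bounded[OF b2p q] by blast
  have "norm (gf_scale m b p) \<le> K1 * (K2 * K3)" for m
  proof -
    have "norm (qpoch (- b\<^sup>2) p (2 * m)) * (norm (inverse (qpoch (b ^ 4) (p\<^sup>2) m)) * norm (inverse (qpoch (b\<^sup>2 * p) (p\<^sup>2) m)))
        \<le> K1 * (K2 * K3)"
      using K1 K2 K3 by (intro mult_mono) (auto simp: less_imp_le)
    then show ?thesis
      by (simp only: gf_scale_def divide_inverse inverse_mult_distrib norm_mult)
  qed
  then show ?thesis
    using K1 K2 K3 by (intro that[of "K1 * (K2 * K3)"]) auto
qed

lemma rogers_bounded:
  assumes q: "norm q < 1"
  obtains K where "K > 0" "\<And>m z. norm z = 1 \<Longrightarrow> norm (rogers m \<beta> q z) \<le> K * real (Suc m)"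
proof -
  obtain K1 where K1: "K1 > 0" "\<And>n. norm (qpoch \<beta> q n) \<le> K1"
    using qpoch_bounded[OF q] by blast
  obtain K2 where K2: "K2 > 0" "\<And>n. norm (inverse (qpoch q q n)) \<le> K2"
    using inverse_qpoch_bounded[OF q q] by blast
  have r: "norm (rcoef \<beta> q k) \<le> K1 * K2" for k
    unfolding rcoef_def divide_inverse norm_mult using K1 K2 by (intro mult_mono) (auto simp: less_imp_le)
  have "norm (rogers m \<beta> q z) \<le> (K1 * K2) * (K1 * K2) * real (Suc m)" if z: "norm z = 1" for m z
  proof -
    have "norm (rogers m \<beta> q z) \<le> (\<Sum>k\<le>m. (K1 * K2) * (K1 * K2))"
      unfolding rogers_def
    proof (rule sum_norm_le)
      fix k
      show "norm (rcoef \<beta> q k * rcoef \<beta> q (m - k) * (z ^ (m - k) * inverse z ^ k)) \<le> (K1 * K2) * (K1 * K2)"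
        using mult_mono[OF r[of k] r[of "m - k"]] K1 K2 z by (simp add: norm_mult norm_power norm_inverse)
    qed
    then show ?thesis
      by (simp add: algebra_simps)
  qed
  then show ?thesis
    using K1 K2 by (intro that[of "(K1 * K2) * (K1 * K2)"]) auto
qed

lemma continuous_on_rogers_cis: "continuous_on A (\<lambda>\<theta>. rogers n \<gamma> q (cis \<theta>))"
  unfolding rogers_def by (intro continuous_intros continuous_on_cis) auto

lemma weight_inverse: "weight \<gamma> q (inverse z) = weight \<gamma> q z"
  by (simp add: weight_def)

text \<open>
  The generating function is integrated term by term over the circle, which covers the interval
  twice. Only the indices \<open>n + 2 k\<close> contribute.
\<close>

theorem gf_integral:
  fixes b p q \<gamma> t :: complex and n :: nat
  assumes q: "norm q < 1" and p: "p \<noteq> 0" "p\<^sup>2 = q" and b: "b \<noteq> 0" "norm b < 1"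
    and \<gamma>: "norm \<gamma> < 1" and t: "norm t < 1"
  defines "I \<equiv> \<lambda>k. of_real pi * moment \<gamma> q 0 * (t ^ (n + 2 * k) * gf_scale (n + 2 * k) b p * mixed_value (b\<^sup>2) \<gamma> q k n)"
  shows "summable I"
    and "((\<lambda>x. basic_hyp [b * cis (arccos x), b * cis (arccos x) * p] [b\<^sup>2 * p] q (t * inverse (cis (arccos x))) *
            basic_hyp [- b * inverse (cis (arccos x)), - b * inverse (cis (arccos x)) * p] [b\<^sup>2 * p] q (t * cis (arccos x)) *
            rogers n \<gamma> q (cis (arccos x)) * weight \<gamma> q (cis (arccos x)) * of_real (1 / sqrt (1 - x\<^sup>2)))
          has_integral suminf I) {-1..1}"
proof -
  have p1: "norm p < 1"
    using q unfolding p(2)[symmetric] by (simp add: norm_power power_less_one_iff)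
  define f where "f = (\<lambda>m \<theta>. t ^ m * gf_scale m b p *
     (rogers m (b\<^sup>2) q (cis \<theta>) * rogers n \<gamma> q (cis \<theta>) * weight \<gamma> q (cis \<theta>)))"
  define J where "J = (\<lambda>m. t ^ m * gf_scale m b p * (2 * of_real pi * moment \<gamma> q 0 * mixed (b\<^sup>2) \<gamma> q m n))"
  have int: "(f m has_integral J m) {-pi..pi}" for m
    unfolding f_def J_def by (intro has_integral_mult_right integral_mixed q \<gamma>)
  have w: "continuous_on {-pi..pi} (\<lambda>\<theta>. weight \<gamma> q (cis \<theta>))"
    by (rule weight_moments(2)[OF q \<gamma>])
  have cont: "continuous_on {-pi..pi} (f m)" for m
    unfolding f_def by (intro continuous_intros continuous_on_rogers_cis w)
  obtain K1 where K1: "K1 > 0" "\<And>m. norm (gf_scale m b p) \<le> K1"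
    using gf_scale_bounded[OF p1 b(2)] by blast
  obtain K2 where K2: "K2 > 0" "\<And>m z. norm z = 1 \<Longrightarrow> norm (rogers m (b\<^sup>2) q z) \<le> K2 * real (Suc m)"
    using rogers_bounded[OF q] by blast
  have "bounded ((\<lambda>\<theta>. rogers n \<gamma> q (cis \<theta>) * weight \<gamma> q (cis \<theta>)) ` {-pi..pi})"
    by (intro compact_imp_bounded compact_continuous_image continuous_intros continuous_on_rogers_cis w) auto
  then obtain K3 where K3: "K3 > 0" "\<And>\<theta>. \<theta> \<in> {-pi..pi} \<Longrightarrow> norm (rogers n \<gamma> q (cis \<theta>) * weight \<gamma> q (cis \<theta>)) \<le> K3"
    unfolding bounded_pos by blast
  define M where "M = (\<lambda>m. K1 * K2 * K3 * (real (Suc m) * norm t ^ m))"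
  have M: "summable M"
    unfolding M_def using geometric_deriv_sums[of "norm t"] t
    by (intro summable_mult) (auto simp: sums_iff)
  have bound: "norm (f m \<theta>) \<le> M m" if "\<theta> \<in> {-pi..pi}" for m \<theta>
  proof -
    have "norm t ^ m * norm (gf_scale m b p) * (norm (rogers m (b\<^sup>2) q (cis \<theta>)) * norm (rogers n \<gamma> q (cis \<theta>) * weight \<gamma> q (cis \<theta>)))
        \<le> norm t ^ m * K1 * ((K2 * real (Suc m)) * K3)"
      using K1 K2 K3 that by (intro mult_mono) (auto simp: less_imp_le intro!: mult_nonneg_nonneg)
    then show ?thesis
      unfolding f_def M_def by (simp add: norm_mult norm_power mult_ac)
  qed
  note S = has_integral_suminf[OF cont bound M int]
  have scale: "J (n + 2 * k) = 2 * I k" for k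
    unfolding J_def I_def mixed_eq_value by (simp only: mult_ac)
  have "(\<lambda>k. J (n + 2 * k)) sums (\<Sum>m. J m)"
  proof (subst sums_mono_reindex)
    show "strict_mono (\<lambda>k. n + 2 * k)"
      by (simp add: strict_mono_def)
    fix m assume "m \<notin> range (\<lambda>k. n + 2 * k)"
    then have "mixed (b\<^sup>2) \<gamma> q m n = 0"
      by (intro mixed_eq_0) auto
    then show "J m = 0"
      by (simp add: J_def)
  qed (use S(3) in \<open>rule summable_sums\<close>)
  then have IJ: "(\<lambda>k. 2 * I k) sums (\<Sum>m. J m)"
    by (simp only: scale)
  from sums_mult[OF this, of "1/2"] show sI: "summable I"
    by (simp add: sums_iff)
  have J: "(\<Sum>m. J m) = 2 * suminf I"
    using IJ sI by (simp add: sums_iff suminf_mult)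
  define h where "h = (\<lambda>\<theta>. \<Sum>m. f m \<theta>)"
  have "h (- \<theta>) = h \<theta>" for \<theta>
    unfolding h_def f_def cis_inverse[symmetric] rogers_inverse weight_inverse ..
  then have half: "(h has_integral suminf I) {0..pi}"
    using has_integral_even_half[of pi h "suminf I"] S(1,2) unfolding J h_def by simp
  have hc: "continuous_on {0..pi} h"
    unfolding h_def by (rule continuous_on_subset[OF S(2)]) (use pi_gt_zero in auto)
  have h: "h \<theta> = basic_hyp [b * cis \<theta>, b * cis \<theta> * p] [b\<^sup>2 * p] q (t * inverse (cis \<theta>)) *
     basic_hyp [- b * inverse (cis \<theta>), - b * inverse (cis \<theta>) * p] [b\<^sup>2 * p] q (t * cis \<theta>) *
     rogers n \<gamma> q (cis \<theta>) * weight \<gamma> q (cis \<theta>)" for \<theta>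
  proof -
    define c where "c = rogers n \<gamma> q (cis \<theta>) * weight \<gamma> q (cis \<theta>)"
    have "cis \<theta> \<noteq> 0"
      by simp
    from gf_coeff_eq_rogers[OF p(1) p1 b this] have "f m \<theta> = t ^ m * gf_coeff m b p (cis \<theta>) * c" for m
      unfolding f_def c_def p(2) by (simp only: mult_ac)
    then show ?thesis
      using sums_mult2[OF gf_sums[OF p1 b(2) norm_cis t], of \<theta> c]
      unfolding h_def c_def p(2) by (simp only: sums_iff mult.assoc)
  qed
  show "((\<lambda>x. basic_hyp [b * cis (arccos x), b * cis (arccos x) * p] [b\<^sup>2 * p] q (t * inverse (cis (arccos x))) *
            basic_hyp [- b * inverse (cis (arccos x)), - b * inverse (cis (arccos x)) * p] [b\<^sup>2 * p] q (t * cis (arccos x)) *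
            rogers n \<gamma> q (cis (arccos x)) * weight \<gamma> q (cis (arccos x)) * of_real (1 / sqrt (1 - x\<^sup>2)))
          has_integral suminf I) {-1..1}"
    using has_integral_arccos[OF hc half] unfolding h .
qed

section \<open>Identification of the series\<close>

text \<open>
  A factorial of length \<open>n + 2 k\<close> leaves, after its first \<open>n\<close> factors, two of base \<open>q\<^sup>2\<close>
  and length \<open>k\<close>. Each of these is a pair \<open>(\<plusminus>c; q)\<^sub>k\<close>, which is how the square roots enter the
  parameters of \<open>\<Phi>\<^sub>n\<close>.
\<close>

lemma qpoch_add_double:
  "qpoch a q (n + 2 * k) = qpoch a q n * (qpoch (a * q ^ n) (q\<^sup>2) k * qpoch (a * q ^ (n + 1)) (q\<^sup>2) k)"
  unfolding qpoch_add qpoch_double by (simp add: mult_ac)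

lemma mixed_series_term:
  fixes B G Q b r p4 t :: complex
  assumes b: "b\<^sup>2 = B" and r: "r\<^sup>2 = Q" and p4: "p4\<^sup>2 = r" and G: "G \<noteq> 0"
  shows "t ^ (n + 2 * k) * gf_scale (n + 2 * k) b (- r) * mixed_value B G Q k n =
    t ^ n * qpochs ([G\<^sup>2] @ pm B @ [B * r]) Q n / qpochs [B\<^sup>2, - B * r, Q * G, Q] Q n *
    (qpochs ([B * inverse G, B * Q ^ n]
            @ pm (\<i> * (b * r ^ n)) @ pm (\<i> * (b * r ^ (n + 1)))
            @ pm (b * p4 ^ (2 * n + 1)) @ pm (b * p4 ^ (2 * n + 3))) Q k /
     qpochs (Q # ([G * Q ^ (n + 1)]
            @ pm (B * r ^ n) @ pm (B * r ^ (n + 1))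
            @ pm (\<i> * (b * p4 ^ (2 * n + 1))) @ pm (\<i> * (b * p4 ^ (2 * n + 3))))) Q k * (G * t\<^sup>2) ^ k)"
proof -
  have rr: "(r ^ m)\<^sup>2 = Q ^ m" for m
    unfolding r[symmetric] by (simp add: power_mult[symmetric] mult.commute)
  have pp: "(p4 ^ (2 * m + 1))\<^sup>2 = r * Q ^ m" for m
  proof -
    have "(p4 ^ (2 * m + 1))\<^sup>2 = (p4\<^sup>2) ^ (2 * m + 1)"
      by (simp only: power_mult[symmetric] mult.commute)
    then show ?thesis
      unfolding p4 by (simp add: power_mult r)
  qed
  have sq: "(\<i> * (b * r ^ n))\<^sup>2 = - B * Q ^ n" "(\<i> * (b * r ^ (n + 1)))\<^sup>2 = - B * Q ^ (n + 1)"
    "(b * p4 ^ (2 * n + 1))\<^sup>2 = B * r * Q ^ n" "(b * p4 ^ (2 * n + 3))\<^sup>2 = B * r * Q ^ (n + 1)"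
    "(B * r ^ n)\<^sup>2 = B\<^sup>2 * Q ^ n" "(B * r ^ (n + 1))\<^sup>2 = B\<^sup>2 * Q ^ (n + 1)"
    "(\<i> * (b * p4 ^ (2 * n + 1)))\<^sup>2 = - B * r * Q ^ n" "(\<i> * (b * p4 ^ (2 * n + 3)))\<^sup>2 = - B * r * Q ^ (n + 1)"
    using pp[of n] pp[of "Suc n"] unfolding power_mult_distrib rr b by (simp_all add: numeral_3_eq_3)
  have pms: "qpochs (pm x @ xs) Q k = qpoch (x\<^sup>2) (Q\<^sup>2) k * qpochs xs Q k" for x xs
    by (simp add: qpochs_def pm_def qpoch_pm[symmetric] mult.assoc)
  have pms0: "qpochs (pm x) Q k = qpoch (x\<^sup>2) (Q\<^sup>2) k" for x
    by (simp add: qpochs_def pm_def qpoch_pm[symmetric])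
  have cons: "qpochs (x # xs) Q m = qpoch x Q m * qpochs xs Q m" for x xs m
    by (simp add: qpochs_def)
  have num: "qpochs ([B * inverse G, B * Q ^ n]
            @ pm (\<i> * (b * r ^ n)) @ pm (\<i> * (b * r ^ (n + 1)))
            @ pm (b * p4 ^ (2 * n + 1)) @ pm (b * p4 ^ (2 * n + 3))) Q k =
      qpoch (B * inverse G) Q k * (qpoch (B * Q ^ n) Q k * (qpoch (- B * Q ^ n) (Q\<^sup>2) k * (qpoch (- B * Q ^ (n + 1)) (Q\<^sup>2) k *
        (qpoch (B * r * Q ^ n) (Q\<^sup>2) k * qpoch (B * r * Q ^ (n + 1)) (Q\<^sup>2) k))))"
    unfolding append_Cons append_Nil cons pms pms0 sq ..
  have den: "qpochs (Q # ([G * Q ^ (n + 1)]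
            @ pm (B * r ^ n) @ pm (B * r ^ (n + 1))
            @ pm (\<i> * (b * p4 ^ (2 * n + 1))) @ pm (\<i> * (b * p4 ^ (2 * n + 3))))) Q k =
      qpoch Q Q k * (qpoch (G * Q ^ (n + 1)) Q k * (qpoch (B\<^sup>2 * Q ^ n) (Q\<^sup>2) k * (qpoch (B\<^sup>2 * Q ^ (n + 1)) (Q\<^sup>2) k *
        (qpoch (- B * r * Q ^ n) (Q\<^sup>2) k * qpoch (- B * r * Q ^ (n + 1)) (Q\<^sup>2) k))))"
    unfolding append_Cons append_Nil cons pms pms0 sq ..
  have n1: "qpochs ([G\<^sup>2] @ pm B @ [B * r]) Q n = qpoch (G\<^sup>2) Q n * (qpoch B Q n * (qpoch (- B) Q n * qpoch (B * r) Q n))"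
    by (simp add: qpochs_def pm_def)
  have n2: "qpochs [B\<^sup>2, - B * r, Q * G, Q] Q n = qpoch (B\<^sup>2) Q n * (qpoch (- B * r) Q n * (qpoch (Q * G) Q n * qpoch Q Q n))"
    by (simp add: qpochs_def)
  have b4: "b ^ 4 = B\<^sup>2"
    unfolding b[symmetric] by (simp add: power_mult[symmetric])
  have s: "gf_scale m b (- r) = qpoch (- B) Q m * qpoch (B * r) Q m / (qpoch (B\<^sup>2) Q m * qpoch (- B * r) Q m)" for m
    unfolding gf_scale_def qpoch_double b b4 power2_minus r by simp
  have pr: "(\<Prod>j<k. G - B * Q ^ j) = G ^ k * qpoch (B * inverse G) Q k"
  proof -
    have "(\<Prod>j<k. G - B * Q ^ j) = (\<Prod>j<k. G * (1 - B * inverse G * Q ^ j))"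
      using G by (intro prod.cong) (simp_all add: field_simps)
    then show ?thesis
      by (simp add: prod.distrib qpoch_def)
  qed
  have QG: "Q * G * Q ^ n = G * Q ^ (n + 1)"
    by simp
  have tt: "t ^ (n + 2 * k) = t ^ n * (t\<^sup>2) ^ k"
    by (simp add: power_add power_mult)
  show ?thesis
    unfolding num den n1 n2 s mixed_value_def pr tt qpoch_add_double
    unfolding qpoch_add QG power_mult_distrib divide_inverse inverse_mult_distrib
    by (simp only: mult_ac)
qed

lemma Phi_eq_suminf:
  "Phi n B G Q t = (let b = csqrt B; r = csqrt Q; p4 = csqrt (csqrt Q) in
    \<Sum>k. qpochs ([B * inverse G, B * Q ^ n]
            @ pm (\<i> * (b * r ^ n)) @ pm (\<i> * (b * r ^ (n + 1)))
            @ pm (b * p4 ^ (2 * n + 1)) @ pm (b * p4 ^ (2 * n + 3))) Q k /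
     qpochs (Q # ([G * Q ^ (n + 1)]
            @ pm (B * r ^ n) @ pm (B * r ^ (n + 1))
            @ pm (\<i> * (b * p4 ^ (2 * n + 1))) @ pm (\<i> * (b * p4 ^ (2 * n + 3))))) Q k * (G * t\<^sup>2) ^ k)"
proof -
  have "length (pm x) = 2" for x
    by (simp add: pm_def)
  then show ?thesis
    unfolding Phi_def Let_def basic_hyp_def length_append by simp
qed

theorem corollary23:
  fixes n :: nat and \<beta> \<gamma> q :: real and t :: complex
  assumes "\<beta> \<in> {-1<..<1} - {0}" and "\<gamma> \<in> {-1<..<1} - {0}"
    and "0 < \<bar>q\<bar>" and "\<bar>q\<bar> < 1"
    and "cmod t < min ((1 - \<beta>\<^sup>2) * (1 + sqrt \<bar>q\<bar> * \<bar>\<beta>\<bar>)) 1"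
  shows
    "((\<lambda>x::real.
        let e = exp (\<i> * complex_of_real (arccos x));
            b = csqrt (complex_of_real \<beta>); r = csqrt (complex_of_real q)
        in basic_hyp [b * e, - (r * b) * e] [- of_real \<beta> * r] (of_real q) (t * inverse e)
           * basic_hyp [r * b * inverse e, - b * inverse e] [- of_real \<beta> * r] (of_real q) (t * e)
           * rogers_C n x (of_real \<gamma>) (of_real q)
           * of_real (rogers_w x (of_real \<gamma>) (of_real q) / sqrt (1 - x\<^sup>2)))
      has_integral
        (let B = complex_of_real \<beta>; G = complex_of_real \<gamma>; Q = complex_of_real q; r = csqrt Q
         in 2 * of_real pi * t ^ n
            * (qpochs_inf [G, Q * G] Q * qpochs ([G\<^sup>2] @ pm B @ [B * r]) Q n)
            / (qpochs_inf [G\<^sup>2, Q] Q * qpochs [B\<^sup>2, - B * r, Q * G, Q] Q n)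
            * Phi n B G Q t))
      {-1..1}"
proof -
  define B G Q b r p4 where "B = complex_of_real \<beta>" and "G = complex_of_real \<gamma>" and "Q = complex_of_real q"
    and "b = csqrt B" and "r = csqrt Q" and "p4 = csqrt r"
  have b: "b\<^sup>2 = B" and r: "r\<^sup>2 = Q" and p4: "p4\<^sup>2 = r"
    by (simp_all add: b_def r_def p4_def)
  have Q: "norm Q < 1" "Q \<noteq> 0" and G: "norm G < 1" "G \<noteq> 0" and B: "norm B < 1" "B \<noteq> 0" and t: "norm t < 1"
    using assms by (auto simp: Q_def G_def B_def)
  have b1: "norm b < 1" "b \<noteq> 0"
    using B unfolding b[symmetric] by (auto simp: norm_power power_less_one_iff)
  have p: "- r \<noteq> 0" "(- r)\<^sup>2 = Q"
    using Q r by auto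
  define A where "A = (\<lambda>k. qpochs ([B * inverse G, B * Q ^ n]
            @ pm (\<i> * (b * r ^ n)) @ pm (\<i> * (b * r ^ (n + 1)))
            @ pm (b * p4 ^ (2 * n + 1)) @ pm (b * p4 ^ (2 * n + 3))) Q k /
     qpochs (Q # ([G * Q ^ (n + 1)]
            @ pm (B * r ^ n) @ pm (B * r ^ (n + 1))
            @ pm (\<i> * (b * p4 ^ (2 * n + 1))) @ pm (\<i> * (b * p4 ^ (2 * n + 3))))) Q k * (G * t\<^sup>2) ^ k)"
  have Phi: "Phi n B G Q t = suminf A"
    unfolding Phi_eq_suminf Let_def A_def b_def[symmetric] r_def[symmetric] p4_def[symmetric] ..
  define c where "c = 2 * of_real pi * t ^ n * (qpochs_inf [G, Q * G] Q * qpochs ([G\<^sup>2] @ pm B @ [B * r]) Q n)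
            / (qpochs_inf [G\<^sup>2, Q] Q * qpochs [B\<^sup>2, - B * r, Q * G, Q] Q n)"
  have coeff: "of_real pi * moment G Q 0 * (t ^ (n + 2 * k) * gf_scale (n + 2 * k) b (- r) * mixed_value (b\<^sup>2) G Q k n) =
      c * A k" for k
  proof -
    have qinf: "qpochs_inf [x, y] Q = qpoch_inf x Q * qpoch_inf y Q" for x y
      by (simp add: qpochs_inf_def)
    show ?thesis
      unfolding b mixed_series_term[OF b r p4 G(2)] A_def moment_0[OF Q(1) G(1)] c_def qinf
        divide_inverse inverse_mult_distrib
      by (simp only: mult_ac)
  qed
  note main = gf_integral[OF Q(1) p b1(2,1) G(1) t, of n, unfolded coeff]
  \<comment> \<open>For \<open>c = 0\<close> summability of \<open>A\<close> is not at hand, but both sides are \<open>0\<close>.\<close>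
  have sum: "(\<Sum>k. c * A k) = c * suminf A"
    using main(1) by (cases "c = 0") (simp_all add: suminf_mult)
  have swap: "basic_hyp [u, v] [w] Q z = basic_hyp [v, u] [w] Q z" for u v w z
    unfolding basic_hyp_2_1 by (simp only: mult.commute)
  have integrand: "basic_hyp [b * cis (arccos x), b * cis (arccos x) * - r] [b\<^sup>2 * - r] Q (t * inverse (cis (arccos x))) *
            basic_hyp [- b * inverse (cis (arccos x)), - b * inverse (cis (arccos x)) * - r] [b\<^sup>2 * - r] Q (t * cis (arccos x)) *
            rogers n G Q (cis (arccos x)) * weight G Q (cis (arccos x)) * of_real (1 / sqrt (1 - x\<^sup>2)) =
      basic_hyp [b * cis (arccos x), - (r * b) * cis (arccos x)] [- B * r] Q (t * inverse (cis (arccos x)))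
           * basic_hyp [r * b * inverse (cis (arccos x)), - b * inverse (cis (arccos x))] [- B * r] Q (t * cis (arccos x))
           * rogers_C n x G Q
           * of_real (rogers_w x G Q / sqrt (1 - x\<^sup>2))" for x
  proof -
    define e where "e = cis (arccos x)"
    have 1: "b * e * - r = - (r * b) * e" "b\<^sup>2 * - r = - B * r" "- b * inverse e * - r = r * b * inverse e"
      unfolding b by simp_all
    have 2: "rogers n G Q e = rogers_C n x G Q"
      unfolding e_def cis_conv_exp by (rule rogers_C_eq_rogers[OF Q(2,1) G(2,1), symmetric])
    have 3: "weight G Q e = of_real (rogers_w x G Q)"
      unfolding e_def G_def Q_def using assms by (intro weight_eq_rogers_w) auto
    show ?thesis
      unfolding e_def[symmetric] 1 2 3 swap[of "- b * inverse e"]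
      by (simp only: mult.assoc of_real_mult[symmetric] times_divide_eq_right mult_1_right)
  qed
  show ?thesis
    using main(2) unfolding sum integrand Let_def cis_conv_exp[symmetric]
      B_def[symmetric] G_def[symmetric] Q_def[symmetric] b_def[symmetric] r_def[symmetric] Phi c_def[symmetric] .
qed

end
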